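(* Let $\ell \neq 3$ be a prime. Then there are only finitely many (up to isomorphism) cyclic number fields $F$ of degree $\ell$ such that $F$ is exceptional, i.e. such that the unit equation $\lambda + \mu = 1$ has a solution with $\lambda, \mu \in \mathcal{O}_F^\times$.
   Context: For a number field $F$, $\mathcal{O}_F$ denotes its ring of integers and $\mathcal{O}_F^\times$ its unit group. A unit $\lambda \in \mathcal{O}_F^\times$ is called exceptional if $1-\lambda \in \mathcal{O}_F^\times$; $F$ is called exceptional if it possesses an exceptional unit, equivalently if the unit equation $\lambda+\mu=1$, $\lambda,\mu\in\mathcal{O}_F^\times$, has a solution. A cyclic number field is a finite Galois extension of $\mathbb{Q}$ whose Galois group is cyclic. *)

theory Defs
  imports
    Complex_Main
    "HOL-Computational_Algebra.Computational_Algebra"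
    "HOL-Algebra.Bij"
    "HOL-Algebra.Elementary_Groups"
begin

text \<open>
  Number fields are taken to be subfields of the complex numbers of finite degree over the
  rationals; every abstract number field is isomorphic to one of these.
\<close>

definition complex_subfield :: "complex set \<Rightarrow> bool" where
  "complex_subfield K \<longleftrightarrow>
     1 \<in> K \<and> (\<forall>x\<in>K. \<forall>y\<in>K. x - y \<in> K \<and> x * y \<in> K) \<and> (\<forall>x\<in>K. inverse x \<in> K)"

interpretation rat_vs: vector_space "\<lambda>(q::rat) (x::complex). of_rat q * x"
  by unfold_locales (simp_all add: algebra_simps of_rat_add of_rat_mult)

definition number_field :: "complex set \<Rightarrow> bool" where
  "number_field K \<longleftrightarrow> complex_subfield K \<and> (\<exists>B. finite B \<and> rat_vs.span B = K)"

definition degree_over_rat :: "complex set \<Rightarrow> nat" where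
  "degree_over_rat K = rat_vs.dim K"

definition field_iso :: "complex set \<Rightarrow> complex set \<Rightarrow> (complex \<Rightarrow> complex) \<Rightarrow> bool" where
  "field_iso K L f \<longleftrightarrow> bij_betw f K L \<and> f 1 = 1 \<and>
     (\<forall>x\<in>K. \<forall>y\<in>K. f (x + y) = f x + f y \<and> f (x * y) = f x * f y)"

definition number_field_iso_rel :: "(complex set \<times> complex set) set" where
  "number_field_iso_rel = {(K, L). number_field K \<and> number_field L \<and> (\<exists>f. field_iso K L f)}"

text \<open>
  Every automorphism of a field of characteristic zero fixes the rationals, so the group of all
  automorphisms of \<open>K\<close> is the automorphism group of \<open>K\<close> over the rationals.
  As in \<^const>\<open>BijGroup\<close>, maps are extensional, i.e. fixed to a dummy value outside \<open>K\<close>,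
  and the group operation is composition.
\<close>

definition galois_group :: "complex set \<Rightarrow> (complex \<Rightarrow> complex) monoid" where
  "galois_group K = (BijGroup K) \<lparr>carrier := {\<sigma> \<in> Bij K. field_iso K K \<sigma>}\<rparr>"

definition galois_over_rat :: "complex set \<Rightarrow> bool" where
  "galois_over_rat K \<longleftrightarrow> {x \<in> K. \<forall>\<sigma>\<in>carrier (galois_group K). \<sigma> x = x} = \<rat>"

definition cyclic_number_field :: "complex set \<Rightarrow> bool" where
  "cyclic_number_field K \<longleftrightarrow>
     number_field K \<and> galois_over_rat K \<and> cyclic_group (galois_group K)"

definition ring_of_integers :: "complex set \<Rightarrow> complex set" where
  "ring_of_integers K = {x \<in> K. algebraic_int x}"

definition unit_group :: "complex set \<Rightarrow> complex set" where
  "unit_group K = {x \<in> ring_of_integers K. \<exists>y \<in> ring_of_integers K. x * y = 1}"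

definition exceptional_unit :: "complex set \<Rightarrow> complex \<Rightarrow> bool" where
  "exceptional_unit K u \<longleftrightarrow> u \<in> unit_group K \<and> 1 - u \<in> unit_group K"

definition exceptional :: "complex set \<Rightarrow> bool" where
  "exceptional K \<longleftrightarrow> (\<exists>u. exceptional_unit K u)"

lemma exceptional_iff_unit_equation:
  "exceptional K \<longleftrightarrow> (\<exists>u \<in> unit_group K. \<exists>v \<in> unit_group K. u + v = 1)"
proof -
  have "v = 1 - u \<longleftrightarrow> u + v = 1" for u v :: complex
    by (auto simp: algebra_simps)
  then show ?thesis
    unfolding exceptional_def exceptional_unit_def by metis
qed

lemma complex_subfield_add:
  assumes "complex_subfield K" "x \<in> K" "y \<in> K"
  shows "x + y \<in> K"
proof -
  have "1 - 1 \<in> K" using assms(1) unfolding complex_subfield_def by blast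
  then have "0 - y \<in> K" using assms unfolding complex_subfield_def by fastforce
  then have "x - (0 - y) \<in> K" using assms unfolding complex_subfield_def by blast
  then show ?thesis by simp
qed

lemma field_iso_inv:
  assumes K: "complex_subfield K" and f: "field_iso K L f"
  shows "field_iso L K (inv_into K f)"
proof -
  let ?g = "inv_into K f"
  have b: "bij_betw f K L" and f1: "f 1 = 1"
    and hom: "\<And>x y. x \<in> K \<Longrightarrow> y \<in> K \<Longrightarrow> f (x + y) = f x + f y \<and> f (x * y) = f x * f y"
    using f unfolding field_iso_def by auto
  have gf: "?g (f x) = x" if "x \<in> K" for x using b that by (simp add: bij_betw_inv_into_left)
  have one: "1 \<in> K" using K unfolding complex_subfield_def by blast
  have g1: "?g 1 = 1" using gf[OF one] f1 by simp
  have gh: "?g (x + y) = ?g x + ?g y \<and> ?g (x * y) = ?g x * ?g y" if xy: "x \<in> L" "y \<in> L" for x y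
  proof -
    obtain a c where ac: "a \<in> K" "c \<in> K" "x = f a" "y = f c"
      using b xy unfolding bij_betw_def by blast
    have "a + c \<in> K" using complex_subfield_add[OF K] ac by blast
    moreover have "a * c \<in> K" using K ac unfolding complex_subfield_def by blast
    ultimately show ?thesis
      using gf[of "a + c"] gf[of "a * c"] gf[of a] gf[of c] hom[of a c] ac by simp
  qed
  show ?thesis
    unfolding field_iso_def using bij_betw_inv_into[OF b] g1 gh by blast
qed

lemma field_iso_comp:
  assumes f: "field_iso K L f" and g: "field_iso L M g"
  shows "field_iso K M (g \<circ> f)"
proof -
  have "f x \<in> L" if "x \<in> K" for x using f that unfolding field_iso_def bij_betw_def by blast
  then show ?thesis
    using f g unfolding field_iso_def by (auto intro: bij_betw_trans)
qed

lemma field_iso_cong: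
  assumes K: "complex_subfield K" and "field_iso K L f" and eq: "\<And>x. x \<in> K \<Longrightarrow> g x = f x"
  shows "field_iso K L g"
proof -
  have "x + y \<in> K" "x * y \<in> K" if "x \<in> K" "y \<in> K" for x y
    using complex_subfield_add[OF K] K that unfolding complex_subfield_def by blast+
  moreover have "1 \<in> K" using K unfolding complex_subfield_def by blast
  moreover have "bij_betw g K L"
    using assms(2) eq bij_betw_cong[of K g f L] unfolding field_iso_def by blast
  ultimately show ?thesis
    using assms(2) eq unfolding field_iso_def by simp
qed

lemma equiv_number_field_iso_rel: "equiv {K. number_field K} number_field_iso_rel"
proof (rule equivI)
  show "number_field_iso_rel \<subseteq> {K. number_field K} \<times> {K. number_field K}"
    unfolding number_field_iso_rel_def by auto
  have "field_iso K K id" for K unfolding field_iso_def by auto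
  then show "refl_on {K. number_field K} number_field_iso_rel"
    unfolding refl_on_def number_field_iso_rel_def by auto
  show "sym number_field_iso_rel"
    unfolding sym_def number_field_iso_rel_def number_field_def using field_iso_inv by blast
  show "trans number_field_iso_rel"
    unfolding trans_def number_field_iso_rel_def using field_iso_comp by blast
qed

lemma group_galois_group:
  assumes K: "complex_subfield K"
  shows "group (galois_group K)"
proof -
  interpret B: group "BijGroup K" by (rule group_BijGroup)
  let ?A = "{\<sigma> \<in> Bij K. field_iso K K \<sigma>}"
  have "subgroup ?A (BijGroup K)"
  proof (rule B.subgroupI)
    show "?A \<subseteq> carrier (BijGroup K)" by (auto simp: BijGroup_def)
    have "field_iso K K id" unfolding field_iso_def by auto
    then have "field_iso K K (\<lambda>x\<in>K. x)" by (rule field_iso_cong[OF K]) simp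
    then show "?A \<noteq> {}" using id_Bij by blast
  next
    fix a assume a: "a \<in> ?A"
    have "inv\<^bsub>BijGroup K\<^esub> a = (\<lambda>x\<in>K. inv_into K a x)"
      using a inv_BijGroup by blast
    moreover have "field_iso K K (\<lambda>x\<in>K. inv_into K a x)"
      by (rule field_iso_cong[OF K, of K "inv_into K a"]) (use field_iso_inv[OF K, of K a] a in auto)
    ultimately show "inv\<^bsub>BijGroup K\<^esub> a \<in> ?A"
      using a restrict_inv_into_Bij by auto
  next
    fix a b assume ab: "a \<in> ?A" "b \<in> ?A"
    have "field_iso K K (compose K a b)"
      by (rule field_iso_cong[OF K, of K "a \<circ> b"])
        (use field_iso_comp[of K K b K a] ab in \<open>auto simp: compose_def\<close>)
    then show "a \<otimes>\<^bsub>BijGroup K\<^esub> b \<in> ?A"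
      using ab compose_Bij by (auto simp: BijGroup_def)
  qed
  then show ?thesis
    unfolding galois_group_def by (rule B.subgroup_imp_group)
qed

end

theory Submission
  imports Defs "Jordan_Normal_Form.Char_Poly"
begin

text \<open>
  A prime \<open>p\<close> ramified in a cyclic field \<open>K\<close> of prime degree \<open>l\<close> has a prime \<open>P\<close> above it on
  whose residue field the Galois group acts trivially, so the norm of an integer \<open>w\<close> is congruent to
  \<open>w ^ l\<close> modulo \<open>P\<close>. For an exceptional unit \<open>u\<close> both \<open>u ^ l\<close> and \<open>(1 - u) ^ l\<close> are then
  congruent to \<open>\<plusminus>1\<close>, so \<open>p\<close> divides one of four resultants. These are nonzero for \<open>l \<noteq> 3\<close>, since
  \<open>X ^ l = \<plusminus>1\<close> and \<open>(1 - X) ^ l = \<plusminus>1\<close> can only have primitive sixth roots of unity in common. Hence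
  the ramified primes divide an integer \<open>r\<close> depending on \<open>l\<close> alone.

  Instead of bounding the discriminant and quoting Hermite's theorem, one works with the dual
  lattice of the ring of integers under the trace form. Its covolume is at most one, so it contains
  an irrational element whose conjugates are bounded in terms of \<open>l\<close>. Because \<open>P\<close> is locally
  principal, \<open>l * r\<close> maps the dual lattice into the ring of integers, which gives an integral
  generator of \<open>K\<close> with bounded conjugates (\<open>K\<close> is totally real for odd \<open>l\<close>). For \<open>l = 2\<close> the
  exceptional unit itself is a root of one of finitely many quadratic polynomials.
\<close>

section \<open>Algebraic integers\<close>

text \<open>Ramification is never defined by factoring ideals. It is detected as a degeneration of
  the trace form: if \<open>x\<close> lies in the dual lattice, \<open>g\<close> is its least
  denominator and a prime \<open>p\<close> divides \<open>g\<close>, then \<open>y = g * x\<close>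
  is not in \<open>pR p\<close> although \<open>tr (y * z)\<close> is divisible by \<open>p\<close>
  for all algebraic integers \<open>z\<close> of \<open>K\<close>. This is a linear relation modulo
  \<open>p\<close> among the conjugations, and a shortest such relation makes two of them agree
  modulo an ideal. Prime degree is essential here: the quotient of two distinct conjugations
  generates the whole group, so that all of them become trivial modulo one proper ideal. The
  exponent \<open>s\<close> of \<open>p\<close> in \<open>g\<close> is then bounded by the trace of
  a multiple of \<open>p\<close>, which yields \<open>p ^ s dvd p * l\<close>; this is why
  \<open>r\<close> is needed only to the first power and why the extra \<open>l\<close> appears.
  Finally, a nonrational \<open>y\<close> determines \<open>K\<close> as a subset of the complex
  numbers, so a bound for integral generators counts the fields themselves.\<close>

definition int_span :: "complex set \<Rightarrow> complex set" where
  "int_span S = {\<Sum>t\<in>S. of_int (f t) * t | f. True}"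

lemma int_span_base: "finite S \<Longrightarrow> s \<in> S \<Longrightarrow> s \<in> int_span S"
  unfolding int_span_def
proof -
  assume "finite S" "s \<in> S"
  then have "(\<Sum>t\<in>S. of_int (if t = s then 1 else 0) * t) = (\<Sum>t\<in>S. if t = s then t else 0)"
    by (intro sum.cong) auto
  also have "\<dots> = s" using \<open>finite S\<close> \<open>s \<in> S\<close> by simp
  finally show "s \<in> {\<Sum>t\<in>S. of_int (f t) * t |f. True}"
    by (intro CollectI exI[of _ "\<lambda>t. if t = s then 1 else 0"]) simp
qed

lemma int_span_add: "x \<in> int_span S \<Longrightarrow> y \<in> int_span S \<Longrightarrow> x + y \<in> int_span S"
proof -
  assume "x \<in> int_span S" "y \<in> int_span S"
  then obtain f g where "x = (\<Sum>t\<in>S. of_int (f t) * t)" "y = (\<Sum>t\<in>S. of_int (g t) * t)"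
    unfolding int_span_def by auto
  then have "x + y = (\<Sum>t\<in>S. of_int (f t + g t) * t)" by (simp add: sum.distrib algebra_simps)
  then show ?thesis unfolding int_span_def by (intro CollectI exI[of _ "\<lambda>t. f t + g t"]) auto
qed

lemma int_span_of_int_mult: "x \<in> int_span S \<Longrightarrow> of_int k * x \<in> int_span S"
proof -
  assume "x \<in> int_span S"
  then obtain f where "x = (\<Sum>t\<in>S. of_int (f t) * t)" unfolding int_span_def by auto
  then have "of_int k * x = (\<Sum>t\<in>S. of_int (k * f t) * t)" by (simp add: sum_distrib_left mult.assoc)
  then show ?thesis unfolding int_span_def by (intro CollectI exI[of _ "\<lambda>t. k * f t"]) auto
qed

lemma int_span_0: "0 \<in> int_span S"
  unfolding int_span_def by (rule CollectI, rule exI[of _ "\<lambda>_. 0"]) simp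

lemma int_span_sum: "(\<And>i. i \<in> I \<Longrightarrow> f i \<in> int_span S) \<Longrightarrow> (\<Sum>i\<in>I. f i) \<in> int_span S"
  by (induction I rule: infinite_finite_induct) (auto intro: int_span_add int_span_0)

lemma int_span_mult_closed:
  assumes "\<And>s. s \<in> S \<Longrightarrow> z * s \<in> int_span S" and "x \<in> int_span S"
  shows "z * x \<in> int_span S"
proof -
  from assms(2) obtain f where "x = (\<Sum>t\<in>S. of_int (f t) * t)" unfolding int_span_def by auto
  then have "z * x = (\<Sum>t\<in>S. of_int (f t) * (z * t))" by (simp add: sum_distrib_left algebra_simps)
  then show ?thesis using assms(1) by (auto intro: int_span_sum int_span_of_int_mult)
qed

text \<open>Such a \<open>z\<close> is an eigenvalue of an integer matrix.\<close>

lemma algebraic_int_if_stabilizes: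
  assumes fin: "finite S" and s0: "s0 \<in> S" "s0 \<noteq> 0"
    and stab: "\<And>s. s \<in> S \<Longrightarrow> z * s \<in> int_span S"
  shows "algebraic_int z"
proof -
  obtain h where h: "bij_betw h {..<card S} S"
    using ex_bij_betw_nat_finite[OF fin] unfolding atLeast0LessThan by blast
  define n where "n = card S"
  note h = h[folded n_def]
  have "\<forall>i<n. \<exists>f. z * h i = (\<Sum>t\<in>S. of_int (f t) * t)"
    using stab h unfolding int_span_def bij_betw_def by blast
  then obtain F where F: "\<And>i. i < n \<Longrightarrow> z * h i = (\<Sum>t\<in>S. of_int (F i t) * t)" by metis
  have F': "z * h i = (\<Sum>j<n. of_int (F i (h j)) * h j)" if "i < n" for i
    using F[OF that] sum.reindex_bij_betw[OF h, of "\<lambda>t. of_int (F i t) * t"] by simp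
  define A where "A = mat n n (\<lambda>(i,j). F i (h j))"
  let ?A = "map_mat of_int A :: complex mat"
  let ?v = "vec n h"
  have A: "A \<in> carrier_mat n n" "?A \<in> carrier_mat n n" unfolding A_def by auto
  have "?v \<noteq> 0\<^sub>v n"
  proof
    assume *: "?v = 0\<^sub>v n"
    obtain i where "i < n" "h i = s0" using h s0 unfolding bij_betw_def by auto
    then show False using * s0 by (metis index_vec index_zero_vec(1))
  qed
  moreover have "?A *\<^sub>v ?v = z \<cdot>\<^sub>v ?v"
  proof (rule eq_vecI)
    fix i assume "i < dim_vec (z \<cdot>\<^sub>v ?v)"
    then have i: "i < n" by simp
    then have "(?A *\<^sub>v ?v) $ i = (\<Sum>j = 0..<n. of_int (F i (h j)) * h j)"
      unfolding A_def by (auto simp: scalar_prod_def intro!: sum.cong)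
    then show "(?A *\<^sub>v ?v) $ i = (z \<cdot>\<^sub>v ?v) $ i" using F'[OF i] i by (simp add: atLeast0LessThan)
  qed (simp add: A_def)
  ultimately have "eigenvector ?A ?v z" unfolding eigenvector_def using A by auto
  then have "poly (char_poly ?A) z = 0"
    using eigenvalue_root_char_poly[OF A(2)] unfolding eigenvalue_def by blast
  moreover have "char_poly ?A = map_poly of_int (char_poly A)"
    using of_int_hom.char_poly_hom[OF A(1)] by simp
  moreover have "lead_coeff (char_poly A) = 1" using degree_monic_char_poly[OF A(1)] by auto
  ultimately show ?thesis unfolding algebraic_int_altdef_ipoly by metis
qed

lemma algebraic_int_power_relation:
  assumes "algebraic_int (x::complex)"
  shows "\<exists>n>0. \<exists>a. x ^ n = (\<Sum>i<n. of_int (a i) * x ^ i)"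
proof -
  from assms obtain p where p: "poly (map_poly of_int p) x = 0" "lead_coeff p = 1"
    unfolding algebraic_int_altdef_ipoly by blast
  define n where "n = degree p"
  define b where "b = (\<Sum>i<n. of_int (coeff p i) * x ^ i)"
  have d: "degree (map_poly of_int p :: complex poly) = n" by (simp add: degree_map_poly n_def)
  have "(\<Sum>i\<le>n. of_int (coeff p i) * x ^ i) = 0"
    using p(1) by (simp add: poly_altdef coeff_map_poly degree_map_poly n_def)
  then have "b + x ^ n = 0"
    using p(2) sum.lessThan_Suc[of "\<lambda>i. of_int (coeff p i) * x ^ i" n]
    unfolding b_def lessThan_Suc_atMost by (simp add: n_def)
  then have eq: "x ^ n = - b"
    by (simp add: add_eq_0_iff)
  then have "n \<noteq> 0" unfolding b_def by (intro notI) simp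
  moreover have "x ^ n = (\<Sum>i<n. of_int (- coeff p i) * x ^ i)"
    unfolding eq b_def by (simp add: sum_negf)
  ultimately show ?thesis
    by (intro exI[of _ n] conjI exI[of _ "\<lambda>i. - coeff p i"]) simp_all
qed

text \<open>The monomials \<open>x ^ i * y ^ j\<close> below the degrees of the two monic relations
  work: a step past the last exponent is undone by the relation. A span stable under both numbers is
  stable under their sum and product.\<close>

lemma algebraic_int_common_span:
  assumes "algebraic_int (x::complex)" "algebraic_int y"
  shows "\<exists>S. finite S \<and> 1 \<in> S \<and> (\<forall>s\<in>S. x * s \<in> int_span S) \<and> (\<forall>s\<in>S. y * s \<in> int_span S)"
proof -
  obtain m a where m: "m > 0" "x ^ m = (\<Sum>i<m. of_int (a i) * x ^ i)"
    using algebraic_int_power_relation[OF assms(1)] by blast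
  obtain n b where n: "n > 0" "y ^ n = (\<Sum>i<n. of_int (b i) * y ^ i)"
    using algebraic_int_power_relation[OF assms(2)] by blast
  define S where "S = (\<lambda>(i,j). x ^ i * y ^ j) ` ({..<m} \<times> {..<n})"
  have fin: "finite S" unfolding S_def by simp
  have mem: "x ^ i * y ^ j \<in> int_span S" if "i < m" "j < n" for i j
    using that by (intro int_span_base[OF fin]) (auto simp: S_def)
  have "x * s \<in> int_span S" if "s \<in> S" for s
  proof -
    from that obtain i j where ij: "i < m" "j < n" "s = x ^ i * y ^ j" unfolding S_def by auto
    show ?thesis
    proof (cases "Suc i < m")
      case True
      then show ?thesis using mem[of "Suc i" j] ij by (simp add: mult.assoc)
    next
      case False
      then have "Suc i = m" using ij by simp
      then have "x * s = x ^ m * y ^ j" using ij by (simp add: mult.assoc flip: \<open>Suc i = m\<close>)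
      then have "x * s = (\<Sum>i<m. of_int (a i) * (x ^ i * y ^ j))"
        unfolding m(2) sum_distrib_right by (simp add: mult.assoc)
      then show ?thesis using mem ij by (auto intro!: int_span_sum int_span_of_int_mult)
    qed
  qed
  moreover have "y * s \<in> int_span S" if "s \<in> S" for s
  proof -
    from that obtain i j where ij: "i < m" "j < n" "s = x ^ i * y ^ j" unfolding S_def by auto
    show ?thesis
    proof (cases "Suc j < n")
      case True
      then show ?thesis using mem[of i "Suc j"] ij by (simp add: algebra_simps)
    next
      case False
      then have "Suc j = n" using ij by simp
      then have "y * s = x ^ i * y ^ n" using ij by (simp add: algebra_simps flip: \<open>Suc j = n\<close>)
      then have "y * s = (\<Sum>j<n. of_int (b j) * (x ^ i * y ^ j))"
        unfolding n(2) sum_distrib_left by (simp add: algebra_simps)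
      then show ?thesis using mem ij by (auto intro!: int_span_sum int_span_of_int_mult)
    qed
  qed
  moreover have "1 \<in> S" unfolding S_def using m n by (auto intro!: rev_image_eqI[of "(0,0)"])
  ultimately show ?thesis using fin by blast
qed

lemma algebraic_int_add: "algebraic_int (x::complex) \<Longrightarrow> algebraic_int y \<Longrightarrow> algebraic_int (x + y)"
proof -
  assume "algebraic_int x" "algebraic_int y"
  from algebraic_int_common_span[OF this] obtain S where S: "finite S" "1 \<in> S"
    "\<forall>s\<in>S. x * s \<in> int_span S" "\<forall>s\<in>S. y * s \<in> int_span S" by blast
  show ?thesis
    by (rule algebraic_int_if_stabilizes[OF S(1,2)])
      (use S in \<open>auto simp: distrib_right intro!: int_span_add\<close>)
qed

lemma algebraic_int_mult: "algebraic_int (x::complex) \<Longrightarrow> algebraic_int y \<Longrightarrow> algebraic_int (x * y)"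
proof -
  assume "algebraic_int x" "algebraic_int y"
  from algebraic_int_common_span[OF this] obtain S where S: "finite S" "1 \<in> S"
    "\<forall>s\<in>S. x * s \<in> int_span S" "\<forall>s\<in>S. y * s \<in> int_span S" by blast
  show ?thesis
    by (rule algebraic_int_if_stabilizes[OF S(1,2)])
      (use S int_span_mult_closed[of S x] in \<open>simp_all add: mult.assoc\<close>)
qed

text \<open>The span of \<open>\<theta> ^ i * a ^ j\<close> with \<open>i < k\<close> is stable under \<open>\<theta>\<close>.\<close>

lemma algebraic_int_of_power_diff:
  assumes "j < k" and a: "algebraic_int (\<theta> ^ k - \<theta> ^ j :: complex)"
  shows "algebraic_int \<theta>"
proof -
  define a where "a = \<theta> ^ k - \<theta> ^ j"
  obtain n b where n: "n > 0" "a ^ n = (\<Sum>i<n. of_int (b i) * a ^ i)"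
    using algebraic_int_power_relation assms unfolding a_def by blast
  define S where "S = (\<lambda>(i,j). \<theta> ^ i * a ^ j) ` ({..<k} \<times> {..<n})"
  have fin: "finite S" unfolding S_def by simp
  have mem: "\<theta> ^ i * a ^ j \<in> int_span S" if "i < k" "j < n" for i j
    using that by (intro int_span_base[OF fin]) (auto simp: S_def)
  have mem': "\<theta> ^ i * a ^ n \<in> int_span S" if "i < k" for i
  proof -
    have "\<theta> ^ i * a ^ n = (\<Sum>j<n. of_int (b j) * (\<theta> ^ i * a ^ j))"
      unfolding n(2) sum_distrib_left by (simp add: algebra_simps)
    then show ?thesis using mem that by (auto intro!: int_span_sum int_span_of_int_mult)
  qed
  show ?thesis
  proof (rule algebraic_int_if_stabilizes[OF fin])
    show "1 \<in> S" unfolding S_def using n assms by (auto intro!: rev_image_eqI[of "(0,0)"])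
    fix s assume "s \<in> S"
    then obtain i q where iq: "i < k" "q < n" "s = \<theta> ^ i * a ^ q" unfolding S_def by auto
    show "\<theta> * s \<in> int_span S"
    proof (cases "Suc i < k")
      case True
      then show ?thesis using mem[of "Suc i" q] iq by (simp add: mult.assoc)
    next
      case False
      then have "Suc i = k" using iq by simp
      then have "\<theta> * s = \<theta> ^ k * a ^ q" using iq by (simp add: mult.assoc flip: \<open>Suc i = k\<close>)
      \<comment> \<open>At the last power, \<open>\<theta> ^ k\<close> is traded for
        \<open>\<theta> ^ j\<close> at the cost of one more factor \<open>a\<close>, which the
        integrality of \<open>a\<close> absorbs.\<close>
      also have "\<theta> ^ k = a + \<theta> ^ j" unfolding a_def by simp
      finally have "\<theta> * s = \<theta> ^ 0 * a ^ Suc q + \<theta> ^ j * a ^ q" by (simp add: algebra_simps)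
      moreover have "\<theta> ^ 0 * a ^ Suc q \<in> int_span S"
        proof (cases "Suc q < n")
        case True
        then show ?thesis using mem[of 0 "Suc q"] iq by simp
      next
        case False
        then have "Suc q = n" using iq by simp
        then show ?thesis using mem'[of 0] iq by simp
      qed
      ultimately show ?thesis using mem[of j q] assms iq by (auto intro: int_span_add)
    qed
  qed simp
qed

section \<open>Linear forms in integers\<close>

text \<open>Row \<open>k\<close> has the single nonzero entry \<open>v k\<close>, whose minor is an
  identity matrix. This serves the elimination step in \<open>pivot_triangularization\<close> and
  Cramer's rule in \<open>D_replace\<close>.\<close>

lemma det_unit_columns_except:
  fixes v :: "nat \<Rightarrow> 'a :: comm_ring_1"
  assumes k: "k < n"
  shows "det (mat n n (\<lambda>(i,j). if j = k then v i else if i = j then 1 else 0)) = v k"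
proof -
  let ?M = "mat n n (\<lambda>(i,j). if j = k then v i else if i = j then 1 else 0)"
  have M: "?M \<in> carrier_mat n n" by simp
  have "mat_delete ?M k k = 1\<^sub>m (n - 1)"
    by (rule eq_matI) (auto simp: mat_delete_def)
  then have c: "cofactor ?M k k = 1" unfolding cofactor_def by simp
  have "det ?M = (\<Sum>j<n. ?M $$ (k,j) * cofactor ?M k j)"
    by (rule laplace_expansion_row[OF M k])
  also have "\<dots> = (\<Sum>j<n. if j = k then v k else 0)"
    using k c by (intro sum.cong) auto
  also have "\<dots> = v k" using k by simp
  finally show ?thesis .
qed

text \<open>Gaussian elimination with partial pivoting on the last column: the multipliers are at
  most 1 in absolute value, so each original form is a combination of triangular forms with
  coefficients in \<open>[-1, 1]\<close>. The triangular shape later allows the integers to be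
  chosen one at a time.\<close>

lemma pivot_triangularization:
  fixes A :: "nat \<Rightarrow> nat \<Rightarrow> real"
  assumes "det (mat n n (\<lambda>(i,j). A i j)) \<noteq> 0"
  shows "\<exists>T. (\<forall>j<n. T j j \<noteq> 0) \<and> \<bar>\<Prod>j<n. T j j\<bar> = \<bar>det (mat n n (\<lambda>(i,j). A i j))\<bar> \<and>
    (\<forall>x. \<forall>i<n. \<bar>\<Sum>k<n. A i k * x k\<bar> \<le> (\<Sum>j<n. \<bar>\<Sum>k\<le>j. T j k * x k\<bar>))"
  using assms
proof (induction n arbitrary: A)
  case 0
  then show ?case by simp
next
  case (Suc n)
  let ?A = "mat (Suc n) (Suc n) (\<lambda>(i,j). A i j)"
  have cA: "?A \<in> carrier_mat (Suc n) (Suc n)" by simp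
  have "Max ((\<lambda>i. \<bar>A i n\<bar>) ` {..n}) \<in> (\<lambda>i. \<bar>A i n\<bar>) ` {..n}" by (rule Max_in) auto
  then obtain i0 where i0: "i0 \<le> n" and "Max ((\<lambda>i. \<bar>A i n\<bar>) ` {..n}) = \<bar>A i0 n\<bar>"
    by (metis (no_types, lifting) atMost_iff imageE)
  then have mx: "\<bar>A i n\<bar> \<le> \<bar>A i0 n\<bar>" if "i \<le> n" for i
    using Max_ge[of "(\<lambda>i. \<bar>A i n\<bar>) ` {..n}" "\<bar>A i n\<bar>"] that by auto
  have piv: "A i0 n \<noteq> 0"
  proof
    assume "A i0 n = 0"
    then have z: "A i n = 0" if "i \<le> n" for i using mx[OF that] by simp
    have "det ?A = (\<Sum>i<Suc n. ?A $$ (i,n) * cofactor ?A i n)"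
      by (rule laplace_expansion_column[OF cA]) simp
    also have "\<dots> = 0" by (rule sum.neutral) (auto simp: z)
    finally show False using Suc.prems by simp
  qed
  define r where "r i = A i n / A i0 n" for i
  have r: "\<bar>r i\<bar> \<le> 1" if "i \<le> n" for i using mx[OF that] piv by (simp add: r_def)
  define B where "B i j = (if i = i0 then A i j else A i j - r i * A i0 j)" for i j
  let ?B = "mat (Suc n) (Suc n) (\<lambda>(i,j). B i j)"
  let ?E = "mat (Suc n) (Suc n) (\<lambda>(i,j). if j = i0 then (if i = i0 then 1 else - r i) else if i = j then 1 else 0)"
  have detE: "det ?E = 1" using i0 by (subst det_unit_columns_except) auto
  have cE: "?E \<in> carrier_mat (Suc n) (Suc n)" and cB: "?B \<in> carrier_mat (Suc n) (Suc n)" by simp_all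
  have "?E * ?A = ?B"
  proof (rule eq_matI)
    fix i j assume "i < dim_row ?B" "j < dim_col ?B"
    then have ij: "i < Suc n" "j < Suc n" by auto
    have "(?E * ?A) $$ (i,j) = (\<Sum>k=0..<Suc n. (if k = i0 then (if i = i0 then 1 else - r i) else if i = k then 1 else 0) * A k j)"
      using ij by (simp add: scalar_prod_def del: sum.op_ivl_Suc)
    also have "\<dots> = (\<Sum>k=0..<Suc n. (if k = i0 then (if i = i0 then 1 else - r i) * A k j else 0) + (if k = i \<and> i \<noteq> i0 then A k j else 0))"
      by (intro sum.cong) auto
    also have "\<dots> = B i j"
      using ij i0 by (auto simp: sum.distrib B_def simp del: sum.op_ivl_Suc)
    finally show "(?E * ?A) $$ (i,j) = ?B $$ (i,j)" using ij by simp
  qed auto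
  then have detB: "det ?B = det ?A" using det_mult[OF cE cA] detE by simp
  have Bn: "B i n = 0" if "i \<noteq> i0" for i using that piv by (simp add: B_def r_def)
  have Bi0: "B i0 n = A i0 n" by (simp add: B_def)
  \<comment> \<open>\<open>s\<close> enumerates the rows other than the pivot row, in the order used
    by \<open>mat_delete\<close>.\<close>
  define s where "s i = (if i < i0 then i else Suc i)" for i
  define A' where "A' i j = B (s i) j" for i j
  let ?A' = "mat n n (\<lambda>(i,j). A' i j)"
  have "mat_delete ?B i0 n = ?A'"
    by (rule eq_matI) (auto simp: mat_delete_def A'_def s_def)
  then have cof: "\<bar>cofactor ?B i0 n\<bar> = \<bar>det ?A'\<bar>"
    unfolding cofactor_def by (simp add: abs_mult power_abs)
  have "det ?B = (\<Sum>i<Suc n. ?B $$ (i,n) * cofactor ?B i n)"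
    by (rule laplace_expansion_column[OF cB]) simp
  also have "\<dots> = (\<Sum>i<Suc n. if i = i0 then A i0 n * cofactor ?B i0 n else 0)"
    by (intro sum.cong) (auto simp: Bn Bi0)
  also have "\<dots> = A i0 n * cofactor ?B i0 n" using i0 by simp
  finally have dA: "\<bar>det ?A\<bar> = \<bar>A i0 n\<bar> * \<bar>det ?A'\<bar>" using detB cof by (simp add: abs_mult)
  then have "det ?A' \<noteq> 0" using Suc.prems by auto
  from Suc.IH[OF this] obtain T' where T': "\<And>j. j < n \<Longrightarrow> T' j j \<noteq> 0"
    "\<bar>\<Prod>j<n. T' j j\<bar> = \<bar>det ?A'\<bar>"
    "\<And>x i. i < n \<Longrightarrow> \<bar>\<Sum>k<n. A' i k * x k\<bar> \<le> (\<Sum>j<n. \<bar>\<Sum>k\<le>j. T' j k * x k\<bar>)"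
    by blast
  define T where "T j k = (if j = n then A i0 k else T' j k)" for j k
  have "\<forall>j<Suc n. T j j \<noteq> 0" using T' piv by (auto simp: T_def less_Suc_eq)
  moreover have "\<bar>\<Prod>j<Suc n. T j j\<bar> = \<bar>det ?A\<bar>"
    using T'(2) dA by (simp add: T_def abs_mult)
  moreover have "\<bar>\<Sum>k<Suc n. A i k * x k\<bar> \<le> (\<Sum>j<Suc n. \<bar>\<Sum>k\<le>j. T j k * x k\<bar>)"
    if i: "i < Suc n" for x i
  proof -
    have Tn: "(\<Sum>k\<le>n. T n k * x k) = (\<Sum>k<Suc n. A i0 k * x k)"
      by (simp add: T_def lessThan_Suc_atMost)
    have eq: "(\<Sum>j<Suc n. \<bar>\<Sum>k\<le>j. T j k * x k\<bar>)
      = (\<Sum>j<n. \<bar>\<Sum>k\<le>j. T' j k * x k\<bar>) + \<bar>\<Sum>k<Suc n. A i0 k * x k\<bar>"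
      unfolding sum.lessThan_Suc[of _ n] Tn[unfolded sum.lessThan_Suc[of _ n]] by (simp add: T_def)
    show ?thesis
    proof (cases "i = i0")
      case True
      then show ?thesis unfolding eq by (simp add: sum_nonneg)
    next
      case False
      define i' where "i' = (if i < i0 then i else i - 1)"
      have i': "i' < n" "s i' = i" using False i i0 by (auto simp: i'_def s_def)
      have "(\<Sum>k<Suc n. A i k * x k) = (\<Sum>k<Suc n. B i k * x k + r i * (A i0 k * x k))"
        using False by (intro sum.cong) (auto simp: B_def algebra_simps)
      also have "\<dots> = (\<Sum>k<Suc n. B i k * x k) + r i * (\<Sum>k<Suc n. A i0 k * x k)"
        by (simp only: sum.distrib sum_distrib_left)
      also have "(\<Sum>k<Suc n. B i k * x k) = (\<Sum>k<n. A' i' k * x k)"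
        using Bn[OF False] i' by (simp add: A'_def)
      finally have "\<bar>\<Sum>k<Suc n. A i k * x k\<bar>
        \<le> \<bar>\<Sum>k<n. A' i' k * x k\<bar> + \<bar>r i\<bar> * \<bar>\<Sum>k<Suc n. A i0 k * x k\<bar>"
        by (simp only: abs_mult[symmetric] abs_triangle_ineq)
      also have "\<dots> \<le> (\<Sum>j<n. \<bar>\<Sum>k\<le>j. T' j k * x k\<bar>) + 1 * \<bar>\<Sum>k<Suc n. A i0 k * x k\<bar>"
        using r[of i] i by (intro add_mono T'(3)[OF i'(1)] mult_right_mono) auto
      finally show ?thesis unfolding eq by simp
    qed
  qed
  ultimately show ?case by blast
qed

text \<open>Start at the first nonnegative value of \<open>c + t * n\<close>, in the direction in
  which it grows. Consecutive integers advance in steps of length \<open>\<bar>t\<bar>\<close>, so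
  the first \<open>m\<close> of them stay below \<open>R\<close>.\<close>

lemma integers_affine_in_interval:
  fixes c t R :: real
  assumes t: "t \<noteq> 0" and m: "real m * \<bar>t\<bar> \<le> R"
  shows "\<exists>f :: nat \<Rightarrow> int. inj f \<and> (\<forall>i<m. 0 \<le> c + t * real_of_int (f i) \<and> c + t * real_of_int (f i) < R)"
proof -
  define a where "a = \<lceil>- c / \<bar>t\<bar>\<rceil>"
  define f where "f i = (if t > 0 then a + int i else - (a + int i))" for i
  have tf: "t * f i = \<bar>t\<bar> * a + \<bar>t\<bar> * real i" for i using t by (auto simp: f_def algebra_simps)
  have "inj f" by (auto simp: inj_def f_def)
  moreover have "0 \<le> c + t * f i \<and> c + t * f i < R" if "i < m" for i
  proof
    have "\<bar>t\<bar> * (- c / \<bar>t\<bar>) \<le> \<bar>t\<bar> * a"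
      unfolding a_def by (intro mult_left_mono le_of_int_ceiling) auto
    then have lo: "- c \<le> \<bar>t\<bar> * a" using t by simp
    have "\<bar>t\<bar> * a < \<bar>t\<bar> * (- c / \<bar>t\<bar> + 1)"
      unfolding a_def using t by (intro mult_strict_left_mono) linarith+
    also have "\<dots> = - c + \<bar>t\<bar>" using t by (simp add: field_simps)
    finally have hi: "\<bar>t\<bar> * a < - c + \<bar>t\<bar>" .
    have "0 \<le> \<bar>t\<bar> * i" by simp
    then show "0 \<le> c + t * f i" using lo unfolding tf by linarith
    have "\<bar>t\<bar> * (real i + 1) \<le> \<bar>t\<bar> * m" using that by (intro mult_left_mono) auto
    then show "c + t * f i < R" using hi m unfolding tf distrib_left by (simp add: mult.commute)
  qed
  ultimately show ?thesis by blast
qed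

text \<open>Once the coordinates below \<open>n\<close> are chosen, the form of index
  \<open>n\<close> is affine in \<open>x n\<close> with slope \<open>T n n\<close>, so there are
  \<open>m n\<close> choices whatever came before, and the counts multiply. The value 0 beyond the
  first coordinates lets functions stand for vectors.\<close>

lemma triangular_lattice_points:
  fixes T :: "nat \<Rightarrow> nat \<Rightarrow> real"
  assumes "\<And>j. j < n \<Longrightarrow> T j j \<noteq> 0" and "\<And>j. j < n \<Longrightarrow> real (m j) * \<bar>T j j\<bar> \<le> R"
  shows "\<exists>X :: (nat \<Rightarrow> int) set. card X = (\<Prod>j<n. m j) \<and> (\<forall>x\<in>X. (\<forall>j\<ge>n. x j = 0) \<and>
    (\<forall>j<n. 0 \<le> (\<Sum>k\<le>j. T j k * x k) \<and> (\<Sum>k\<le>j. T j k * x k) < R))"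
  using assms
proof (induction n)
  case 0
  show ?case by (rule exI[of _ "{\<lambda>_. 0}"]) simp
next
  case (Suc n)
  from Suc.IH[OF Suc.prems(1)[OF less_SucI] Suc.prems(2)[OF less_SucI]]
  obtain X :: "(nat \<Rightarrow> int) set" where X: "card X = (\<Prod>j<n. m j)"
    "\<And>x j. x \<in> X \<Longrightarrow> j \<ge> n \<Longrightarrow> x j = 0"
    "\<And>x j. x \<in> X \<Longrightarrow> j < n \<Longrightarrow> 0 \<le> (\<Sum>k\<le>j. T j k * x k) \<and> (\<Sum>k\<le>j. T j k * x k) < R"
    by auto
  have "\<forall>x. \<exists>f :: nat \<Rightarrow> int. inj f \<and>
    (\<forall>i<m n. 0 \<le> (\<Sum>k<n. T n k * real_of_int (x k)) + T n n * real_of_int (f i) \<and> (\<Sum>k<n. T n k * real_of_int (x k)) + T n n * real_of_int (f i) < R)"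
    using Suc.prems[of n] by (intro allI integers_affine_in_interval) auto
  from choice[OF this] obtain F :: "(nat \<Rightarrow> int) \<Rightarrow> nat \<Rightarrow> int" where F: "\<And>x. inj (F x)"
    "\<And>x i. i < m n \<Longrightarrow> 0 \<le> (\<Sum>k<n. T n k * real_of_int (x k)) + T n n * real_of_int (F x i)
      \<and> (\<Sum>k<n. T n k * real_of_int (x k)) + T n n * real_of_int (F x i) < R"
    by auto
  define h where "h = (\<lambda>(x,i). x(n := F x i))"
  have "inj_on h (X \<times> {..<m n})"
  proof (rule inj_onI, clarify)
    fix x i y j assume x: "x \<in> X" "y \<in> X" and eq: "h (x, i) = h (y, j)"
    have "x k = y k" for k
    proof (cases "k = n")
      case False
      then show ?thesis using fun_cong[OF eq, of k] by (simp add: h_def)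
    qed (simp add: X(2) x)
    then have "x = y" by blast
    moreover have "F x i = F y j" using fun_cong[OF eq, of n] by (simp add: h_def)
    ultimately show "x = y \<and> i = j" using F(1) by (auto simp: inj_def)
  qed
  then have "card (h ` (X \<times> {..<m n})) = (\<Prod>j<Suc n. m j)"
    by (simp add: card_image card_cartesian_product X(1))
  moreover have "(\<forall>j\<ge>Suc n. z j = 0) \<and>
    (\<forall>j<Suc n. 0 \<le> (\<Sum>k\<le>j. T j k * z k) \<and> (\<Sum>k\<le>j. T j k * z k) < R)"
    if z: "z \<in> h ` (X \<times> {..<m n})" for z
  proof -
    from z obtain x i where xi: "x \<in> X" "i < m n" "z = x(n := F x i)" by (auto simp: h_def)
    have "(\<Sum>k\<le>j. T j k * z k) = (\<Sum>k\<le>j. T j k * x k)" if "j < n" for j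
      using that xi by (intro sum.cong) auto
    moreover have "(\<Sum>k\<le>n. T n k * z k) = (\<Sum>k<n. T n k * real_of_int (x k)) + T n n * real_of_int (F x i)"
      unfolding lessThan_Suc_atMost[symmetric] sum.lessThan_Suc using xi by simp
    ultimately show ?thesis
      using X(2,3)[OF xi(1)] F(2)[OF xi(2), of x] xi(3) by (auto simp: less_Suc_eq)
  qed
  ultimately show ?case by blast
qed

text \<open>A weak form of Minkowski's theorem on linear forms: many integer points have all triangular
  forms in \<open>{0..<N}\<close>, so two of them share a unit cell.\<close>

theorem small_integer_vector:
  fixes A :: "nat \<Rightarrow> nat \<Rightarrow> real"
  assumes d: "det (mat n n (\<lambda>(i,j). A i j)) \<noteq> 0" "\<bar>det (mat n n (\<lambda>(i,j). A i j))\<bar> < 1"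
  shows "\<exists>z :: nat \<Rightarrow> int. (\<exists>j<n. z j \<noteq> 0) \<and> (\<forall>i<n. \<bar>\<Sum>j<n. A i j * z j\<bar> \<le> n)"
proof -
  from pivot_triangularization[OF d(1)]
  obtain T where T: "\<And>j. j < n \<Longrightarrow> T j j \<noteq> 0" "\<bar>\<Prod>j<n. T j j\<bar> = \<bar>det (mat n n (\<lambda>(i,j). A i j))\<bar>"
    "\<And>x i. i < n \<Longrightarrow> \<bar>\<Sum>k<n. A i k * x k\<bar> \<le> (\<Sum>j<n. \<bar>\<Sum>k\<le>j. T j k * x k\<bar>)"
    by auto
  define t where "t j = 1 / \<bar>T j j\<bar>" for j
  have t: "t j > 0" if "j < n" for j using T(1)[OF that] by (simp add: t_def)
  have prod_t: "(\<Prod>j<n. t j) > 1"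
  proof -
    have "(\<Prod>j<n. t j) = 1 / \<bar>\<Prod>j<n. T j j\<bar>" by (simp add: t_def prod_dividef abs_prod)
    moreover have "\<bar>\<Prod>j<n. T j j\<bar> > 0" using T(1) by simp
    ultimately show ?thesis using T(2) d(2) by simp
  qed
  \<comment> \<open>Rounding the number of choices \<open>N * t j\<close> down loses less than one,
    which amounts to replacing \<open>t j\<close> by \<open>t j - 1 / N\<close>; for large
    \<open>N\<close> the product still exceeds 1.\<close>
  have "(\<lambda>N. \<Prod>j<n. t j - 1 / real N) \<longlonglongrightarrow> (\<Prod>j<n. t j - 0)"
    by (intro tendsto_intros lim_1_over_n)
  then have "\<forall>\<^sub>F N in sequentially. (\<Prod>j<n. t j - 1 / real N) > 1"
    using prod_t by (intro order_tendstoD(1)) auto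
  moreover have "\<forall>\<^sub>F N in sequentially. \<forall>j\<in>{..<n}. 1 / real N < t j"
    using t by (intro eventually_ball_finite ballI order_tendstoD(2)[OF lim_1_over_n]) auto
  ultimately have "\<forall>\<^sub>F N in sequentially. (\<Prod>j<n. t j - 1 / real N) > 1 \<and> (\<forall>j<n. 1 / real N < t j) \<and> N > 0"
    using eventually_gt_at_top[of "0::nat"] by eventually_elim auto
  from eventually_happens'[OF sequentially_bot this] obtain N :: nat where N: "(\<Prod>j<n. t j - 1 / real N) > 1" "\<And>j. j < n \<Longrightarrow> 1 / real N < t j" "N > 0"
    by auto
  define m where "m j = nat \<lfloor>real N * t j\<rfloor>" for j
  have m: "real (m j) * \<bar>T j j\<bar> \<le> real N" if "j < n" for j
  proof -
    have "real (m j) \<le> real N * t j" using t[OF that] by (simp add: m_def)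
    then have "real (m j) * \<bar>T j j\<bar> \<le> real N * t j * \<bar>T j j\<bar>" by (intro mult_right_mono) auto
    then show ?thesis using T(1)[OF that] by (simp add: t_def)
  qed
  from triangular_lattice_points[of n T m "real N", OF T(1) m]
  obtain X :: "(nat \<Rightarrow> int) set" where X: "card X = (\<Prod>j<n. m j)"
    "\<And>x j. x \<in> X \<Longrightarrow> j \<ge> n \<Longrightarrow> x j = 0"
    "\<And>x j. x \<in> X \<Longrightarrow> j < n \<Longrightarrow> 0 \<le> (\<Sum>k\<le>j. T j k * x k) \<and> (\<Sum>k\<le>j. T j k * x k) < N"
    by auto
  have "real N ^ n < (\<Prod>j<n. real N * (t j - 1 / real N))"
    using N by (simp add: prod.distrib)
  also have "\<dots> \<le> (\<Prod>j<n. real (m j))"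
  proof (rule prod_mono, safe)
    fix j assume j: "j < n"
    show "0 \<le> real N * (t j - 1 / real N)" using N(2)[OF j] by simp
    have "real N * (t j - 1 / real N) = real N * t j - 1" using N(3) by (simp add: algebra_simps)
    also have "\<dots> \<le> m j" unfolding m_def by linarith
    finally show "real N * (t j - 1 / real N) \<le> m j" .
  qed
  finally have big: "N ^ n < card X" unfolding X(1) by (simp flip: of_nat_power of_nat_prod)
  \<comment> \<open>\<open>h x\<close> is the unit cell containing the values of the triangular
    forms at \<open>x\<close>; there are \<open>N ^ n\<close> cells and more points.\<close>
  define h where "h x = (\<lambda>j\<in>{..<n}. \<lfloor>\<Sum>k\<le>j. T j k * real_of_int (x k)\<rfloor>)" for x
  have "h ` X \<subseteq> {..<n} \<rightarrow>\<^sub>E {0..<int N}"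
    using X(3) by (intro image_subsetI) (simp add: h_def restrict_PiE_iff floor_less_iff)
  then have "card (h ` X) \<le> card ({..<n} \<rightarrow>\<^sub>E {0..<int N})"
    by (intro card_mono finite_PiE) auto
  also have "\<dots> = N ^ n" by (simp add: card_PiE)
  finally have "\<not> inj_on h X" using big by (metis card_image not_le)
  then obtain x y where xy: "x \<in> X" "y \<in> X" "x \<noteq> y" "h x = h y" by (auto simp: inj_on_def)
  define z where "z j = x j - y j" for j
  have "\<exists>j<n. z j \<noteq> 0"
  proof (rule ccontr)
    assume "\<not> ?thesis"
    then have "x j = y j" for j using X(2)[OF xy(1)] X(2)[OF xy(2)] by (cases "j < n") (auto simp: z_def)
    then show False using xy(3) by blast
  qed
  moreover have "\<bar>\<Sum>j<n. A i j * z j\<bar> \<le> n" if i: "i < n" for i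
  proof -
    have "\<bar>\<Sum>k\<le>j. T j k * z k\<bar> \<le> 1" if j: "j < n" for j
    proof -
      have "\<lfloor>\<Sum>k\<le>j. T j k * x k\<rfloor> = \<lfloor>\<Sum>k\<le>j. T j k * y k\<rfloor>"
        using fun_cong[OF xy(4), of j] j by (simp add: h_def)
      moreover have "(\<Sum>k\<le>j. T j k * z k) = (\<Sum>k\<le>j. T j k * x k) - (\<Sum>k\<le>j. T j k * y k)"
        by (simp add: z_def algebra_simps sum_subtractf)
      ultimately show ?thesis by linarith
    qed
    then have "(\<Sum>j<n. \<bar>\<Sum>k\<le>j. T j k * z k\<bar>) \<le> (\<Sum>j<n. 1)" by (intro sum_mono) auto
    then show ?thesis using T(3)[OF i, of "\<lambda>k. real_of_int (z k)"] by simp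
  qed
  ultimately show ?thesis by blast
qed

section \<open>Determinants, polynomials and linear systems\<close>

lemma det_mem_subring:
  assumes A: "A \<in> carrier_mat n n"
    and "0 \<in> R" "1 \<in> R" "\<And>x y. x \<in> R \<Longrightarrow> y \<in> R \<Longrightarrow> x + y \<in> R" "\<And>x y. x \<in> R \<Longrightarrow> y \<in> R \<Longrightarrow> x * y \<in> R"
      "\<And>x. x \<in> R \<Longrightarrow> - x \<in> R"
    and ent: "\<And>i j. i < n \<Longrightarrow> j < n \<Longrightarrow> A $$ (i,j) \<in> R"
  shows "det A \<in> R"
proof -
  have prod_mem: "(\<Prod>i\<in>I. f i) \<in> R" if "\<And>i. i \<in> I \<Longrightarrow> f i \<in> R" for I :: "nat set" and f
    using that assms by (induction I rule: infinite_finite_induct) auto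
  have sum_mem: "(\<Sum>i\<in>I. f i) \<in> R" if "\<And>i. i \<in> I \<Longrightarrow> f i \<in> R" for I :: "(nat \<Rightarrow> nat) set" and f
    using that assms by (induction I rule: infinite_finite_induct) auto
  have "signof p * (\<Prod>i = 0..<n. A $$ (i, p i)) \<in> R" if "p permutes {0..<n}" for p
  proof -
    have "(\<Prod>i = 0..<n. A $$ (i, p i)) \<in> R"
      using that ent permutes_in_image[OF that] by (intro prod_mem) auto
    then show ?thesis using assms by (auto simp: sign_def)
  qed
  then show ?thesis unfolding det_def'[OF A] by (intro sum_mem) auto
qed

lemma adj_mat_mem_Rats:
  assumes A: "A \<in> carrier_mat n n" and ent: "\<And>i j. i < n \<Longrightarrow> j < n \<Longrightarrow> A $$ (i,j) \<in> (\<rat> :: complex set)"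
    and ij: "i < n" "j < n"
  shows "adj_mat A $$ (i,j) \<in> \<rat>"
proof -
  have "det (mat_delete A j i) \<in> \<rat>"
  proof (rule det_mem_subring[OF mat_delete_carrier[OF A]])
    fix a b assume "a < n - 1" "b < n - 1"
    then show "mat_delete A j i $$ (a,b) \<in> \<rat>"
      using A by (auto simp: mat_delete_def intro!: ent)
  qed auto
  then show ?thesis using A ij unfolding adj_mat_def cofactor_def by auto
qed

section \<open>Polynomials with prescribed roots\<close>

definition linear_factors :: "('i \<Rightarrow> complex) \<Rightarrow> 'i set \<Rightarrow> complex poly" where
  "linear_factors a A = (\<Prod>i\<in>A. [:- a i, 1:])"

lemma degree_linear_factors: "degree (linear_factors a A) = card A"
  unfolding linear_factors_def by (subst degree_prod_eq_sum_degree) auto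

lemma coeff_linear_factors_insert:
  assumes "finite A" "i \<notin> A"
  shows "coeff (linear_factors a (insert i A)) k
    = (if k = 0 then 0 else coeff (linear_factors a A) (k - 1)) - a i * coeff (linear_factors a A) k"
  using assms by (cases k) (auto simp: linear_factors_def)

lemma coeff_linear_factors_card: "finite A \<Longrightarrow> coeff (linear_factors a A) (card A) = 1"
proof (induction A rule: finite_induct)
  case (insert i A)
  then show ?case
    using degree_linear_factors[of a A] by (simp add: coeff_linear_factors_insert coeff_eq_0)
qed (simp add: linear_factors_def)

lemma poly_linear_factors_root: "finite A \<Longrightarrow> i \<in> A \<Longrightarrow> poly (linear_factors a A) (a i) = 0"
  by (auto simp: linear_factors_def poly_prod)

lemma poly_linear_factors_eq_0: "finite A \<Longrightarrow> poly (linear_factors a A) x = 0 \<Longrightarrow> \<exists>i\<in>A. x = a i"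
  by (auto simp: linear_factors_def poly_prod)

lemma coeff_linear_factors_mem_subring:
  assumes "finite A" and R: "0 \<in> R" "1 \<in> R" "\<And>x y. x \<in> R \<Longrightarrow> y \<in> R \<Longrightarrow> x - y \<in> R"
    "\<And>x y. x \<in> R \<Longrightarrow> y \<in> R \<Longrightarrow> x * y \<in> R"
    and "\<And>i. i \<in> A \<Longrightarrow> a i \<in> R"
  shows "coeff (linear_factors a A) k \<in> R"
  using assms(1,6)
proof (induction A arbitrary: k rule: finite_induct)
  case empty
  then show ?case using R by (cases k) (auto simp: linear_factors_def coeff_1)
next
  case (insert i A)
  then show ?case using R by (simp add: coeff_linear_factors_insert)
qed

text \<open>Every coefficient below the leading one is a signed sum of products with at least one
  root as a factor, hence lies in any ideal containing the roots.\<close>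

lemma coeff_linear_factors_mem_ideal:
  assumes "finite A" and R: "0 \<in> R" "1 \<in> R" "\<And>x y. x \<in> R \<Longrightarrow> y \<in> R \<Longrightarrow> x - y \<in> R"
    "\<And>x y. x \<in> R \<Longrightarrow> y \<in> R \<Longrightarrow> x * y \<in> R"
    and P: "P \<subseteq> R" "0 \<in> P" "\<And>x y. x \<in> P \<Longrightarrow> y \<in> P \<Longrightarrow> x - y \<in> P" "\<And>x y. x \<in> P \<Longrightarrow> y \<in> R \<Longrightarrow> x * y \<in> P"
    and "\<And>i. i \<in> A \<Longrightarrow> a i \<in> P" and "k < card A"
  shows "coeff (linear_factors a A) k \<in> P"
  using assms(1,10,11)
proof (induction A arbitrary: k rule: finite_induct)
  case (insert i A)
  have "coeff (linear_factors a A) k \<in> R"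
    using insert.hyps insert.prems P(1) by (intro coeff_linear_factors_mem_subring R) auto
  then have "a i * coeff (linear_factors a A) k \<in> P" using P(4) insert.prems by simp
  moreover have "(if k = 0 then 0 else coeff (linear_factors a A) (k - 1)) \<in> P"
    using insert P(2) by auto
  ultimately show ?case unfolding coeff_linear_factors_insert[OF insert.hyps] by (intro P(3))
qed simp

lemma coeff_linear_factors_hom:
  assumes "finite A" and R: "0 \<in> R" "1 \<in> R" "\<And>x y. x \<in> R \<Longrightarrow> y \<in> R \<Longrightarrow> x - y \<in> R"
    "\<And>x y. x \<in> R \<Longrightarrow> y \<in> R \<Longrightarrow> x * y \<in> R"
    and h: "h 0 = 0" "h 1 = 1" "\<And>x y. x \<in> R \<Longrightarrow> y \<in> R \<Longrightarrow> h (x - y) = h x - h y"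
      "\<And>x y. x \<in> R \<Longrightarrow> y \<in> R \<Longrightarrow> h (x * y) = h x * h y"
    and "\<And>i. i \<in> A \<Longrightarrow> a i \<in> R"
  shows "h (coeff (linear_factors a A) k) = coeff (linear_factors (\<lambda>i. h (a i)) A) k"
  using assms(1,10)
proof (induction A arbitrary: k rule: finite_induct)
  case empty
  then show ?case using h by (simp add: linear_factors_def coeff_1)
next
  case (insert i A)
  have *: "coeff (linear_factors a A) k \<in> R" for k
    using insert.hyps insert.prems by (intro coeff_linear_factors_mem_subring R) auto
  then show ?case using insert R h by (simp add: coeff_linear_factors_insert)
qed

lemma norm_coeff_linear_factors_le:
  assumes "finite A" "\<And>i. i \<in> A \<Longrightarrow> norm (a i) \<le> B" "B \<ge> 0"
  shows "norm (coeff (linear_factors a A) k) \<le> (1 + B) ^ card A"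
  using assms(1,2)
proof (induction A arbitrary: k rule: finite_induct)
  case empty
  then show ?case by (simp add: linear_factors_def coeff_1)
next
  case (insert i A)
  let ?c = "coeff (linear_factors a A)"
  have "norm (coeff (linear_factors a (insert i A)) k) \<le> norm (if k = 0 then 0 else ?c (k - 1)) + norm (a i) * norm (?c k)"
    unfolding coeff_linear_factors_insert[OF insert.hyps] by (metis norm_mult norm_triangle_ineq4)
  also have "\<dots> \<le> (1 + B) ^ card A + B * (1 + B) ^ card A"
    using insert assms(3) by (intro add_mono mult_mono) auto
  also have "\<dots> = (1 + B) ^ card (insert i A)" using insert.hyps by (simp add: algebra_simps)
  finally show ?case .
qed

text \<open>One equation eliminates one unknown, by division within \<open>S\<close>. Solutions in
  the subfield are needed in \<open>gal_order_ge_dim\<close>, where \<open>\<sigma>\<close> is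
  applied to them.\<close>

lemma homogeneous_system_nontrivial_solution:
  fixes A :: "'i \<Rightarrow> 'j \<Rightarrow> complex"
  assumes S: "complex_subfield S" and "finite I" "finite J" "card I < card J"
    and "\<And>i j. i \<in> I \<Longrightarrow> j \<in> J \<Longrightarrow> A i j \<in> S"
  shows "\<exists>c. (\<forall>j\<in>J. c j \<in> S) \<and> (\<exists>j\<in>J. c j \<noteq> 0) \<and> (\<forall>i\<in>I. (\<Sum>j\<in>J. A i j * c j) = 0)"
  using assms(2-)
proof (induction I arbitrary: J A rule: finite_induct)
  case empty
  then obtain j where "j \<in> J" by fastforce
  then show ?case using S unfolding complex_subfield_def by (intro exI[of _ "\<lambda>_. 1"]) auto
next
  case (insert i0 I)
  have Sm: "x - y \<in> S" "x * y \<in> S" "inverse x \<in> S" if "x \<in> S" "y \<in> S" for x y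
    using S that unfolding complex_subfield_def by auto
  have S0: "0 \<in> S" using S unfolding complex_subfield_def by (metis diff_self)
  have Ssum: "(\<Sum>j\<in>X. f j) \<in> S" if "\<And>j. j \<in> X \<Longrightarrow> f j \<in> S" for X :: "'j set" and f
    using that by (induction X rule: infinite_finite_induct) (auto simp: S0 intro: complex_subfield_add[OF S])
  show ?case
  proof (cases "\<forall>j\<in>J. A i0 j = 0")
    case True
    have "card I < card J" using insert.prems insert.hyps by simp
    then obtain c where "\<forall>j\<in>J. c j \<in> S" "\<exists>j\<in>J. c j \<noteq> 0" "\<forall>i\<in>I. (\<Sum>j\<in>J. A i j * c j) = 0"
      using insert.IH[of J A] insert.prems by auto
    then show ?thesis using True by (intro exI[of _ c]) auto
  next
    case False
    then obtain j0 where j0: "j0 \<in> J" "A i0 j0 \<noteq> 0" by blast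
    define A' where "A' i j = A i j - A i j0 * (A i0 j * inverse (A i0 j0))" for i j
    have "card I < card (J - {j0})" using insert.prems insert.hyps j0 by simp
    moreover have "A' i j \<in> S" if "i \<in> I" "j \<in> J - {j0}" for i j
      unfolding A'_def using that j0 insert.prems by (intro Sm) auto
    ultimately obtain c where c: "\<forall>j\<in>J - {j0}. c j \<in> S" "\<exists>j\<in>J - {j0}. c j \<noteq> 0"
      "\<forall>i\<in>I. (\<Sum>j\<in>J - {j0}. A' i j * c j) = 0"
      using insert.IH[of "J - {j0}" A'] insert.prems by auto
    define s where "s = (\<Sum>j\<in>J - {j0}. A i0 j * c j)"
    define c' where "c' = c(j0 := - (s * inverse (A i0 j0)))"
    have "s \<in> S" unfolding s_def using c(1) insert.prems j0 by (intro Ssum Sm) auto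
    then have "s * inverse (A i0 j0) \<in> S" using insert.prems j0 by (intro Sm) auto
    then have "c' j0 \<in> S" unfolding c'_def using Sm(1)[OF S0] by fastforce
    then have "\<forall>j\<in>J. c' j \<in> S" using c(1) by (auto simp: c'_def)
    moreover have "\<exists>j\<in>J. c' j \<noteq> 0" using c(2) by (auto simp: c'_def)
    moreover have "(\<Sum>j\<in>J. A i j * c' j) = 0" if "i \<in> insert i0 I" for i
    proof -
      have split: "(\<Sum>j\<in>J. A i j * c' j) = - (A i j0 * (s * inverse (A i0 j0))) + (\<Sum>j\<in>J - {j0}. A i j * c j)"
        using j0 insert.prems by (subst sum.remove[of _ j0]) (auto simp: c'_def intro!: sum.cong)
      show ?thesis
      proof (cases "i = i0")
        case True
        then show ?thesis using j0 unfolding split s_def by simp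
      next
        case False
        then have "i \<in> I" using that by simp
        then have "0 = (\<Sum>j\<in>J - {j0}. A' i j * c j)" using c(3) by simp
        also have "\<dots> = (\<Sum>j\<in>J - {j0}. A i j * c j) - A i j0 * (s * inverse (A i0 j0))"
          unfolding A'_def s_def by (simp add: algebra_simps sum_subtractf sum_distrib_left sum_distrib_right)
        finally show ?thesis unfolding split by simp
      qed
    qed
    ultimately show ?thesis by (intro exI[of _ c']) blast
  qed
qed

section \<open>Resultants of the unit equation\<close>

lemma rat_poly_denominator: "\<exists>m>0. \<exists>q :: int poly. Polynomial.smult (of_int m) (p :: rat poly) = map_poly of_int q"
proof (induction p)
  case 0
  show ?case by (rule exI[of _ 1]) (auto intro: exI[of _ 0])
next
  case (pCons c p)
  then obtain m and q :: "int poly" where mq: "m > 0" "Polynomial.smult (of_int m) p = map_poly of_int q" by blast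
  obtain a b where ab: "quotient_of c = (a, b)" by fastforce
  then have b: "b > 0" and c: "c = of_int a / of_int b"
    using quotient_of_denom_pos quotient_of_div by auto
  have "Polynomial.smult (of_int (m * b)) (pCons c p) = pCons (of_int (m * a)) (Polynomial.smult (of_int b) (Polynomial.smult (of_int m) p))"
    using b c by (simp add: mult.commute)
  also have "\<dots> = map_poly of_int (pCons (m * a) (Polynomial.smult b q))"
    unfolding mq(2) by (rule poly_eqI) (simp add: coeff_pCons split: nat.split)
  finally show ?case using mq(1) b by (intro exI[of _ "m * b"]) auto
qed

lemma poly_bezout:
  fixes f g :: "'a :: field poly"
  shows "\<exists>a b. a * f + b * g dvd f \<and> a * f + b * g dvd g"
\<comment> \<open>The measure puts the zero polynomial strictly below the nonzero constants, which
  have degree 0 as well.\<close>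
proof (induction "if g = 0 then 0 else Suc (degree g)" arbitrary: f g rule: less_induct)
  case less
  show ?case
  proof (cases "g = 0")
    case True
    then show ?thesis by (intro exI[of _ 1] exI[of _ 0]) simp
  next
    case False
    then have "(if f mod g = 0 then 0 else Suc (degree (f mod g))) < (if g = 0 then 0 else Suc (degree g))"
      using degree_mod_less[of g f] by auto
    from less[OF this] obtain a b where ab: "a * g + b * (f mod g) dvd g" "a * g + b * (f mod g) dvd f mod g"
      by blast
    have eq: "a * g + b * (f mod g) = b * f + (a - b * (f div g)) * g"
      by (simp add: algebra_simps flip: minus_div_mult_eq_mod)
    have "b * f + (a - b * (f div g)) * g dvd f"
      using ab unfolding eq by (metis dvd_mod_imp_dvd)
    then show ?thesis using ab(1) unfolding eq by blast
  qed
qed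

text \<open>The unit circles around 0 and 1 meet only in the primitive sixth roots of unity, where
  \<open>z ^ 2 = z - 1\<close>.\<close>

lemma unit_circle_lens:
  assumes "norm (z::complex) = 1" "norm (1 - z) = 1"
  shows "z ^ 6 = 1" "z ^ 2 \<noteq> 1"
proof -
  have "(Re z)\<^sup>2 + (Im z)\<^sup>2 = 1" "(1 - Re z)\<^sup>2 + (Im z)\<^sup>2 = 1"
    using assms by (simp_all add: cmod_def)
  then have re: "Re z = 1 / 2" and im: "(Re z)\<^sup>2 + (Im z)\<^sup>2 = 1" by (simp_all add: power2_eq_square algebra_simps)
  have "Im z * Im z = 3 / 4" using im unfolding re by (simp add: power2_eq_square)
  then have "z ^ 2 = z - 1" by (simp add: complex_eq_iff power2_eq_square re)
  note sq = this
  have "z ^ 3 = z * z ^ 2" by (simp add: power3_eq_cube power2_eq_square)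
  also have "\<dots> = z ^ 2 - z" unfolding sq using sq by (simp add: algebra_simps power2_eq_square)
  also have "\<dots> = -1" unfolding sq by simp
  finally have "z ^ 3 = -1" .
  then show "z ^ 6 = 1" using power_mult[of z 3 2] by simp
  show "z ^ 2 \<noteq> 1"
  proof
    assume "z ^ 2 = 1"
    then have "z = 2" using sq by simp
    then show False using \<open>Re z = 1 / 2\<close> by simp
  qed
qed

text \<open>A common root is a primitive sixth root of unity with \<open>z ^ (2 * l) = 1\<close>,
  which forces \<open>3 dvd l\<close>. For \<open>l = 3\<close> these roots really are common roots,
  with \<open>e = d = -1\<close>; this is the only source of the hypothesis
  \<open>l \<noteq> 3\<close>.\<close>

lemma no_common_root:
  assumes "\<not> 3 dvd l" "l > 0" "e \<in> {1, -1}" "d \<in> {1, -1}"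
  shows "\<not> (z ^ l = (e :: complex) \<and> (1 - z) ^ l = d)"
proof
  assume *: "z ^ l = e \<and> (1 - z) ^ l = d"
  then have "norm z ^ l = 1" "norm (1 - z) ^ l = 1" using assms by (auto simp flip: norm_power)
  then have n: "norm z = 1" "norm (1 - z) = 1"
    using assms(2) power_eq_imp_eq_base[of "norm z" l 1] power_eq_imp_eq_base[of "norm (1 - z)" l 1] by auto
  note z = unit_circle_lens[OF n]
  have "z ^ (2 * l) = 1" using * assms by (auto simp: power_mult mult.commute[of 2])
  moreover have "z ^ (2 * l) = z ^ (2 * l mod 6)"
    using z(1) by (metis mod_mult_div_eq power_add power_mult power_one mult.right_neutral)
  moreover have "2 * l mod 6 = 2 \<or> 2 * l mod 6 = 4" using assms(1) by presburger
  ultimately have "z ^ 2 = 1 \<or> z ^ 4 = 1" by auto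
  then have "z ^ 2 = 1"
  proof
    assume "z ^ 4 = 1"
    then show "z ^ 2 = 1" using z(1) power_add[of z 4 2] by simp
  qed
  then show False using z(2) by simp
qed

text \<open>Clearing denominators in a Bezout identity over the rationals; the two polynomials are
  coprime because their only possible common roots are primitive sixth roots of unity.\<close>

lemma unit_equation_resultant:
  fixes l :: nat and e d :: int
  assumes "\<not> 3 dvd l" "l > 0" "e \<in> {1, -1}" "d \<in> {1, -1}"
  shows "\<exists>r\<noteq>0. \<exists>A B :: int poly. \<forall>x :: complex. of_int r =
    poly (of_int_poly A) x * (x ^ l - of_int e) + poly (of_int_poly B) x * ((1 - x) ^ l - of_int d)"
proof -
  interpret C: map_poly_inj_idom_hom "of_rat :: rat \<Rightarrow> complex" ..
  define P Q :: "rat poly" where "P = [:0, 1:] ^ l - [:of_int e:]" and "Q = [:1, -1:] ^ l - [:of_int d:]"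
  let ?C = "map_poly of_rat :: rat poly \<Rightarrow> complex poly"
  have const: "?C [:c:] = [:of_rat c:]" and lin: "?C [:c, b:] = [:of_rat c, of_rat b:]" for c b
    by (rule poly_eqI, simp add: coeff_pCons split: nat.split)+
  have C: "poly (?C P) x = x ^ l - of_int e" "poly (?C Q) x = (1 - x) ^ l - of_int d" for x
    unfolding P_def Q_def by (simp_all add: C.hom_minus C.hom_power const lin del: C.map_poly_pCons_hom)
  \<comment> \<open>This makes the greatest common divisor \<open>g\<close> nonzero, so that the
    constant \<open>k\<close> below can be inverted.\<close>
  have "P \<noteq> 0"
  proof
    assume "P = 0"
    then have "poly (?C P) 2 = 0" by simp
    moreover have "norm ((2::complex) ^ l) > 1" using assms(2) by (simp add: norm_power)
    ultimately have "norm (of_int e :: complex) > 1" unfolding C by (metis eq_iff_diff_eq_0)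
    then show False using assms(3) by auto
  qed
  obtain u v where uv: "u * P + v * Q dvd P" "u * P + v * Q dvd Q" using poly_bezout by blast
  define g where "g = u * P + v * Q"
  obtain U V where UV: "P = g * U" "Q = g * V" using uv unfolding g_def by (meson dvdE)
  have "degree g = 0"
  proof (rule ccontr)
    assume deg: "degree g \<noteq> 0"
    have "degree (?C g) = degree g" by simp
    then obtain z where z: "poly (?C g) z = 0"
      using deg fundamental_theorem_of_algebra[of "?C g"] constant_degree by metis
    have "?C P = ?C g * ?C U" using UV(1) by (metis C.hom_mult)
    then have "poly (?C P) z = 0" using z by simp
    moreover have "?C Q = ?C g * ?C V" using UV(2) by (metis C.hom_mult)
    then have "poly (?C Q) z = 0" using z by simp
    ultimately show False using no_common_root[of l "of_int e" "of_int d" z] assms unfolding C by auto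
  qed
  then obtain k where k: "g = [:k:]" by (rule degree_eq_zeroE)
  then have "k \<noteq> 0" using \<open>P \<noteq> 0\<close> UV(1) by auto
  define a b where "a = [:inverse k:] * u" and "b = [:inverse k:] * v"
  have "a * P + b * Q = [:inverse k:] * g" unfolding a_def b_def g_def by (simp only: distrib_left mult.assoc)
  then have ab: "a * P + b * Q = 1" using \<open>k \<noteq> 0\<close> unfolding k by (simp add: one_pCons)
  obtain m A where A: "m > 0" "Polynomial.smult (of_int m) a = of_int_poly A" using rat_poly_denominator[of a] by blast
  obtain n B where B: "n > 0" "Polynomial.smult (of_int n) b = of_int_poly B" using rat_poly_denominator[of b] by blast
  have CC: "?C (of_int_poly X) = of_int_poly X" for X by (simp add: map_poly_map_poly o_def)
  have "of_int (m * n) = poly (of_int_poly (Polynomial.smult n A)) x * (x ^ l - of_int e)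
      + poly (of_int_poly (Polynomial.smult m B)) x * ((1 - x) ^ l - of_int d)" for x :: complex
  proof -
    have "[:of_int (m * n):] = Polynomial.smult (of_int n) (Polynomial.smult (of_int m) a) * P + Polynomial.smult (of_int m) (Polynomial.smult (of_int n) b) * Q"
    proof -
      have "Polynomial.smult (of_int n) (Polynomial.smult (of_int m) a) * P + Polynomial.smult (of_int m) (Polynomial.smult (of_int n) b) * Q
        = Polynomial.smult (of_int (m * n)) (a * P + b * Q)" by (simp add: smult_add_right mult.commute)
      then show ?thesis unfolding ab by simp
    qed
    also have "\<dots> = of_int_poly (Polynomial.smult n A) * P + of_int_poly (Polynomial.smult m B) * Q"
      unfolding A(2) B(2) by (simp add: of_int_hom.map_poly_hom_smult)
    finally have "?C [:of_int (m * n):] = ?C (of_int_poly (Polynomial.smult n A)) * ?C P + ?C (of_int_poly (Polynomial.smult m B)) * ?C Q"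
      by (simp only: C.hom_add C.hom_mult)
    then have "poly (?C [:of_int (m * n):]) x = poly (of_int_poly (Polynomial.smult n A)) x * poly (?C P) x
        + poly (of_int_poly (Polynomial.smult m B)) x * poly (?C Q) x"
      unfolding CC by simp
    then show ?thesis unfolding C const by (simp add: of_rat_mult)
  qed
  then show ?thesis using A(1) B(1) by (intro exI[of _ "m * n"]) auto
qed

section \<open>Cyclic extensions of prime degree\<close>

locale field_endo =
  fixes K :: "complex set" and \<sigma> :: "complex \<Rightarrow> complex"
  assumes subfield: "complex_subfield K"
    and \<sigma>_closed: "x \<in> K \<Longrightarrow> \<sigma> x \<in> K"
    and \<sigma>_add: "x \<in> K \<Longrightarrow> y \<in> K \<Longrightarrow> \<sigma> (x + y) = \<sigma> x + \<sigma> y"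
    and \<sigma>_mult: "x \<in> K \<Longrightarrow> y \<in> K \<Longrightarrow> \<sigma> (x * y) = \<sigma> x * \<sigma> y"
    and \<sigma>_one: "\<sigma> 1 = 1"
begin

text \<open>Natural exponents reach the whole group once \<open>\<sigma>\<close> has finite order;
  \<open>gal (l - i)\<close> then plays the part of the inverse of \<open>gal i\<close>.\<close>

definition gal :: "nat \<Rightarrow> complex \<Rightarrow> complex" where "gal i = \<sigma> ^^ i"

lemma one_mem [simp]: "1 \<in> K"
  and diff_mem [intro]: "x \<in> K \<Longrightarrow> y \<in> K \<Longrightarrow> x - y \<in> K"
  and mult_mem [intro]: "x \<in> K \<Longrightarrow> y \<in> K \<Longrightarrow> x * y \<in> K"
  and inverse_mem [intro]: "x \<in> K \<Longrightarrow> inverse x \<in> K"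
  using subfield unfolding complex_subfield_def by auto

lemma add_mem [intro]: "x \<in> K \<Longrightarrow> y \<in> K \<Longrightarrow> x + y \<in> K"
  by (rule complex_subfield_add[OF subfield])

lemma zero_mem [simp]: "0 \<in> K"
  using diff_mem[OF one_mem one_mem] by simp

lemma minus_mem [intro]: "x \<in> K \<Longrightarrow> - x \<in> K"
  using diff_mem[of 0 x] by simp

lemma divide_mem [intro]: "x \<in> K \<Longrightarrow> y \<in> K \<Longrightarrow> x / y \<in> K"
  by (simp add: divide_inverse mult_mem inverse_mem)

lemma sum_mem [intro]: "(\<And>i. i \<in> I \<Longrightarrow> f i \<in> K) \<Longrightarrow> (\<Sum>i\<in>I. f i) \<in> K"
  by (induction I rule: infinite_finite_induct) auto

lemma prod_mem [intro]: "(\<And>i. i \<in> I \<Longrightarrow> f i \<in> K) \<Longrightarrow> (\<Prod>i\<in>I. f i) \<in> K"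
  by (induction I rule: infinite_finite_induct) auto

lemma power_mem [intro]: "x \<in> K \<Longrightarrow> x ^ n \<in> K"
  by (induction n) auto

lemma of_int_mem [simp]: "of_int n \<in> K"
proof -
  have "of_nat m \<in> K" for m by (induction m) auto
  then show ?thesis by (cases n) (auto simp del: of_nat_Suc)
qed

lemma of_nat_mem [simp]: "of_nat n \<in> K"
  using of_int_mem[of "int n"] by simp

lemma of_rat_mem [simp]: "of_rat q \<in> K"
  by (cases q) (auto simp: of_rat_rat)

lemma Rats_mem: "x \<in> \<rat> \<Longrightarrow> x \<in> K"
  by (auto elim: Rats_cases)

lemma gal_0 [simp]: "gal 0 x = x" and gal_Suc: "gal (Suc i) x = \<sigma> (gal i x)"
  by (simp_all add: gal_def)

lemma gal_gal: "gal i (gal j x) = gal (i + j) x"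
  by (simp add: gal_def funpow_add)

lemma gal_closed [intro, simp]: "x \<in> K \<Longrightarrow> gal i x \<in> K"
  by (induction i) (auto simp: gal_Suc \<sigma>_closed)

lemma gal_add: "x \<in> K \<Longrightarrow> y \<in> K \<Longrightarrow> gal i (x + y) = gal i x + gal i y"
  by (induction i) (auto simp: gal_Suc \<sigma>_add)

lemma gal_mult: "x \<in> K \<Longrightarrow> y \<in> K \<Longrightarrow> gal i (x * y) = gal i x * gal i y"
  by (induction i) (auto simp: gal_Suc \<sigma>_mult)

lemma gal_1 [simp]: "gal i 1 = 1"
  by (induction i) (auto simp: gal_Suc \<sigma>_one)

lemma gal_zero [simp]: "gal i 0 = 0"
  using gal_add[of 0 0 i] by simp

lemma \<sigma>_zero: "\<sigma> 0 = 0"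
  using gal_Suc[of 0 0] gal_zero[of "Suc 0"] by simp

lemma gal_minus: "x \<in> K \<Longrightarrow> gal i (- x) = - gal i x"
  using gal_add[of x "- x" i] by (simp add: minus_mem eq_neg_iff_add_eq_0 add.commute)

lemma gal_diff: "x \<in> K \<Longrightarrow> y \<in> K \<Longrightarrow> gal i (x - y) = gal i x - gal i y"
  using gal_add[of x "- y" i] by (simp add: minus_mem gal_minus)

lemma gal_sum: "(\<And>j. j \<in> J \<Longrightarrow> f j \<in> K) \<Longrightarrow> gal i (\<Sum>j\<in>J. f j) = (\<Sum>j\<in>J. gal i (f j))"
  by (induction J rule: infinite_finite_induct) (auto simp: gal_add sum_mem)

lemma gal_prod: "(\<And>j. j \<in> J \<Longrightarrow> f j \<in> K) \<Longrightarrow> gal i (\<Prod>j\<in>J. f j) = (\<Prod>j\<in>J. gal i (f j))"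
  by (induction J rule: infinite_finite_induct) (auto simp: gal_mult prod_mem)

lemma gal_power: "x \<in> K \<Longrightarrow> gal i (x ^ n) = gal i x ^ n"
  by (induction n) (auto simp: gal_mult power_mem)

lemma gal_of_int [simp]: "gal i (of_int n) = of_int n"
proof -
  have "gal i (of_nat m) = of_nat m" for m by (induction m) (auto simp: gal_add)
  then show ?thesis by (cases n) (auto simp: gal_minus simp del: of_nat_Suc)
qed

lemma gal_of_rat [simp]: "gal i (of_rat q) = of_rat q"
proof -
  obtain a b where q: "q = Rat.Fract a b" "b > 0" by (cases q) auto
  then have "of_rat q * of_int b = (of_int a :: complex)" by (simp add: of_rat_rat)
  then have "gal i (of_rat q) * of_int b = of_int a"
    using gal_mult[of "of_rat q" "of_int b" i] by simp
  then show ?thesis using \<open>of_rat q * of_int b = of_int a\<close> q(2)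
    by (metis less_irrefl mult_cancel_right of_int_eq_0_iff)
qed

lemma gal_Rats: "x \<in> \<rat> \<Longrightarrow> gal i x = x"
  by (auto elim: Rats_cases)

lemma gal_eq_0_iff [simp]: "x \<in> K \<Longrightarrow> gal i x = 0 \<longleftrightarrow> x = 0"
proof
  assume x: "x \<in> K" "gal i x = 0"
  show "x = 0"
  proof (rule ccontr)
    assume "x \<noteq> 0"
    then have "gal i (x * inverse x) = 1" by simp
    then show False using x by (simp add: gal_mult inverse_mem)
  qed
qed simp

lemma gal_inject: "x \<in> K \<Longrightarrow> y \<in> K \<Longrightarrow> gal i x = gal i y \<longleftrightarrow> x = y"
  using gal_eq_0_iff[of "x - y" i] by (auto simp: gal_diff)

text \<open>Dedekind's argument: comparing the relation at \<open>y * x\<close> with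
  \<open>gal k y\<close> times the relation at \<open>x\<close> removes the term of index
  \<open>k\<close>.\<close>

lemma independent_gal:
  assumes "finite J" "\<And>i j. i \<in> J \<Longrightarrow> j \<in> J \<Longrightarrow> i \<noteq> j \<Longrightarrow> \<exists>y\<in>K. gal i y \<noteq> gal j y"
    "\<And>x. x \<in> K \<Longrightarrow> (\<Sum>i\<in>J. a i * gal i x) = 0" "i \<in> J"
  shows "a i = 0"
  using assms
proof (induction J arbitrary: a i rule: finite_induct)
  case (insert k J)
  have a0: "a j = 0" if j: "j \<in> J" for j
  proof -
    have "j \<noteq> k" using insert.hyps j by auto
    then obtain y where y: "y \<in> K" "gal j y \<noteq> gal k y" using insert.prems(1)[of j k] j by auto
    define b where "b i = a i * (gal i y - gal k y)" for i
    have "(\<Sum>i\<in>J. b i * gal i x) = 0" if x: "x \<in> K" for x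
    proof -
      have "0 = (\<Sum>i\<in>insert k J. a i * gal i (y * x)) - gal k y * (\<Sum>i\<in>insert k J. a i * gal i x)"
        using insert.prems(2)[of x] insert.prems(2)[of "y * x"] x y by auto
      also have "\<dots> = (\<Sum>i\<in>insert k J. b i * gal i x)"
        unfolding sum_distrib_left sum_subtractf[symmetric]
        using x y by (intro sum.cong) (auto simp: gal_mult b_def algebra_simps)
      also have "\<dots> = (\<Sum>i\<in>J. b i * gal i x)" using insert.hyps by (simp add: b_def)
      finally show ?thesis by simp
    qed
    then have "b j = 0" using insert.IH[of b j] insert.prems(1) j by auto
    then show ?thesis using y(2) by (simp add: b_def)
  qed
  moreover have "a k = 0" using insert.prems(2)[of 1] insert.hyps a0 by simp
  ultimately show ?case using insert.prems(3) by auto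
qed simp

end

text \<open>Encodes a cyclic Galois extension by a generator of its group: \<open>\<sigma>\<close>
  fixes only rationals and its \<open>l\<close>-th iterate is trivial. As \<open>l\<close> is prime
  and \<open>K\<close> is not rational, the order is exactly \<open>l\<close>.\<close>

locale cyclic_ext = field_endo +
  fixes l :: nat
  assumes fixed_Rats: "x \<in> K \<Longrightarrow> \<sigma> x = x \<Longrightarrow> x \<in> \<rat>"
    and gal_l: "x \<in> K \<Longrightarrow> gal l x = x"
    and prime_l: "prime l"
    and ex_nonrational: "\<exists>x\<in>K. x \<notin> \<rat>"

section \<open>The order of the generator equals the degree\<close>

context field_endo
begin

text \<open>Were the first \<open>card B + 1\<close> iterates pairwise distinct, testing on
  \<open>B\<close> would give fewer equations than unknowns and thus a linear relation among them,
  against their independence.\<close>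

lemma ex_gal_trivial:
  assumes B: "finite B" "rat_vs.span B = K"
  shows "\<exists>k>0. k \<le> card B \<and> (\<forall>x\<in>K. gal k x = x)"
proof (rule ccontr)
  assume neg: "\<not> ?thesis"
  have BK: "B \<subseteq> K" using B(2) rat_vs.span_superset by blast
  have dist: "\<exists>y\<in>K. gal i y \<noteq> gal j y" if "i < j" "j \<le> card B" for i j
  proof -
    have "j - i > 0" "j - i \<le> card B" using that by auto
    then obtain y where y: "y \<in> K" "gal (j - i) y \<noteq> y" using neg by blast
    then have "gal i (gal (j - i) y) \<noteq> gal i y" by (subst gal_inject) auto
    then show ?thesis using y(1) that by (intro bexI[of _ y]) (simp_all add: gal_gal)
  qed
  have "\<exists>a. (\<forall>i\<in>{..card B}. a i \<in> K) \<and> (\<exists>i\<in>{..card B}. a i \<noteq> 0) \<and> (\<forall>b\<in>B. (\<Sum>i\<in>{..card B}. gal i b * a i) = 0)"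
    using BK by (intro homogeneous_system_nontrivial_solution[OF subfield B(1)]) auto
  then obtain a where a: "\<exists>i\<in>{..card B}. a i \<noteq> 0"
    "\<And>b. b \<in> B \<Longrightarrow> (\<Sum>i\<in>{..card B}. gal i b * a i) = 0"
    by blast
  have "(\<Sum>i\<in>{..card B}. a i * gal i x) = 0" if "x \<in> K" for x
  proof -
    have "x \<in> rat_vs.span B" using that B(2) by simp
    then have "x \<in> K \<and> (\<Sum>i\<in>{..card B}. a i * gal i x) = 0"
    proof (induction rule: rat_vs.span_induct_alt)
      case (step c b y)
      have "a i * gal i (of_rat c * b + y) = of_rat c * (gal i b * a i) + a i * gal i y" for i
        using step BK by (subst gal_add) (auto simp: gal_mult algebra_simps)
      then have "(\<Sum>i\<in>{..card B}. a i * gal i (of_rat c * b + y))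
        = of_rat c * (\<Sum>i\<in>{..card B}. gal i b * a i) + (\<Sum>i\<in>{..card B}. a i * gal i y)"
        by (simp add: sum.distrib sum_distrib_left)
      moreover have "b \<in> K" using step.hyps BK by blast
      ultimately show ?case using a(2)[OF step.hyps] step by (simp add: add_mem mult_mem)
    qed simp
    then show ?thesis by blast
  qed
  then have "a i = 0" if "i \<in> {..card B}" for i
    using independent_gal[of "{..card B}" a i] dist that by (metis atMost_iff finite_atMost linorder_neqE_nat)
  then show False using a(1) by blast
qed

text \<open>Artin's argument: a solution of the system of conjugates with least support, scaled to
  have an entry 1, is fixed by \<open>\<sigma>\<close>, hence rational, and is then a linear
  relation on \<open>B\<close>.\<close>

lemma gal_order_ge_dim:
  assumes n: "n > 0" "\<And>x. x \<in> K \<Longrightarrow> gal n x = x"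
    and fixed: "\<And>x. x \<in> K \<Longrightarrow> \<sigma> x = x \<Longrightarrow> x \<in> \<rat>"
    and B: "finite B" "B \<subseteq> K" "rat_vs.independent B"
  shows "card B \<le> n"
proof (rule ccontr)
  assume "\<not> ?thesis"
  then have less: "card {..<n} < card B" by simp
  define sol where "sol a \<longleftrightarrow> (\<forall>b\<in>B. a b \<in> K) \<and> (\<forall>i<n. (\<Sum>b\<in>B. gal i b * a b) = 0)" for a
  define supp where "supp a = {b\<in>B. a b \<noteq> 0}" for a :: "complex \<Rightarrow> complex"
  have "\<exists>a. (\<forall>b\<in>B. a b \<in> K) \<and> (\<exists>b\<in>B. a b \<noteq> 0) \<and> (\<forall>i\<in>{..<n}. (\<Sum>b\<in>B. gal i b * a b) = 0)"
    using B(2) by (intro homogeneous_system_nontrivial_solution[OF subfield _ B(1) less]) auto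
  then obtain a1 where a1: "sol a1 \<and> supp a1 \<noteq> {}" unfolding sol_def supp_def by auto
  from ex_has_least_nat[of "\<lambda>a. sol a \<and> supp a \<noteq> {}", OF a1, of "\<lambda>a. card (supp a)"]
  obtain a where a: "sol a" "supp a \<noteq> {}" and least: "\<And>e. sol e \<Longrightarrow> supp e \<noteq> {} \<Longrightarrow> card (supp a) \<le> card (supp e)"
    by blast
  obtain b0 where b0: "b0 \<in> B" "a b0 \<noteq> 0" using a(2) by (auto simp: supp_def)
  define a' where "a' b = a b * inverse (a b0)" for b
  have a'K: "a' b \<in> K" if "b \<in> B" for b using a(1) b0(1) that by (auto simp: a'_def sol_def)
  have a'0: "(\<Sum>b\<in>B. gal i b * a' b) = 0" if "i < n" for i
    using a(1) that by (simp add: a'_def sol_def mult.assoc[symmetric] flip: sum_distrib_right)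
  \<comment> \<open>Applying \<open>\<sigma>\<close> permutes the equations cyclically; the last one
    becomes the one of index 0 because the \<open>n\<close>-th iterate is trivial.\<close>
  have sh: "(\<Sum>b\<in>B. gal i b * \<sigma> (a' b)) = 0" if "i < n" for i
  proof -
    define j where "j = (if i = 0 then n - 1 else i - 1)"
    have j: "j < n" "\<And>b. b \<in> B \<Longrightarrow> gal (Suc j) b = gal i b" using that n B(2) by (auto simp: j_def)
    have "gal 1 (\<Sum>b\<in>B. gal j b * a' b) = (\<Sum>b\<in>B. gal 1 (gal j b * a' b))"
      using a'K B(2) by (intro gal_sum) auto
    also have "\<dots> = (\<Sum>b\<in>B. gal i b * \<sigma> (a' b))"
      using a'K B(2) j(2) by (intro sum.cong) (auto simp: gal_Suc \<sigma>_mult)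
    finally show ?thesis using a'0[OF j(1)] by simp
  qed
  define e where "e b = \<sigma> (a' b) - a' b" for b
  have "sol e" unfolding sol_def e_def using a'K a'0 sh \<sigma>_closed by (auto simp: right_diff_distrib sum_subtractf)
  moreover have "supp e \<subset> supp a"
  proof -
    have "e b = 0" if "a b = 0" for b using that \<sigma>_zero by (simp add: e_def a'_def)
    moreover have "e b0 = 0" using b0(2) by (simp add: e_def a'_def \<sigma>_one)
    ultimately show ?thesis using b0 by (auto simp: supp_def)
  qed
  then have "card (supp e) < card (supp a)" using B(1) by (intro psubset_card_mono) (auto simp: supp_def)
  ultimately have "supp e = {}" using least[of e] by force
  then have "a' b \<in> \<rat>" if "b \<in> B" for b using fixed[OF a'K[OF that]] that by (auto simp: supp_def e_def)
  then have "\<forall>b\<in>B. \<exists>q. a' b = of_rat q" by (auto elim: Rats_cases)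
  then obtain q where q: "\<And>b. b \<in> B \<Longrightarrow> a' b = of_rat (q b)" by metis
  have "(\<Sum>b\<in>B. of_rat (q b) * b) = 0" using a'0[OF n(1)] q by (simp add: mult.commute)
  moreover have "q b0 \<noteq> 0" using q[OF b0(1)] b0(2) by (auto simp: a'_def)
  ultimately show False using B rat_vs.dependent_finite[OF B(1)] b0(1) by blast
qed

end

text \<open>A number fixed by a generator is fixed by all its integer powers, that is, by the whole
  group, and is therefore rational by \<open>galois_over_rat\<close>.\<close>

lemma cyclic_number_field_generator:
  assumes cyc: "cyclic_number_field K"
  shows "\<exists>\<sigma>. field_endo K \<sigma> \<and> (\<forall>x\<in>K. \<sigma> x = x \<longrightarrow> x \<in> \<rat>)"
proof -
  let ?G = "galois_group K"
  from cyc have K: "complex_subfield K" and gal: "galois_over_rat K" and "cyclic_group ?G"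
    unfolding cyclic_number_field_def number_field_def by auto
  interpret G: group ?G by (rule group_galois_group[OF K])
  obtain \<sigma> where \<sigma>: "\<sigma> \<in> carrier ?G" and gen: "carrier ?G = range (\<lambda>n::int. \<sigma> [^]\<^bsub>?G\<^esub> n)"
    using \<open>cyclic_group ?G\<close> G.cyclic_group by blast
  have carr: "g \<in> Bij K" "field_iso K K g" if "g \<in> carrier ?G" for g
    using that unfolding galois_group_def by auto
  have mult: "(g \<otimes>\<^bsub>?G\<^esub> h) x = g (h x)" if "g \<in> carrier ?G" "h \<in> carrier ?G" "x \<in> K" for g h x
    using carr(1)[OF that(1)] carr(1)[OF that(2)] that(3)
    by (simp add: galois_group_def BijGroup_def compose_def)
  have one: "\<one>\<^bsub>?G\<^esub> x = x" if "x \<in> K" for x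
    using that by (simp add: galois_group_def BijGroup_def)
  have "x \<in> \<rat>" if x: "x \<in> K" "\<sigma> x = x" for x
  proof -
    have nat: "(\<sigma> [^]\<^bsub>?G\<^esub> (n::nat)) x = x" for n
      by (induction n) (simp_all add: one mult \<sigma> x)
    have "g x = x" if "g \<in> carrier ?G" for g
    proof -
      from that gen obtain n :: int where n: "g = \<sigma> [^]\<^bsub>?G\<^esub> n" by auto
      show ?thesis
      proof (cases "n \<ge> 0")
        case True
        then obtain k where "n = int k" using nonneg_int_cases by blast
        then show ?thesis using nat[of k] n by (simp add: int_pow_int)
      next
        case False
        define m where "m = nat (- n)"
        have inv: "g \<otimes>\<^bsub>?G\<^esub> (\<sigma> [^]\<^bsub>?G\<^esub> m) = \<one>\<^bsub>?G\<^esub>"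
        proof -
          have "n = - int m" using False by (simp add: m_def)
          then have "g = inv\<^bsub>?G\<^esub> (\<sigma> [^]\<^bsub>?G\<^esub> m)" using n \<sigma> by (simp add: G.int_pow_neg_int)
          then show ?thesis using \<sigma> by simp
        qed
        have "g x = g ((\<sigma> [^]\<^bsub>?G\<^esub> m) x)" using nat by simp
        also have "\<dots> = x" using mult[of g "\<sigma> [^]\<^bsub>?G\<^esub> m" x] inv one x \<sigma> that by simp
        finally show ?thesis .
      qed
    qed
    then show ?thesis using x gal unfolding galois_over_rat_def by blast
  qed
  moreover have "field_endo K \<sigma>"
    using K carr(2)[OF \<sigma>] unfolding field_iso_def bij_betw_def by unfold_locales auto
  ultimately show ?thesis by blast
qed

text \<open>Some exponent \<open>k\<close> of a trivial iterate is at most \<open>l\<close> by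
  independence of the iterates and at least \<open>l\<close> by Artin's argument.\<close>

lemma cyclic_ext_of_prime_degree:
  assumes cyc: "cyclic_number_field K" and deg: "degree_over_rat K = l" and l: "prime l"
  shows "\<exists>\<sigma>. cyclic_ext K \<sigma> l"
proof -
  obtain \<sigma> where endo: "field_endo K \<sigma>" and fixed: "\<And>x. x \<in> K \<Longrightarrow> \<sigma> x = x \<Longrightarrow> x \<in> \<rat>"
    using cyclic_number_field_generator[OF cyc] by blast
  interpret field_endo K \<sigma> by fact
  obtain B where B: "B \<subseteq> K" "rat_vs.independent B" "K \<subseteq> rat_vs.span B" "card B = l"
    using rat_vs.basis_exists[of K] deg unfolding degree_over_rat_def by metis
  have fin: "finite B" using B(4) l by (metis card.infinite not_prime_0)
  have "rat_vs.span B \<subseteq> K"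
  proof (rule rat_vs.span_minimal[OF B(1)])
    show "rat_vs.subspace K" unfolding rat_vs.subspace_def by auto
  qed
  then have span: "rat_vs.span B = K" using B(3) by blast
  obtain k where k: "k > 0" "k \<le> l" "\<And>x. x \<in> K \<Longrightarrow> gal k x = x"
    using ex_gal_trivial[OF fin span] unfolding B(4) by blast
  have "card B \<le> k"
  proof (rule gal_order_ge_dim)
    show "x \<in> K \<Longrightarrow> gal k x = x" for x by (rule k(3))
    show "x \<in> K \<Longrightarrow> \<sigma> x = x \<Longrightarrow> x \<in> \<rat>" for x by (rule fixed)
  qed (fact k(1) fin B(1) B(2))+
  then have "k = l" using k(2) B(4) by simp
  moreover have "\<exists>x\<in>K. x \<notin> \<rat>"
  proof (rule ccontr)
    assume "\<not> ?thesis"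
    then have "K \<subseteq> rat_vs.span {1}"
      by (auto simp: rat_vs.span_singleton elim!: Rats_cases)
    then have "rat_vs.dim K \<le> card {1::complex}" by (intro rat_vs.dim_le_card) auto
    then show False using deg prime_gt_1_nat[OF l] unfolding degree_over_rat_def by simp
  qed
  ultimately have "cyclic_ext K \<sigma> l"
    using k(3) fixed l by unfold_locales auto
  then show ?thesis by blast
qed

section \<open>Traces, norms and integral bases\<close>

lemma of_real_of_rat: "of_real (of_rat q) = (of_rat q :: complex)"
  by (cases q) (simp add: of_rat_rat)

lemma common_denominator:
  assumes "finite I" "\<And>i. i \<in> I \<Longrightarrow> q i \<in> (\<rat> :: complex set)"
  shows "\<exists>d::int. d > 0 \<and> (\<forall>i\<in>I. of_int d * q i \<in> \<int>)"
  using assms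
proof (induction I rule: finite_induct)
  case empty
  show ?case by (rule exI[of _ 1]) simp
next
  case (insert k I)
  then obtain d :: int where d: "d > 0" "\<forall>i\<in>I. of_int d * q i \<in> \<int>" by auto
  have "q k \<in> \<rat>" using insert.prems by simp
  then obtain a b where ab: "b > 0" "coprime a b" "q k = of_int a / of_int b" by (rule Rats_cases')
  have "of_int (d * b) * q k = of_int (d * a)" using ab by simp
  then have "of_int (d * b) * q k \<in> \<int>" by (metis Ints_of_int)
  moreover have "of_int (d * b) * q i \<in> \<int>" if "i \<in> I" for i
  proof -
    have "of_int (d * b) * q i = of_int b * (of_int d * q i)" by simp
    then show ?thesis using d(2) that by (metis Ints_mult Ints_of_int)
  qed
  ultimately show ?case using d(1) ab(1) by (intro exI[of _ "d * b"]) auto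
qed

context cyclic_ext
begin

abbreviation R :: "complex set" where "R \<equiv> ring_of_integers K"

lemma l_gt_1: "l > 1" and l_pos: "l > 0"
  using prime_gt_1_nat[OF prime_l] by simp_all

lemma R_mem_K: "x \<in> R \<Longrightarrow> x \<in> K"
  and R_algebraic_int: "x \<in> R \<Longrightarrow> algebraic_int x"
  and R_I: "x \<in> K \<Longrightarrow> algebraic_int x \<Longrightarrow> x \<in> R"
  unfolding ring_of_integers_def by auto

lemma R_add: "x \<in> R \<Longrightarrow> y \<in> R \<Longrightarrow> x + y \<in> R"
  and R_mult: "x \<in> R \<Longrightarrow> y \<in> R \<Longrightarrow> x * y \<in> R"
  and R_minus: "x \<in> R \<Longrightarrow> - x \<in> R"
  unfolding ring_of_integers_def by (auto intro: algebraic_int_add algebraic_int_mult)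

lemma R_diff: "x \<in> R \<Longrightarrow> y \<in> R \<Longrightarrow> x - y \<in> R"
  using R_add[of x "- y"] R_minus by simp

lemma R_of_int: "of_int n \<in> R"
  unfolding ring_of_integers_def by (auto intro: int_imp_algebraic_int)

lemma R_Ints: "x \<in> \<int> \<Longrightarrow> x \<in> R"
  by (auto elim!: Ints_cases intro: R_of_int)

lemma R_0: "0 \<in> R" and R_1: "1 \<in> R" and R_of_nat: "of_nat n \<in> R"
  using R_of_int[of 0] R_of_int[of 1] R_of_int[of "int n"] by simp_all

lemma R_sum: "(\<And>i. i \<in> I \<Longrightarrow> f i \<in> R) \<Longrightarrow> (\<Sum>i\<in>I. f i) \<in> R"
  by (induction I rule: infinite_finite_induct) (auto intro: R_add R_0)

lemma R_prod: "(\<And>i. i \<in> I \<Longrightarrow> f i \<in> R) \<Longrightarrow> (\<Prod>i\<in>I. f i) \<in> R"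
  by (induction I rule: infinite_finite_induct) (auto intro: R_mult R_1)

lemma R_power: "x \<in> R \<Longrightarrow> x ^ n \<in> R"
  by (induction n) (auto intro: R_mult R_1)

lemma R_Rats: "x \<in> R \<Longrightarrow> x \<in> \<rat> \<Longrightarrow> x \<in> \<int>"
  using rational_algebraic_int_is_int R_algebraic_int by blast

lemma R_gal: assumes x: "x \<in> R" shows "gal i x \<in> R"
proof -
  note xK = R_mem_K[OF x]
  obtain p where p: "poly (of_int_poly p) x = 0" "lead_coeff p = 1"
    using R_algebraic_int[OF x] unfolding algebraic_int_altdef_ipoly by blast
  have eval: "poly (of_int_poly p) y = (\<Sum>k\<le>degree p. of_int (coeff p k) * y ^ k)" for y :: complex
    by (simp add: poly_altdef)
  have "poly (of_int_poly p) (gal i x) = gal i (poly (of_int_poly p) x)"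
    unfolding eval using xK by (subst gal_sum) (simp_all add: gal_mult gal_power mult_mem power_mem)
  then have "poly (of_int_poly p) (gal i x) = 0" using p(1) by simp
  then show ?thesis using p(2) xK by (intro R_I) (auto simp: algebraic_int_altdef_ipoly)
qed

lemma gal_add_l: "x \<in> K \<Longrightarrow> gal (i + l) x = gal i x"
  by (simp flip: gal_gal add: gal_l)

lemma gal_add_mult_l: "x \<in> K \<Longrightarrow> gal (i + l * m) x = gal i x"
proof (induction m)
  case (Suc m)
  then show ?case using gal_add_l[of x "i + l * m"] by (simp add: ac_simps)
qed simp

lemma gal_multiple: "x \<in> K \<Longrightarrow> gal k x = x \<Longrightarrow> gal (k * m) x = x"
proof (induction m)
  case (Suc m)
  then show ?case by (simp flip: gal_gal)
qed simp

text \<open>Such a \<open>k\<close> is invertible modulo the prime \<open>l\<close>; hence every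
  nontrivial power of \<open>\<sigma>\<close> generates the group.\<close>

lemma gal_generates:
  assumes "0 < k" "k < l"
  shows "\<exists>m q. k * m = 1 + l * q"
proof -
  have "coprime k l" using assms prime_l by (meson coprime_commute nat_dvd_not_less prime_imp_coprime)
  moreover obtain m q where "k * m = l * q + gcd k l" using bezout_nat[of k l] assms by auto
  ultimately show ?thesis by (metis add.commute coprime_imp_gcd_eq_1)
qed

lemma gal_nontrivial:
  assumes x: "x \<in> K" "x \<notin> \<rat>" and k: "0 < k" "k < l"
  shows "gal k x \<noteq> x"
proof
  assume *: "gal k x = x"
  obtain m q where mq: "k * m = 1 + l * q" using gal_generates[OF k] by blast
  have "x = gal (1 + l * q) x" using gal_multiple[OF x(1) *, of m] mq by simp
  also have "\<dots> = \<sigma> x" using gal_add_mult_l[OF x(1), of 1 q] by (simp add: gal_Suc)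
  finally show False using fixed_Rats[OF x(1)] x(2) by simp
qed

lemma inj_on_gal:
  assumes x: "x \<in> K" "x \<notin> \<rat>"
  shows "inj_on (\<lambda>i. gal i x) {..<l}"
proof (rule linorder_inj_onI')
  fix i j assume ij: "i \<in> {..<l}" "j \<in> {..<l}" "i < j"
  have "gal (j - i) x \<noteq> x" using ij by (intro gal_nontrivial x) auto
  then have "gal i (gal (j - i) x) \<noteq> gal i x" using x by (subst gal_inject) auto
  then show "gal i x \<noteq> gal j x" using ij by (simp add: gal_gal)
qed

section \<open>Trace, norm and characteristic polynomial\<close>

definition tr :: "complex \<Rightarrow> complex" where "tr x = (\<Sum>i<l. gal i x)"
definition nm :: "complex \<Rightarrow> complex" where "nm x = (\<Prod>i<l. gal i x)"
definition chi :: "complex \<Rightarrow> complex poly" where "chi x = linear_factors (\<lambda>i. gal i x) {..<l}"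

lemma coeff_chi_Rats: assumes x: "x \<in> K" shows "coeff (chi x) k \<in> \<rat>"
proof (rule fixed_Rats)
  show "coeff (chi x) k \<in> K" unfolding chi_def
    by (rule coeff_linear_factors_mem_subring) (use x in auto)
  have "\<sigma> (coeff (chi x) k) = coeff (linear_factors (\<lambda>i. \<sigma> (gal i x)) {..<l}) k"
    unfolding chi_def using gal_diff[of _ _ 1]
    by (intro coeff_linear_factors_hom[where R = K]) (auto simp: x \<sigma>_zero \<sigma>_one \<sigma>_mult gal_Suc)
  also have "linear_factors (\<lambda>i. \<sigma> (gal i x)) {..<l} = linear_factors (\<lambda>i. gal i x) {..<l}"
  proof -
    let ?f = "\<lambda>i. [:- gal i x, 1:]"
    \<comment> \<open>\<open>\<sigma>\<close> shifts the factors by one; the factor of index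
      \<open>l\<close> equals the one of index 0, which is a nonzero polynomial and cancels.\<close>
    have "?f 0 * (\<Prod>i<l. ?f (Suc i)) = (\<Prod>i<l. ?f i) * ?f l"
      using prod.lessThan_Suc_shift[of ?f l] prod.lessThan_Suc[of ?f l] by (simp del: mult_pCons_left mult_pCons_right)
    then have "?f 0 * (\<Prod>i<l. ?f (Suc i)) = ?f 0 * (\<Prod>i<l. ?f i)"
      using gal_l[OF x] by (simp only: gal_0 mult.commute)
    then show ?thesis unfolding linear_factors_def by (subst (asm) mult_cancel_left) (simp add: gal_Suc)
  qed
  finally show "\<sigma> (coeff (chi x) k) = coeff (chi x) k" by (simp add: chi_def)
qed

lemma coeff_chi_Ints: assumes x: "x \<in> R" shows "coeff (chi x) k \<in> \<int>"
proof (rule R_Rats[OF _ coeff_chi_Rats[OF R_mem_K[OF x]]])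
  show "coeff (chi x) k \<in> R" unfolding chi_def
    by (rule coeff_linear_factors_mem_subring) (use x in \<open>auto intro: R_0 R_1 R_diff R_mult R_gal\<close>)
qed

lemma degree_chi: "degree (chi x) = l" and coeff_chi_l: "coeff (chi x) l = 1"
  unfolding chi_def using coeff_linear_factors_card[of "{..<l}"] by (simp_all add: degree_linear_factors)

lemma poly_chi_self: "poly (chi x) x = 0"
  using poly_linear_factors_root[of "{..<l}" 0 "\<lambda>i. gal i x"] l_pos unfolding chi_def by simp

lemma chi_relation: "x ^ l = - (\<Sum>k<l. coeff (chi x) k * x ^ k)"
proof -
  have "(\<Sum>k\<le>l. coeff (chi x) k * x ^ k) = 0"
    using poly_chi_self[of x] by (simp add: poly_altdef degree_chi)
  then have "(\<Sum>k<l. coeff (chi x) k * x ^ k) + x ^ l = 0"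
    using sum.lessThan_Suc[of "\<lambda>k. coeff (chi x) k * x ^ k" l]
    unfolding lessThan_Suc_atMost by (simp add: coeff_chi_l)
  then show ?thesis by (simp add: eq_neg_iff_add_eq_0 add.commute)
qed

lemma nm_gal: assumes x: "x \<in> K" shows "nm (gal i x) = nm x"
proof -
  have step: "nm (\<sigma> x) = nm x" if x: "x \<in> K" for x
  proof (cases "x = 0")
    case True
    then show ?thesis by (simp add: \<sigma>_zero)
  next
    case False
    have "gal 0 x * (\<Prod>i<l. gal (Suc i) x) = (\<Prod>i<l. gal i x) * gal l x"
      using prod.lessThan_Suc_shift[of "\<lambda>i. gal i x" l] prod.lessThan_Suc[of "\<lambda>i. gal i x" l] by simp
    moreover have "gal i (\<sigma> x) = gal (Suc i) x" for i
      using gal_gal[of i 1 x] by (simp add: gal_Suc)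
    ultimately show ?thesis using False gal_l[OF x] by (simp add: nm_def)
  qed
  show ?thesis using x by (induction i) (simp_all add: gal_Suc step)
qed

lemma nm_Rats: assumes x: "x \<in> K" shows "nm x \<in> \<rat>"
proof (rule fixed_Rats)
  show "nm x \<in> K" unfolding nm_def using x by auto
  have "\<sigma> (nm x) = gal 1 (nm x)" by (simp add: gal_Suc)
  also have "\<dots> = (\<Prod>i<l. gal 1 (gal i x))" unfolding nm_def using x by (intro gal_prod) auto
  also have "\<dots> = nm (gal 1 x)" unfolding nm_def by (simp add: gal_gal)
  finally show "\<sigma> (nm x) = nm x" using nm_gal[OF x] by simp
qed

lemma tr_Rats: assumes x: "x \<in> K" shows "tr x \<in> \<rat>"
proof (rule fixed_Rats)
  show "tr x \<in> K" unfolding tr_def using x by auto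
  have "\<sigma> (tr x) = gal 1 (tr x)" by (simp add: gal_Suc)
  also have "\<dots> = (\<Sum>i<l. gal 1 (gal i x))" unfolding tr_def using x by (intro gal_sum) auto
  also have "\<dots> = (\<Sum>i<l. gal (Suc i) x)" by (simp add: gal_gal)
  also have "\<dots> = tr x"
    using sum.lessThan_Suc_shift[of "\<lambda>i. gal i x" l] sum.lessThan_Suc[of "\<lambda>i. gal i x" l] gal_l[OF x]
    by (simp add: tr_def)
  finally show "\<sigma> (tr x) = tr x" .
qed

lemma nm_Ints: "x \<in> R \<Longrightarrow> nm x \<in> \<int>" and tr_Ints: "x \<in> R \<Longrightarrow> tr x \<in> \<int>"
  using R_Rats nm_Rats tr_Rats R_mem_K unfolding nm_def tr_def
  by (meson R_prod R_gal, meson R_sum R_gal)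

lemma nm_mult: "x \<in> K \<Longrightarrow> y \<in> K \<Longrightarrow> nm (x * y) = nm x * nm y"
  by (simp add: nm_def gal_mult prod.distrib)

lemma nm_1 [simp]: "nm 1 = 1"
  by (simp add: nm_def)

lemma nm_of_int: "nm (of_int n) = of_int n ^ l"
  by (simp add: nm_def)

lemma nm_eq_0_iff: "x \<in> K \<Longrightarrow> nm x = 0 \<longleftrightarrow> x = 0"
  using l_pos by (auto simp: nm_def intro!: bexI[of _ 0])

text \<open>The cofactor is the product of the other conjugates. It lets division by
  \<open>x\<close> be replaced by division by an integer.\<close>

lemma nm_cofactor: assumes x: "x \<in> R" shows "\<exists>y\<in>R. nm x = x * y"
proof
  show "(\<Prod>i\<in>{..<l} - {0}. gal i x) \<in> R" using x by (intro R_prod R_gal)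
  show "nm x = x * (\<Prod>i\<in>{..<l} - {0}. gal i x)"
    unfolding nm_def using l_pos by (subst prod.remove[of _ 0]) auto
qed

lemma tr_add: "x \<in> K \<Longrightarrow> y \<in> K \<Longrightarrow> tr (x + y) = tr x + tr y"
  by (simp add: tr_def gal_add sum.distrib)

lemma tr_diff: "x \<in> K \<Longrightarrow> y \<in> K \<Longrightarrow> tr (x - y) = tr x - tr y"
  by (simp add: tr_def gal_diff sum_subtractf)

lemma tr_sum: "(\<And>j. j \<in> J \<Longrightarrow> f j \<in> K) \<Longrightarrow> tr (\<Sum>j\<in>J. f j) = (\<Sum>j\<in>J. tr (f j))"
  by (induction J rule: infinite_finite_induct) (auto simp: tr_add sum_mem, auto simp: tr_def)

lemma tr_Rats_mult: "q \<in> \<rat> \<Longrightarrow> x \<in> K \<Longrightarrow> tr (q * x) = q * tr x"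
  by (simp add: tr_def gal_mult gal_Rats Rats_mem sum_distrib_left)

lemma tr_of_Rats: "q \<in> \<rat> \<Longrightarrow> tr q = of_nat l * q"
  by (simp add: tr_def gal_Rats)

text \<open>With \<open>d\<close> a common denominator of the coefficients, multiplying
  \<open>chi_relation\<close> by \<open>d ^ l\<close> gives a monic relation for
  \<open>d * x\<close> with integer coefficients.\<close>

lemma ex_integral_multiple:
  assumes x: "x \<in> K"
  shows "\<exists>d::int. d > 0 \<and> of_int d * x \<in> R"
proof -
  obtain d :: int where d: "d > 0" "\<forall>k\<in>{..<l}. of_int d * coeff (chi x) k \<in> \<int>"
    using common_denominator[of "{..<l}" "coeff (chi x)"] coeff_chi_Rats[OF x] by blast
  define y where "y = of_int d * x"
  have "\<exists>a. of_int d ^ (l - k) * coeff (chi x) k = of_int a" if "k < l" for k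
  proof -
    have "of_int d ^ (l - k) * coeff (chi x) k = of_int d ^ (l - k - 1) * (of_int d * coeff (chi x) k)"
      using that by (simp add: power_eq_if)
    also have "\<dots> \<in> \<int>" using d(2) that by (intro Ints_mult[OF Ints_power[OF Ints_of_int]]) auto
    finally show ?thesis by (auto elim: Ints_cases)
  qed
  then obtain a where a: "\<And>k. k < l \<Longrightarrow> of_int d ^ (l - k) * coeff (chi x) k = of_int (a k)" by metis
  have "y ^ l = of_int d ^ l * x ^ l" by (simp add: y_def power_mult_distrib)
  also have "\<dots> = (\<Sum>k<l. - (of_int d ^ l * coeff (chi x) k * x ^ k))"
    by (subst chi_relation) (simp add: sum_distrib_left sum_negf mult.assoc)
  also have "\<dots> = (\<Sum>k<l. of_int (- a k) * y ^ k)"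
  proof (rule sum.cong)
    fix k assume "k \<in> {..<l}"
    then have k: "k < l" by simp
    have "of_int d ^ l = (of_int d ^ (l - k) * of_int d ^ k :: complex)" using k by (simp flip: power_add)
    then have "of_int d ^ l * coeff (chi x) k * x ^ k = of_int (a k) * y ^ k"
      unfolding a[OF k, symmetric] y_def by (simp add: power_mult_distrib)
    then show "- (of_int d ^ l * coeff (chi x) k * x ^ k) = of_int (- a k) * y ^ k" by simp
  qed simp
  finally have rel: "y ^ l = (\<Sum>k<l. of_int (- a k) * y ^ k)" .
  have mem: "y ^ k \<in> int_span ((\<lambda>k. y ^ k) ` {..<l})" if "k < l" for k
    using that by (intro int_span_base) auto
  have "algebraic_int y"
  proof (rule algebraic_int_if_stabilizes)
    show "1 \<in> (\<lambda>k. y ^ k) ` {..<l}" using l_pos by (auto intro!: rev_image_eqI[of 0])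
    fix s assume "s \<in> (\<lambda>k. y ^ k) ` {..<l}"
    then obtain k where k: "k < l" "s = y ^ k" by auto
    show "y * s \<in> int_span ((\<lambda>k. y ^ k) ` {..<l})"
    proof (cases "Suc k < l")
      case True
      then show ?thesis using mem[of "Suc k"] k by simp
    next
      case False
      then have "y * s = y ^ l" using k by (metis Suc_lessI power_Suc)
      then show ?thesis unfolding rel using mem by (auto intro!: int_span_sum int_span_of_int_mult simp del: of_int_minus)
    qed
  qed auto
  then show ?thesis using d(1) x unfolding y_def by (intro exI[of _ d]) (auto intro!: R_I)
qed

section \<open>Discriminants and dual bases\<close>

definition gal_mat :: "(nat \<Rightarrow> complex) \<Rightarrow> complex mat" where
  "gal_mat w = mat l l (\<lambda>(i,j). gal i (w j))"

text \<open>A square root of the discriminant of \<open>w\<close>, by \<open>det_tr_form\<close>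
  with \<open>u = w\<close>. If all conjugates are real, its absolute value is the covolume of the
  lattice spanned by \<open>w\<close>.\<close>

definition D :: "(nat \<Rightarrow> complex) \<Rightarrow> complex" where "D w = det (gal_mat w)"

lemma gal_mat_carrier: "gal_mat w \<in> carrier_mat l l" and gal_mat_T_carrier: "(gal_mat w)\<^sup>T \<in> carrier_mat l l"
  by (simp_all add: gal_mat_def)

lemma gal_mat_T_mult:
  assumes "\<And>j. j < l \<Longrightarrow> u j \<in> K" "\<And>j. j < l \<Longrightarrow> w j \<in> K"
  shows "(gal_mat u)\<^sup>T * gal_mat w = mat l l (\<lambda>(i,j). tr (u i * w j))"
  by (rule eq_matI)
    (use assms in \<open>auto simp: gal_mat_def scalar_prod_def tr_def gal_mult atLeast0LessThan\<close>)

lemma det_tr_form: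
  assumes "\<And>j. j < l \<Longrightarrow> u j \<in> K" "\<And>j. j < l \<Longrightarrow> w j \<in> K"
  shows "det (mat l l (\<lambda>(i,j). tr (u i * w j))) = D u * D w"
  unfolding gal_mat_T_mult[of u w, OF assms, symmetric, simplified] D_def
  by (simp add: det_mult[OF gal_mat_T_carrier gal_mat_carrier] det_transpose[OF gal_mat_carrier])

text \<open>A Vandermonde determinant: a kernel vector would be a nonzero polynomial of degree below
  \<open>l\<close> vanishing at the \<open>l\<close> distinct conjugates of
  \<open>x\<close>.\<close>

lemma D_powers_nonzero:
  assumes x: "x \<in> K" "x \<notin> \<rat>"
  shows "D (\<lambda>j. x ^ j) \<noteq> 0"
proof
  assume "D (\<lambda>j. x ^ j) = 0"
  then obtain v where v: "v \<in> carrier_vec l" "v \<noteq> 0\<^sub>v l" "gal_mat (\<lambda>j. x ^ j) *\<^sub>v v = 0\<^sub>v l"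
    unfolding D_def det_0_iff_vec_prod_zero[OF gal_mat_carrier] by blast
  define p where "p = (\<Sum>j<l. monom (v $ j) j)"
  have cp: "coeff p j = v $ j" if "j < l" for j
    using that by (simp add: p_def coeff_sum if_distrib cong: if_cong)
  have root: "poly p (gal i x) = 0" if i: "i < l" for i
  proof -
    have "0 = (gal_mat (\<lambda>j. x ^ j) *\<^sub>v v) $ i" using v i by simp
    also have "\<dots> = poly p (gal i x)"
      using i v(1) x(1) by (auto simp: gal_mat_def scalar_prod_def p_def poly_sum poly_monom gal_power atLeast0LessThan
        intro!: sum.cong)
    finally show ?thesis by simp
  qed
  have "p \<noteq> 0"
  proof
    assume "p = 0"
    then have "v $ j = 0" if "j < l" for j using cp[OF that] by simp
    then show False using v(1,2) by (metis carrier_vecD eq_vecI index_zero_vec)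
  qed
  have "degree p \<le> l - 1"
    unfolding p_def by (intro degree_sum_le order.trans[OF degree_monom_le]) auto
  then have deg: "degree p < l" using l_pos by simp
  have "l = card ((\<lambda>i. gal i x) ` {..<l})" using card_image[OF inj_on_gal[OF x]] by simp
  also have "\<dots> \<le> card {z. poly p z = 0}"
    using root \<open>p \<noteq> 0\<close> by (intro card_mono poly_roots_finite) auto
  also have "\<dots> \<le> degree p" using \<open>p \<noteq> 0\<close> by (rule card_poly_roots_bound)
  finally show False using deg by simp
qed

text \<open>The conjugates of \<open>y\<close> form a kernel vector of the transposed matrix of
  \<open>w\<close>.\<close>

lemma tr_form_nondegenerate:
  assumes w: "\<And>j. j < l \<Longrightarrow> w j \<in> K" "D w \<noteq> 0" and y: "y \<in> K" "\<And>j. j < l \<Longrightarrow> tr (y * w j) = 0"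
  shows "y = 0"
proof (rule ccontr)
  assume "y \<noteq> 0"
  define v where "v = vec l (\<lambda>i. gal i y)"
  have "v \<noteq> 0\<^sub>v l"
  proof
    assume "v = 0\<^sub>v l"
    then have "v $ 0 = 0" using l_pos by simp
    then show False using \<open>y \<noteq> 0\<close> l_pos by (simp add: v_def)
  qed
  moreover have "(gal_mat w)\<^sup>T *\<^sub>v v = 0\<^sub>v l"
  proof (rule eq_vecI)
    fix j assume "j < dim_vec (0\<^sub>v l :: complex vec)"
    then have j: "j < l" by simp
    then have "((gal_mat w)\<^sup>T *\<^sub>v v) $ j = tr (y * w j)"
      using w(1)[OF j] y(1) by (auto simp: gal_mat_def v_def scalar_prod_def tr_def gal_mult atLeast0LessThan mult.commute)
    then show "((gal_mat w)\<^sup>T *\<^sub>v v) $ j = 0\<^sub>v l $ j" using y(2)[OF j] j by simp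
  qed (simp add: gal_mat_def)
  moreover have "v \<in> carrier_vec l" by (simp add: v_def)
  ultimately have "det ((gal_mat w)\<^sup>T) = 0"
    unfolding det_0_iff_vec_prod_zero[OF gal_mat_T_carrier] by blast
  then show False using w(2) by (simp add: D_def det_transpose[OF gal_mat_carrier])
qed

text \<open>\<open>u\<close> is the trace-dual basis of \<open>w\<close>; for an integral basis
  \<open>w\<close> it spans the dual lattice of the ring of integers (the codifferent).\<close>

definition dual_pair :: "(nat \<Rightarrow> complex) \<Rightarrow> (nat \<Rightarrow> complex) \<Rightarrow> bool" where
  "dual_pair w u \<longleftrightarrow> (\<forall>j<l. w j \<in> K \<and> u j \<in> K) \<and> (\<forall>j<l. \<forall>k<l. tr (u j * w k) = (if j = k then 1 else 0))"

lemma dual_pair_D: assumes "dual_pair w u" shows "D u * D w = 1"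
proof -
  have "mat l l (\<lambda>(i,j). tr (u i * w j)) = 1\<^sub>m l"
    using assms by (intro eq_matI) (auto simp: dual_pair_def)
  then show ?thesis using det_tr_form[of u w] assms by (simp add: dual_pair_def)
qed

lemma dual_pair_expansion:
  assumes dp: "dual_pair w u" and x: "x \<in> K"
  shows "x = (\<Sum>j<l. tr (x * u j) * w j)"
proof -
  have wu: "w j \<in> K" "u j \<in> K" if "j < l" for j using dp that by (auto simp: dual_pair_def)
  have trK: "tr (x * u j) \<in> \<rat>" if "j < l" for j using x wu that by (intro tr_Rats) auto
  define y where "y = x - (\<Sum>j<l. tr (x * u j) * w j)"
  have sK: "(\<Sum>j<l. tr (x * u j) * w j) \<in> K" using wu trK by (intro sum_mem mult_mem) (auto intro: Rats_mem)
  have "D u \<noteq> 0" using dual_pair_D[OF dp] by auto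
  have "y = 0"
  proof (rule tr_form_nondegenerate[OF wu(2) \<open>D u \<noteq> 0\<close>])
    show "y \<in> K" using x sK by (auto simp: y_def)
    fix k assume k: "k < l"
    have "tr ((\<Sum>j<l. tr (x * u j) * w j) * u k) = tr (\<Sum>j<l. tr (x * u j) * (w j * u k))"
      by (simp add: sum_distrib_right mult.assoc)
    also have "\<dots> = (\<Sum>j<l. tr (tr (x * u j) * (w j * u k)))"
      using wu trK k by (intro tr_sum mult_mem) (auto intro: Rats_mem)
    also have "\<dots> = (\<Sum>j<l. tr (x * u j) * tr (w j * u k))"
      using wu trK k by (intro sum.cong tr_Rats_mult) auto
    also have "\<dots> = (\<Sum>j<l. if j = k then tr (x * u k) else 0)"
      using dp k by (intro sum.cong) (auto simp: dual_pair_def mult.commute)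
    also have "\<dots> = tr (x * u k)" using k by simp
    finally show "tr (y * u k) = 0"
      using x sK wu(2)[OF k] by (simp add: y_def left_diff_distrib tr_diff mult_mem)
  qed
  then show ?thesis by (simp add: y_def)
qed

text \<open>The coordinates of \<open>u\<close> in terms of \<open>w\<close> form the inverse Gram
  matrix of the trace form, rational as the adjugate divided by the determinant.\<close>

lemma ex_dual:
  assumes w: "\<And>j. j < l \<Longrightarrow> w j \<in> K" "D w \<noteq> 0"
  shows "\<exists>u. dual_pair w u"
proof -
  define T where "T = mat l l (\<lambda>(i,j). tr (w i * w j))"
  have T: "T \<in> carrier_mat l l" by (simp add: T_def)
  have entT: "T $$ (i,j) = tr (w i * w j)" if "i < l" "j < l" for i j using that by (simp add: T_def)
  have detT: "det T = D w * D w" unfolding T_def by (rule det_tr_form[OF w(1) w(1)])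
  then have detT0: "det T \<noteq> 0" using w(2) by simp
  have ratT: "T $$ (i,j) \<in> \<rat>" if "i < l" "j < l" for i j
    using entT that w(1) by (auto intro!: tr_Rats)
  have "det T \<in> \<rat>" using det_mem_subring[OF T, of \<rat>] ratT by auto
  define q where "q k j = adj_mat T $$ (k,j) / det T" for k j
  have q: "q k j \<in> \<rat>" if "k < l" "j < l" for k j
    unfolding q_def using adj_mat_mem_Rats[OF T ratT that] \<open>det T \<in> \<rat>\<close> by (rule Rats_divide)
  have Tq: "(\<Sum>k<l. tr (w m * w k) * q k j) = (if m = j then 1 else 0)" if "m < l" "j < l" for m j
  proof -
    have "(T * adj_mat T) $$ (m,j) = (\<Sum>k<l. T $$ (m,k) * adj_mat T $$ (k,j))"
      using T adj_mat(1)[OF T] that by (auto simp: scalar_prod_def atLeast0LessThan)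
    then have "(\<Sum>k<l. tr (w m * w k) * adj_mat T $$ (k,j)) = (if m = j then det T else 0)"
      unfolding adj_mat(2)[OF T] using that entT by auto
    then have "(\<Sum>k<l. tr (w m * w k) * adj_mat T $$ (k,j)) / det T = (if m = j then 1 else 0)"
      using detT0 by auto
    then show ?thesis by (simp add: q_def sum_divide_distrib)
  qed
  define u where "u j = (\<Sum>k<l. q k j * w k)" for j
  have uK: "u j \<in> K" if "j < l" for j
    unfolding u_def using q that w(1) by (intro sum_mem mult_mem) (auto intro: Rats_mem)
  have "tr (u j * w m) = (if j = m then 1 else 0)" if "j < l" "m < l" for j m
  proof -
    have "tr (u j * w m) = tr (\<Sum>k<l. q k j * (w m * w k))"
      unfolding u_def by (simp add: sum_distrib_left mult.commute mult.left_commute)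
    also have "\<dots> = (\<Sum>k<l. tr (q k j * (w m * w k)))"
      using q that w(1) by (intro tr_sum mult_mem) (auto intro: Rats_mem)
    also have "\<dots> = (\<Sum>k<l. tr (w m * w k) * q k j)"
      using q that w(1) by (intro sum.cong) (auto simp: tr_Rats_mult mult_mem mult.commute)
    finally show ?thesis using Tq that by auto
  qed
  then show ?thesis using w(1) uK by (intro exI[of _ u]) (auto simp: dual_pair_def)
qed

lemma D_sq_Ints: assumes "\<And>j. j < l \<Longrightarrow> w j \<in> R" shows "D w * D w \<in> \<int>"
proof -
  have "det (mat l l (\<lambda>(i,j). tr (w i * w j))) \<in> \<int>"
    using assms by (intro det_mem_subring[where n = l]) (auto intro!: tr_Ints R_mult)
  then show ?thesis using det_tr_form[of w w] assms R_mem_K by simp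
qed

text \<open>Cramer's rule: \<open>tr (z * u k)\<close> is the coordinate of \<open>z\<close> at
  \<open>w k\<close>, and only column \<open>k\<close> of the identity changes.\<close>

lemma D_replace:
  assumes dp: "dual_pair w u" and z: "z \<in> K" and k: "k < l"
  shows "D (w(k := z)) = tr (z * u k) * D w"
proof -
  let ?E = "mat l l (\<lambda>(i,j). if j = k then tr (z * u i) else if i = j then 1 else 0)"
  have wu: "w j \<in> K" "u j \<in> K" if "j < l" for j using dp that by (auto simp: dual_pair_def)
  have trK: "tr (z * u j) \<in> \<rat>" if "j < l" for j using z wu that by (intro tr_Rats) auto
  have E: "?E \<in> carrier_mat l l" by simp
  have "gal_mat w * ?E = gal_mat (w(k := z))"
  proof (rule eq_matI)
    fix i j assume "i < dim_row (gal_mat (w(k := z)))" "j < dim_col (gal_mat (w(k := z)))"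
    then have ij: "i < l" "j < l" by (auto simp: gal_mat_def)
    have "(gal_mat w * ?E) $$ (i,j) = (\<Sum>m<l. gal i (w m) * (if j = k then tr (z * u m) else if m = j then 1 else 0))"
      using ij by (simp add: gal_mat_def scalar_prod_def atLeast0LessThan)
    also have "\<dots> = gal i ((w(k := z)) j)"
    proof (cases "j = k")
      case True
      have "gal i z = gal i (\<Sum>m<l. tr (z * u m) * w m)" using dual_pair_expansion[OF dp z] by simp
      also have "\<dots> = (\<Sum>m<l. gal i (tr (z * u m) * w m))"
        using wu trK by (intro gal_sum mult_mem) (auto intro: Rats_mem)
      also have "\<dots> = (\<Sum>m<l. gal i (w m) * tr (z * u m))"
        using wu trK by (intro sum.cong) (auto simp: gal_mult gal_Rats Rats_mem)
      finally show ?thesis using True by simp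
    next
      case False
      then have "(\<Sum>m<l. gal i (w m) * (if j = k then tr (z * u m) else if m = j then 1 else 0))
        = (\<Sum>m<l. if m = j then gal i (w j) else 0)" by (intro sum.cong) auto
      then show ?thesis using False ij by simp
    qed
    finally show "(gal_mat w * ?E) $$ (i,j) = gal_mat (w(k := z)) $$ (i,j)"
      using ij by (simp add: gal_mat_def)
  qed (simp_all add: gal_mat_def)
  then have "D (w(k := z)) = D w * det ?E"
    unfolding D_def by (metis det_mult[OF gal_mat_carrier E])
  then show ?thesis using det_unit_columns_except[OF k, of "\<lambda>i. tr (z * u i)"] by simp
qed

text \<open>A basis of integers with \<^term>\<open>D w\<close> of least absolute value is an integral basis.\<close>

lemma ex_integral_basis:
  "\<exists>w u. dual_pair w u \<and> (\<forall>j<l. w j \<in> R) \<and> (\<forall>z\<in>R. \<forall>j<l. tr (z * u j) \<in> \<int>)"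
proof -
  define basis where "basis w \<longleftrightarrow> (\<forall>j<l. w j \<in> R) \<and> D w \<noteq> 0" for w
  \<comment> \<open>The floor only provides a natural number to minimize; it is exact, since
    \<open>D w * D w\<close> is an integer.\<close>
  define dd where "dd w = nat \<lfloor>norm (D w * D w)\<rfloor>" for w
  have dd: "real (dd w) = (norm (D w))\<^sup>2" if "basis w" for w
  proof -
    obtain k where k: "D w * D w = of_int k"
      using D_sq_Ints[of w] \<open>basis w\<close> by (auto simp: basis_def elim: Ints_cases)
    have n: "norm (D w * D w) = real_of_int \<bar>k\<bar>" unfolding k by simp
    have "real (dd w) = real_of_int \<bar>k\<bar>" unfolding dd_def n by (simp only: floor_of_int of_nat_nat abs_ge_zero)
    then show ?thesis using n by (simp add: norm_mult power2_eq_square)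
  qed
  obtain x where x: "x \<in> K" "x \<notin> \<rat>" using ex_nonrational by blast
  obtain d :: int where d: "d > 0" "of_int d * x \<in> R" using ex_integral_multiple[OF x(1)] by blast
  have "of_int d * x \<notin> \<rat>"
  proof
    assume "of_int d * x \<in> \<rat>"
    then have "of_int d * x / of_int d \<in> \<rat>" by (intro Rats_divide) auto
    then show False using x(2) d(1) by simp
  qed
  then have "basis (\<lambda>j. (of_int d * x) ^ j)"
    unfolding basis_def using D_powers_nonzero[of "of_int d * x"] d(2) R_power R_mem_K by auto
  from ex_has_least_nat[of basis, OF this, of dd]
  obtain w where w: "basis w" and least: "\<And>w'. basis w' \<Longrightarrow> dd w \<le> dd w'" by blast
  have wR: "w j \<in> R" if "j < l" for j using w that by (auto simp: basis_def)
  obtain u where dp: "dual_pair w u"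
    using ex_dual[of w] w R_mem_K[OF wR] by (auto simp: basis_def)
  have uK: "u j \<in> K" if "j < l" for j using dp that by (auto simp: dual_pair_def)
  have "tr (z * u j) \<in> \<int>" if z: "z \<in> R" and j: "j < l" for z j
  proof (rule ccontr)
    assume nint: "tr (z * u j) \<notin> \<int>"
    have "tr (z * u j) \<in> \<rat>" using uK[OF j] R_mem_K[OF z] by (auto intro!: tr_Rats)
    then obtain q where q: "tr (z * u j) = of_rat q" by (auto elim: Rats_cases)
    \<comment> \<open>Removing the integral part of the coordinate at \<open>w j\<close> and
      exchanging \<open>w j\<close> for the remainder multiplies \<open>D\<close> by
      \<open>frac q\<close>, which is below 1.\<close>
    define z' where "z' = z - of_int \<lfloor>q\<rfloor> * w j"
    have z': "z' \<in> R" unfolding z'_def using z wR[OF j] by (intro R_diff R_mult R_of_int)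
    have "tr (z' * u j) = tr (z * u j) - tr (of_int \<lfloor>q\<rfloor> * (u j * w j))"
      unfolding z'_def left_diff_distrib using R_mem_K[OF z] uK[OF j] R_mem_K[OF wR[OF j]]
      by (subst tr_diff) (auto simp: mult_mem ac_simps)
    also have "\<dots> = of_rat q - of_int \<lfloor>q\<rfloor> * tr (u j * w j)"
      using q uK[OF j] R_mem_K[OF wR[OF j]] by (simp add: tr_Rats_mult mult_mem)
    also have "\<dots> = of_rat (q - of_int \<lfloor>q\<rfloor>)"
      using dp j by (simp add: dual_pair_def of_rat_diff)
    finally have f: "tr (z' * u j) = of_rat (frac q)" by (simp add: frac_def)
    have "frac q \<noteq> 0"
    proof
      assume "frac q = 0"
      then have "q \<in> \<int>" by simp
      then show False using nint q by (auto elim!: Ints_cases)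
    qed
    then have fq: "norm (of_rat (frac q) :: complex) > 0" by simp
    have nf: "norm (of_rat (frac q) :: complex) < 1"
    proof -
      have "(of_rat (frac q) :: complex) = of_real (of_rat (frac q))"
        by (simp add: of_real_of_rat)
      then have "norm (of_rat (frac q) :: complex) = \<bar>of_rat (frac q)\<bar>" by (simp only: norm_of_real)
      also have "\<dots> = of_rat (frac q)" using frac_ge_0[of q] by (simp only: abs_of_nonneg zero_le_of_rat_iff)
      also have "\<dots> < of_rat 1" using frac_lt_1[of q] by (simp only: of_rat_less)
      finally show ?thesis by simp
    qed
    have D': "D (w(j := z')) = of_rat (frac q) * D w" using D_replace[OF dp R_mem_K[OF z'] j] f by simp
    have b': "basis (w(j := z'))" unfolding basis_def D' using w z' fq by (auto simp: basis_def)
    have "real (dd (w(j := z'))) = (norm (of_rat (frac q) :: complex))\<^sup>2 * (norm (D w))\<^sup>2"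
      unfolding dd[OF b'] D' by (simp add: norm_mult power_mult_distrib)
    also have "\<dots> < 1 * (norm (D w))\<^sup>2"
      using nf w by (intro mult_strict_right_mono) (simp_all add: abs_square_less_1 basis_def)
    also have "\<dots> = real (dd w)" using dd[OF w] by simp
    finally show False using least[OF b'] by simp
  qed
  then show ?thesis using dp wR by blast
qed

end

section \<open>Totally ramified primes\<close>

context cyclic_ext
begin

definition pR :: "int \<Rightarrow> complex set" where "pR p = (\<lambda>y. of_int p * y) ` R"

lemma pR_I: "y \<in> R \<Longrightarrow> x = of_int p * y \<Longrightarrow> x \<in> pR p"
  by (auto simp: pR_def)

lemma pR_E: assumes "x \<in> pR p" obtains y where "y \<in> R" "x = of_int p * y"
  using assms by (auto simp: pR_def)

lemma pR_add: "x \<in> pR p \<Longrightarrow> y \<in> pR p \<Longrightarrow> x + y \<in> pR p"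
proof -
  assume "x \<in> pR p" "y \<in> pR p"
  then obtain a b where "a \<in> R" "b \<in> R" "x = of_int p * a" "y = of_int p * b" by (auto elim!: pR_E)
  then show ?thesis by (intro pR_I[of "a + b"] R_add) (simp_all add: distrib_left)
qed

lemma pR_mult: "x \<in> pR p \<Longrightarrow> r \<in> R \<Longrightarrow> r * x \<in> pR p"
proof -
  assume r: "r \<in> R" and "x \<in> pR p"
  then obtain a where "a \<in> R" "x = of_int p * a" by (auto elim!: pR_E)
  then show ?thesis using r by (intro pR_I[of "r * a"] R_mult) simp_all
qed

lemma pR_mult_right: "x \<in> pR p \<Longrightarrow> r \<in> R \<Longrightarrow> x * r \<in> pR p"
  using pR_mult[of x p r] by (simp add: mult.commute)

lemma pR_minus: "x \<in> pR p \<Longrightarrow> - x \<in> pR p"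
  using pR_mult[of x p "- 1"] R_of_int[of "-1"] by simp

lemma pR_diff: "x \<in> pR p \<Longrightarrow> y \<in> pR p \<Longrightarrow> x - y \<in> pR p"
  using pR_add[of x p "- y"] pR_minus by simp

lemma pR_0: "0 \<in> pR p"
  by (rule pR_I[OF R_0]) simp

lemma pR_self: "of_int p \<in> pR p"
  by (rule pR_I[OF R_1]) simp

lemma pR_sum: "(\<And>i. i \<in> I \<Longrightarrow> f i \<in> pR p) \<Longrightarrow> (\<Sum>i\<in>I. f i) \<in> pR p"
  by (induction I rule: infinite_finite_induct) (auto intro: pR_add pR_0)

lemma pR_gal: "x \<in> pR p \<Longrightarrow> gal i x \<in> pR p"
  by (auto elim!: pR_E intro!: pR_I[OF R_gal] simp: gal_mult R_mem_K)

lemma pR_of_int_iff: assumes "p \<noteq> 0" shows "of_int n \<in> pR p \<longleftrightarrow> p dvd n"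
proof
  assume "of_int n \<in> pR p"
  then obtain y where y: "y \<in> R" "of_int n = of_int p * y" by (rule pR_E)
  have "y = of_int n / of_int p" using y(2) assms by simp
  then have "y \<in> \<int>" using R_Rats[OF y(1)] by simp
  then obtain k where "y = of_int k" by (auto elim: Ints_cases)
  then have "(of_int n :: complex) = of_int (p * k)" using y(2) by simp
  then show "p dvd n" by (metis dvd_triv_left of_int_eq_iff)
next
  assume "p dvd n"
  then obtain k where "n = p * k" by blast
  then show "of_int n \<in> pR p" by (intro pR_I[OF R_of_int[of k]]) simp
qed

text \<open>An ideal witnessing that the Galois group acts trivially modulo a prime above \<open>p\<close>.\<close>

definition inertial :: "int \<Rightarrow> complex set \<Rightarrow> bool" where
  "inertial p J \<longleftrightarrow> J \<subseteq> R \<and> (\<forall>x\<in>J. \<forall>y\<in>J. x + y \<in> J) \<and> (\<forall>x\<in>J. \<forall>r\<in>R. r * x \<in> J) \<and>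
     of_int p \<in> J \<and> 1 \<notin> J \<and> (\<forall>w\<in>R. \<forall>i. gal i w - w \<in> J)"

text \<open>Dedekind's independence argument modulo \<open>p\<close>: a shortest relation among the conjugations with
  coefficients in the module \<open>R / p R\<close> has coefficients whose annihilators are inertial.\<close>

lemma ex_inertial:
  assumes p: "prime p" and y: "y \<in> R" "y \<notin> pR p" "\<And>z. z \<in> R \<Longrightarrow> tr (y * z) \<in> pR p"
  shows "\<exists>J. inertial p J"
proof -
  define rel where "rel zI \<longleftrightarrow> (case zI of (z, I) \<Rightarrow> I \<subseteq> {..<l} \<and> I \<noteq> {} \<and> (\<forall>i\<in>I. z i \<in> R \<and> z i \<notin> pR p) \<and>
    (\<forall>w\<in>R. (\<Sum>i\<in>I. z i * gal i w) \<in> pR p))" for zI :: "(nat \<Rightarrow> complex) \<times> nat set"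
  have galy: "gal i y \<notin> pR p" if "i < l" for i
  proof
    assume "gal i y \<in> pR p"
    then have "gal (l - i) (gal i y) \<in> pR p" by (rule pR_gal)
    then show False using y that by (simp add: gal_gal gal_l R_mem_K)
  qed
  \<comment> \<open>The hypothesis on \<open>y\<close> is itself a relation, with coefficients
    \<open>gal i y\<close>.\<close>
  have "rel (\<lambda>i. gal i y, {..<l})"
    unfolding rel_def using l_pos y galy
    by (auto simp: tr_def gal_mult R_mem_K intro: R_gal)
  from ex_has_least_nat[of rel, OF this, of "\<lambda>zI. card (snd zI)"]
  obtain zI where zI: "rel zI" "\<And>zI'. rel zI' \<Longrightarrow> card (snd zI) \<le> card (snd zI')" by blast
  obtain z I where eq: "zI = (z, I)" by fastforce
  have I: "I \<subseteq> {..<l}" "I \<noteq> {}" "\<And>i. i \<in> I \<Longrightarrow> z i \<in> R" "\<And>i. i \<in> I \<Longrightarrow> z i \<notin> pR p"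
    "\<And>w. w \<in> R \<Longrightarrow> (\<Sum>i\<in>I. z i * gal i w) \<in> pR p" using zI(1) unfolding rel_def eq by auto
  have finI: "finite I" using I(1) finite_subset by blast
  obtain i0 where i0: "i0 \<in> I" using I(2) by blast
  \<comment> \<open>At \<open>w = 1\<close>, a relation with a single term would put its coefficient
    into \<open>pR p\<close>.\<close>
  have "I \<noteq> {i0}" using I(5)[OF R_1] I(4)[OF i0] by auto
  then obtain i1 where i1: "i1 \<in> I" "i1 \<noteq> i0" using i0 by blast
  have ann: "z j * (gal j w - gal i0 w) \<in> pR p" if w: "w \<in> R" and j: "j \<in> I" for w j
  proof (rule ccontr)
    assume neg: "z j * (gal j w - gal i0 w) \<notin> pR p"
    define z' where "z' j = z j * (gal j w - gal i0 w)" for j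
    \<comment> \<open>Terms that vanish modulo \<open>p\<close> are dropped to restore the condition
      in \<open>rel\<close>; the term of index \<open>i0\<close> is among them, so the relation gets
      shorter.\<close>
    define I' where "I' = {j\<in>I. z' j \<notin> pR p}"
    have z'R: "z' j \<in> R" if "j \<in> I" for j unfolding z'_def using that I(3) w by (intro R_mult R_diff R_gal)
    have "(\<Sum>j\<in>I'. z' j * gal j v) \<in> pR p" if v: "v \<in> R" for v
    proof -
      have "(\<Sum>j\<in>I. z j * gal j (w * v)) - gal i0 w * (\<Sum>j\<in>I. z j * gal j v) \<in> pR p"
        using I(5)[of "w * v"] I(5)[OF v] w v by (intro pR_diff pR_mult) (auto intro: R_mult R_gal)
      also have "(\<Sum>j\<in>I. z j * gal j (w * v)) - gal i0 w * (\<Sum>j\<in>I. z j * gal j v) = (\<Sum>j\<in>I. z' j * gal j v)"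
        unfolding sum_distrib_left sum_subtractf[symmetric] using w v
        by (intro sum.cong) (auto simp: gal_mult R_mem_K z'_def algebra_simps)
      also have "\<dots> = (\<Sum>j\<in>I'. z' j * gal j v) + (\<Sum>j\<in>I - I'. z' j * gal j v)"
        using sum.subset_diff[of I' I "\<lambda>j. z' j * gal j v"] finI by (simp add: I'_def add.commute)
      finally have "(\<Sum>j\<in>I'. z' j * gal j v) + (\<Sum>j\<in>I - I'. z' j * gal j v) \<in> pR p" .
      moreover have "(\<Sum>j\<in>I - I'. z' j * gal j v) \<in> pR p"
        using v by (intro pR_sum pR_mult_right) (auto simp: I'_def intro: R_gal)
      ultimately show ?thesis using pR_diff by fastforce
    qed
    then have "rel (z', I')" unfolding rel_def using I(1) neg j z'R by (auto simp: I'_def z'_def)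
    then have "card I \<le> card I'" using zI(2) unfolding eq by fastforce
    moreover have "i0 \<notin> I'" by (simp add: I'_def z'_def pR_0)
    then have "I' \<subset> I" using i0 unfolding I'_def by blast
    then have "card I' < card I" using finI by (rule psubset_card_mono[rotated])
    ultimately show False by simp
  qed
  \<comment> \<open>The annihilator of \<open>z i1\<close> modulo \<open>p\<close>, proper because
    \<open>z i1\<close> is not in \<open>pR p\<close>.\<close>
  define J0 where "J0 = {a\<in>R. a * z i1 \<in> pR p}"
  have J0: "gal i1 w - gal i0 w \<in> J0" "gal i0 w - gal i1 w \<in> J0" if "w \<in> R" for w
  proof -
    have D: "gal i1 w - gal i0 w \<in> R" "(gal i1 w - gal i0 w) * z i1 \<in> pR p"
      using ann[OF that i1(1)] that by (auto simp: mult.commute intro: R_diff R_gal)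
    then show "gal i1 w - gal i0 w \<in> J0" by (simp add: J0_def)
    show "gal i0 w - gal i1 w \<in> J0"
      using R_minus[OF D(1)] pR_minus[OF D(2)] by (simp add: J0_def left_diff_distrib)
  qed
  define a where "a = min i0 i1"
  define k where "k = max i0 i1 - a"
  have "i0 < l" "i1 < l" using i0 i1 I(1) by auto
  then have k: "0 < k" "k < l" using i1(2) by (auto simp: k_def a_def max_def min_def)
  \<comment> \<open>Pulling back along the conjugation of smaller index turns the congruence of the
    two into one between \<open>gal k\<close> and the identity.\<close>
  define J where "J = {x\<in>R. gal a x \<in> J0}"
  have J_add: "x + y \<in> J" if "x \<in> J" "y \<in> J" for x y
    using that by (auto simp: J_def J0_def gal_add R_mem_K distrib_right intro: R_add pR_add)
  have gk: "gal k w - w \<in> J" if w: "w \<in> R" for w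
  proof -
    have "gal a (gal k w - w) = gal (max i0 i1) w - gal a w"
      using w by (simp add: gal_diff R_mem_K gal_gal k_def a_def)
    also have "\<dots> \<in> J0" using J0[OF w] by (cases "i0 \<le> i1") (simp_all add: a_def max_def min_def)
    finally show ?thesis using w by (simp add: J_def R_diff R_gal)
  qed
  have gkm: "gal (k * m) w - w \<in> J" if w: "w \<in> R" for w m
  proof (induction m)
    case 0
    then show ?case by (simp add: J_def J0_def R_0 pR_0)
  next
    case (Suc m)
    have "gal (k * Suc m) w - w = (gal k (gal (k * m) w) - gal (k * m) w) + (gal (k * m) w - w)"
      by (simp add: gal_gal)
    also have "\<dots> \<in> J" using gk[OF R_gal[OF w]] Suc by (rule J_add)
    finally show ?case .
  qed
  have "inertial p J" unfolding inertial_def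
  proof (intro conjI ballI allI)
    show "J \<subseteq> R" by (auto simp: J_def)
    show "x + y \<in> J" if "x \<in> J" "y \<in> J" for x y using that by (rule J_add)
    show "r * x \<in> J" if "x \<in> J" "r \<in> R" for x r
      using that by (auto simp: J_def J0_def gal_mult R_mem_K mult.assoc intro: R_mult R_gal pR_mult)
    show "of_int p \<in> J"
      using I(3)[OF i1(1)] by (auto simp: J_def J0_def R_of_int intro: pR_I)
    show "1 \<notin> J" using I(4)[OF i1(1)] by (simp add: J_def J0_def)
    fix w i assume w: "w \<in> R"
    obtain m q where "k * m = 1 + l * q" using gal_generates[OF k] by blast
    then have "k * (m * i) = i + l * (q * i)" by (metis add_mult_distrib mult.assoc nat_mult_1)
    then have "gal (k * (m * i)) w = gal i w" using gal_add_mult_l[OF R_mem_K[OF w]] by simp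
    then show "gal i w - w \<in> J" using gkm[OF w, of "m * i"] by simp
  qed
  then show ?thesis by blast
qed

section \<open>The prime ideal above an inertial prime number\<close>

context
  fixes p :: int and J :: "complex set"
  assumes p: "prime p" and J: "inertial p J"
begin

lemma J_add: "x \<in> J \<Longrightarrow> y \<in> J \<Longrightarrow> x + y \<in> J"
  and J_mult: "x \<in> J \<Longrightarrow> r \<in> R \<Longrightarrow> r * x \<in> J"
  and J_p: "of_int p \<in> J"
  and J_proper: "1 \<notin> J"
  and J_gal: "w \<in> R \<Longrightarrow> gal i w - w \<in> J"
  using J unfolding inertial_def by blast+

lemma p_nonzero: "p \<noteq> 0" using p by auto

lemma J_minus: "x \<in> J \<Longrightarrow> - x \<in> J"
  using J_mult[of x "- 1"] R_of_int[of "-1"] by simp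

lemma J_diff: "x \<in> J \<Longrightarrow> y \<in> J \<Longrightarrow> x - y \<in> J"
  using J_add[of x "- y"] J_minus by simp

lemma J_0: "0 \<in> J"
  using J_diff[OF J_p J_p] by simp

lemma J_sum: "(\<And>i. i \<in> I \<Longrightarrow> f i \<in> J) \<Longrightarrow> (\<Sum>i\<in>I. f i) \<in> J"
  by (induction I rule: infinite_finite_induct) (auto intro: J_add J_0)

lemma pR_subset_J: "x \<in> pR p \<Longrightarrow> x \<in> J"
  using J_mult[OF J_p] by (auto elim!: pR_E simp: mult.commute)

lemma J_of_int: assumes "of_int n \<in> J" shows "p dvd n"
proof (rule ccontr)
  assume "\<not> p dvd n"
  then have "coprime p n" by (rule prime_imp_coprime[OF p])
  then obtain a b where ab: "a * p + b * n = 1" using bezout_int[of p n] by (auto simp: coprime_iff_gcd_eq_1)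
  have "of_int a * of_int p + of_int b * of_int n \<in> J"
    using assms by (intro J_add J_mult J_p R_of_int)
  then have "(of_int (a * p + b * n) :: complex) \<in> J" by simp
  then show False using J_proper unfolding ab by simp
qed

lemma J_nm: assumes w: "w \<in> R" shows "nm w - w ^ l \<in> J"
proof -
  have "(\<Prod>i<m. gal i w) - w ^ m \<in> J" for m
  proof (induction m)
    case 0
    then show ?case using J_0 by simp
  next
    case (Suc m)
    have "(\<Prod>i<Suc m. gal i w) - w ^ Suc m = gal m w * ((\<Prod>i<m. gal i w) - w ^ m) + w ^ m * (gal m w - w)"
      by (simp add: algebra_simps)
    also have "\<dots> \<in> J" using Suc w by (intro J_add J_mult J_gal R_gal R_power)
    finally show ?case .
  qed
  then show ?thesis by (simp add: nm_def)
qed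

text \<open>Membership is a divisibility of integers. Closure under addition is the point where the
  triviality of the conjugations modulo \<open>J\<close> enters; \<open>P\<close> is then the prime
  ideal above \<open>p\<close>.\<close>

definition P :: "complex set" where "P = {x\<in>R. nm x \<in> pR p}"

lemma P_R: "x \<in> P \<Longrightarrow> x \<in> R" by (simp add: P_def)

lemma nm_pR_iff: assumes "nm x = of_int n" shows "nm x \<in> pR p \<longleftrightarrow> p dvd n"
  using assms pR_of_int_iff[OF p_nonzero] by simp

lemma ex_nm_int: "x \<in> R \<Longrightarrow> \<exists>n. nm x = of_int n"
  using nm_Ints by (auto elim: Ints_cases)

lemma P_power_J: assumes "x \<in> P" shows "x ^ l \<in> J"
proof -
  have "nm x - (nm x - x ^ l) \<in> J"
    using assms by (intro J_diff[OF pR_subset_J J_nm]) (auto simp: P_def)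
  then show ?thesis by simp
qed

text \<open>In the expansion of \<open>(x + y) ^ (l + l)\<close> every term contains
  \<open>x ^ l\<close> or \<open>y ^ l\<close>, both in \<open>J\<close>. So the square of
  \<open>nm (x + y)\<close>, congruent to this power, is an integer in \<open>J\<close> and a
  multiple of \<open>p\<close>.\<close>

lemma P_add: assumes "x \<in> P" "y \<in> P" shows "x + y \<in> P"
proof -
  have R: "x \<in> R" "y \<in> R" "x + y \<in> R" using assms P_R R_add by auto
  have "(x + y) ^ (l + l) = (\<Sum>k\<le>l + l. of_nat (l + l choose k) * x ^ k * y ^ (l + l - k))"
    by (rule binomial_ring)
  also have "\<dots> \<in> J"
  proof (rule J_sum)
    fix k
    show "of_nat (l + l choose k) * x ^ k * y ^ (l + l - k) \<in> J"
    proof (cases "k \<ge> l")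
      case True
      then have "of_nat (l + l choose k) * x ^ k * y ^ (l + l - k)
        = (of_nat (l + l choose k) * x ^ (k - l) * y ^ (l + l - k)) * x ^ l"
        by (simp add: mult_ac flip: power_add)
      also have "\<dots> \<in> J" using R by (intro J_mult P_power_J assms R_mult R_power R_of_nat)
      finally show ?thesis .
    next
      case False
      then have "l + l - k = (l - k) + l" by simp
      then have "of_nat (l + l choose k) * x ^ k * y ^ (l + l - k)
        = (of_nat (l + l choose k) * x ^ k * y ^ (l - k)) * y ^ l"
        by (simp add: power_add mult.assoc)
      also have "\<dots> \<in> J" using R by (intro J_mult P_power_J assms R_mult R_power R_of_nat)
      finally show ?thesis .
    qed
  qed
  finally have J2: "(x + y) ^ l * (x + y) ^ l \<in> J" by (simp add: power_add)
  obtain n where n: "nm (x + y) = of_int n" using ex_nm_int[OF R(3)] by blast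
  have "nm (x + y) * nm (x + y) = (nm (x + y) + (x + y) ^ l) * (nm (x + y) - (x + y) ^ l) + (x + y) ^ l * (x + y) ^ l"
    by (simp add: algebra_simps)
  also have "\<dots> \<in> J" unfolding n
    by (rule J_add[OF J_mult J2]) (use J_nm[OF R(3)] R n in \<open>auto intro: R_add R_power R_of_int\<close>)
  finally have "of_int (n * n) \<in> J" unfolding n by simp
  then have "p dvd n * n" by (rule J_of_int)
  then have "p dvd n" using p by (simp add: prime_dvd_mult_iff)
  then show ?thesis using nm_pR_iff[OF n] R by (simp add: P_def)
qed

lemma P_mult: "x \<in> P \<Longrightarrow> r \<in> R \<Longrightarrow> r * x \<in> P"
  using nm_Ints[of r] by (auto simp: P_def nm_mult R_mem_K intro: R_mult pR_mult R_Ints)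

lemma P_of_int_iff: "of_int n \<in> P \<longleftrightarrow> p dvd n"
proof -
  have "nm (of_int n) = of_int (n ^ l)" by (simp add: nm_of_int)
  from nm_pR_iff[OF this] show ?thesis
    using p l_pos by (auto simp: P_def R_of_int prime_dvd_power_iff)
qed

lemma P_diff: "x \<in> P \<Longrightarrow> y \<in> P \<Longrightarrow> x - y \<in> P"
  using P_add[of x "- y"] P_mult[of y "-1"] R_of_int[of "-1"] by simp

lemma P_0: "0 \<in> P"
  using P_of_int_iff[of 0] by simp

lemma pR_subset_P: "x \<in> pR p \<Longrightarrow> x \<in> P"
  using P_mult P_of_int_iff[of p] by (auto elim!: pR_E simp: mult.commute)

lemma P_gal: "x \<in> P \<Longrightarrow> gal i x \<in> P"
  by (auto simp: P_def nm_gal R_mem_K intro: R_gal)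

text \<open>The lower coefficients of \<open>chi x\<close> are integers lying in \<open>P\<close>,
  hence multiples of \<open>p\<close>. Thus every element of \<open>P\<close> is nilpotent modulo
  \<open>p\<close>.\<close>

lemma P_power_pR: assumes x: "x \<in> P" shows "x ^ l \<in> pR p"
proof -
  have "coeff (chi x) k \<in> pR p" if k: "k < l" for k
  proof -
    have "coeff (chi x) k \<in> P" unfolding chi_def
      by (rule coeff_linear_factors_mem_ideal[where R = R])
        (use k x P_gal P_mult P_R in \<open>auto intro: R_0 R_1 R_diff R_mult P_0 P_diff simp: mult.commute\<close>)
    moreover obtain n where "coeff (chi x) k = of_int n"
      using coeff_chi_Ints[OF P_R[OF x]] by (auto elim: Ints_cases)
    ultimately show ?thesis using P_of_int_iff pR_of_int_iff[OF p_nonzero] by simp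
  qed
  then show ?thesis using P_R[OF x]
    by (subst chi_relation) (auto intro!: pR_minus pR_sum pR_mult_right R_power)
qed

text \<open>Reduce the coordinates in an integral basis modulo \<open>p\<close>. Finiteness of the
  quotient replaces ideal theory below: once to find a common annihilator, once as a
  pigeonhole.\<close>

lemma finite_representatives: "\<exists>X. finite X \<and> X \<subseteq> R \<and> (\<forall>x\<in>R. \<exists>x0\<in>X. x - x0 \<in> pR p)"
proof -
  obtain w u where dp: "dual_pair w u" and w: "\<And>j. j < l \<Longrightarrow> w j \<in> R"
    and int: "\<And>z j. z \<in> R \<Longrightarrow> j < l \<Longrightarrow> tr (z * u j) \<in> \<int>" using ex_integral_basis by blast
  define X where "X = (\<lambda>a. \<Sum>j<l. of_int (a j) * w j) ` ({..<l} \<rightarrow>\<^sub>E {0..<p})"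
  have "finite X" unfolding X_def by (intro finite_imageI finite_PiE) auto
  moreover have "X \<subseteq> R" unfolding X_def using w by (auto intro!: R_sum R_mult R_of_int)
  moreover have "\<exists>x0\<in>X. x - x0 \<in> pR p" if x: "x \<in> R" for x
  proof -
    have "\<forall>j<l. \<exists>n. tr (x * u j) = of_int n" using int[OF x] by (auto elim: Ints_cases)
    then obtain n where n: "\<And>j. j < l \<Longrightarrow> tr (x * u j) = of_int (n j)" by metis
    define a where "a = (\<lambda>j\<in>{..<l}. n j mod p)"
    have "p > 0" using p by (simp add: prime_gt_0_int)
    then have "a \<in> {..<l} \<rightarrow>\<^sub>E {0..<p}" by (auto simp: a_def)
    moreover have "x - (\<Sum>j<l. of_int (a j) * w j) \<in> pR p"
    proof -
      have "x - (\<Sum>j<l. of_int (a j) * w j) = (\<Sum>j<l. of_int (n j) * w j) - (\<Sum>j<l. of_int (a j) * w j)"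
        using dual_pair_expansion[OF dp R_mem_K[OF x]] n by simp
      also have "\<dots> = (\<Sum>j<l. of_int (n j - a j) * w j)"
        by (simp add: algebra_simps sum_subtractf)
      also have "\<dots> \<in> pR p"
      proof (rule pR_sum)
        fix j assume "j \<in> {..<l}"
        then have "p dvd n j - a j" "w j \<in> R" using w by (auto simp: a_def)
        then show "of_int (n j - a j) * w j \<in> pR p"
          using pR_of_int_iff[OF p_nonzero] by (blast intro: pR_mult_right)
      qed
      finally show ?thesis .
    qed
    ultimately show ?thesis unfolding X_def by blast
  qed
  ultimately show ?thesis by blast
qed

text \<open>By nilpotence, each element of \<open>P\<close> can be killed after multiplying
  \<open>b\<close> with the largest power of it that keeps \<open>b\<close> outside
  \<open>pR p\<close>; finitely many representatives suffice.\<close>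

lemma ex_socle_element: "\<exists>b\<in>R. b \<notin> pR p \<and> (\<forall>x\<in>P. b * x \<in> pR p)"
proof -
  have fin: "\<exists>b\<in>R. b \<notin> pR p \<and> (\<forall>y\<in>Y. b * y \<in> pR p)" if "finite Y" "Y \<subseteq> P" for Y
    using that
  proof (induction Y rule: finite_induct)
    case empty
    have "1 \<notin> pR p" using pR_subset_J J_proper by blast
    then show ?case using R_1 by blast
  next
    case (insert x Y)
    then obtain b where b: "b \<in> R" "b \<notin> pR p" "\<And>y. y \<in> Y \<Longrightarrow> b * y \<in> pR p" by auto
    have xR: "x \<in> R" using insert.prems P_R by auto
    have ex: "b * x ^ l \<in> pR p" using insert.prems b(1) by (auto intro: pR_mult P_power_pR)
    define k where "k = (LEAST k. b * x ^ k \<in> pR p)"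
    have k: "b * x ^ k \<in> pR p" unfolding k_def using ex by (rule LeastI)
    then have "k \<noteq> 0" using b(2) by (intro notI) simp
    then have least: "b * x ^ (k - 1) \<notin> pR p" using not_less_Least[of "k - 1" "\<lambda>k. b * x ^ k \<in> pR p"] by (simp flip: k_def)
    have "b * x ^ (k - 1) * x \<in> pR p" using k \<open>k \<noteq> 0\<close> by (simp add: power_eq_if mult.commute mult.left_commute)
    moreover have "b * x ^ (k - 1) * y \<in> pR p" if "y \<in> Y" for y
      using pR_mult[OF b(3)[OF that] R_power[OF xR, of "k - 1"]] by (simp add: ac_simps)
    moreover have "b * x ^ (k - 1) \<in> R" using b(1) xR by (intro R_mult R_power)
    ultimately show ?case using least by (intro bexI[of _ "b * x ^ (k - 1)"]) auto
  qed
  obtain X where X: "finite X" "\<forall>x\<in>R. \<exists>x0\<in>X. x - x0 \<in> pR p" using finite_representatives by blast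
  obtain b where b: "b \<in> R" "b \<notin> pR p" "\<forall>y\<in>X \<inter> P. b * y \<in> pR p" using fin[of "X \<inter> P"] X(1) by blast
  have "b * x \<in> pR p" if x: "x \<in> P" for x
  proof -
    obtain x0 where x0: "x0 \<in> X" "x - x0 \<in> pR p" using X(2) P_R[OF x] by blast
    have "x - (x - x0) \<in> P" using x pR_subset_P[OF x0(2)] by (rule P_diff)
    then have "b * x0 \<in> pR p" using b(3) x0(1) by simp
    moreover have "b * (x - x0) \<in> pR p" using pR_mult[OF x0(2) b(1)] .
    ultimately have "b * x0 + b * (x - x0) \<in> pR p" by (rule pR_add)
    then show ?thesis by (simp add: algebra_simps)
  qed
  then show ?thesis using b by blast
qed

text \<open>With \<open>b\<close> killing \<open>P\<close> modulo \<open>p\<close>, the quotient \<open>\<theta> = b / p\<close> is not integral, so \<open>\<theta> P\<close> is not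
  contained in \<open>P\<close>. Hence \<open>P\<close> is principal up to integers prime to \<open>p\<close>.\<close>

lemma ex_uniformizer:
  "\<exists>\<pi>\<in>P. \<exists>n::int. \<not> p dvd n \<and> (\<forall>x\<in>P. \<exists>y\<in>R. of_int n * x = \<pi> * y)"
proof -
  obtain b where b: "b \<in> R" "b \<notin> pR p" "\<And>x. x \<in> P \<Longrightarrow> b * x \<in> pR p" using ex_socle_element by blast
  define \<theta> where "\<theta> = b / of_int p"
  have \<theta>K: "\<theta> \<in> K" unfolding \<theta>_def using R_mem_K[OF b(1)] by (intro divide_mem) auto
  have "\<theta> \<notin> R"
  proof
    assume "\<theta> \<in> R"
    then have "b \<in> pR p" using p_nonzero by (intro pR_I[of \<theta>]) (simp_all add: \<theta>_def)
    then show False using b(2) by simp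
  qed
  have \<theta>P: "\<theta> * x \<in> R" if "x \<in> P" for x
  proof -
    obtain y where "y \<in> R" "b * x = of_int p * y" using b(3)[OF \<open>x \<in> P\<close>] by (rule pR_E)
    then show ?thesis using p_nonzero by (simp add: \<theta>_def)
  qed
  have "\<exists>x\<in>P. \<theta> * x \<notin> P"
  proof (rule ccontr)
    assume "\<not> ?thesis"
    then have stab: "\<theta> * x \<in> P" if "x \<in> P" for x using that by blast
    \<comment> \<open>Stability keeps all \<open>p * \<theta> ^ k\<close> in \<open>R\<close>. Two
      of them agree modulo \<open>p\<close>, so a difference of two powers of
      \<open>\<theta>\<close> is integral, and then so is \<open>\<theta>\<close>.\<close>
    have pw: "of_int p * \<theta> ^ k \<in> P" for k
    proof (induction k)
      case 0
      then show ?case using P_of_int_iff[of p] by simp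
    next
      case (Suc k)
      then show ?case using stab[OF Suc] by (simp add: ac_simps)
    qed
    obtain X where X: "finite X" "\<forall>x\<in>R. \<exists>x0\<in>X. x - x0 \<in> pR p" using finite_representatives by blast
    then have "\<forall>k. \<exists>x0\<in>X. of_int p * \<theta> ^ k - x0 \<in> pR p" using pw P_R by blast
    then obtain f where f: "\<And>k. f k \<in> X" "\<And>k. of_int p * \<theta> ^ k - f k \<in> pR p" by metis
    have "\<not> inj f"
    proof
      assume "inj f"
      then have "infinite (range f)" using finite_imageD by blast
      then show False using f(1) X(1) by (meson finite_subset image_subsetI)
    qed
    then obtain i j where "f i = f j" "i \<noteq> j" by (auto simp: inj_def)
    then obtain i j where ij: "f i = f j" "i < j" by (metis linorder_neqE_nat)
    have "(of_int p * \<theta> ^ j - f j) - (of_int p * \<theta> ^ i - f i) \<in> pR p" using f(2) f(2) by (rule pR_diff)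
    then obtain y where y: "y \<in> R" "(of_int p * \<theta> ^ j - f j) - (of_int p * \<theta> ^ i - f i) = of_int p * y"
      by (rule pR_E)
    then have "of_int p * (\<theta> ^ j - \<theta> ^ i) = of_int p * y" using ij(1) by (simp add: algebra_simps)
    then have "\<theta> ^ j - \<theta> ^ i = y" using p_nonzero by simp
    with R_algebraic_int[OF y(1)] have "algebraic_int (\<theta> ^ j - \<theta> ^ i)" by (simp only:)
    then have "\<theta> \<in> R" by (rule R_I[OF \<theta>K algebraic_int_of_power_diff[OF ij(2)]])
    then show False using \<open>\<theta> \<notin> R\<close> by contradiction
  qed
  \<comment> \<open>Since \<open>\<theta> * \<pi>\<close> lies in \<open>R\<close> but not in
    \<open>P\<close>, its norm \<open>n\<close> is prime to \<open>p\<close>; the cofactor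
    \<open>v\<close> inverts it up to \<open>n\<close>.\<close>
  then obtain \<pi> where \<pi>: "\<pi> \<in> P" "\<theta> * \<pi> \<notin> P" by blast
  obtain n where n: "nm (\<theta> * \<pi>) = of_int n" using ex_nm_int[OF \<theta>P[OF \<pi>(1)]] by blast
  have "\<not> p dvd n" using \<pi> \<theta>P nm_pR_iff[OF n] by (simp add: P_def)
  obtain v where v: "v \<in> R" "nm (\<theta> * \<pi>) = \<theta> * \<pi> * v" using nm_cofactor[OF \<theta>P[OF \<pi>(1)]] by blast
  have "\<exists>y\<in>R. of_int n * x = \<pi> * y" if x: "x \<in> P" for x
  proof
    show "v * (\<theta> * x) \<in> R" using v(1) \<theta>P[OF x] by (rule R_mult)
    show "of_int n * x = \<pi> * (v * (\<theta> * x))" using v(2) n by (simp add: ac_simps)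
  qed
  then show ?thesis using \<pi>(1) \<open>\<not> p dvd n\<close> by blast
qed

text \<open>Each division by \<open>\<pi>\<close> removes at least one factor \<open>p\<close> from
  the norm, because \<open>p\<close> divides \<open>nm \<pi>\<close> but not \<open>n\<close>; the
  induction runs over a bound for the exponent of \<open>p\<close> in the norm.\<close>

lemma uniformizer_factorization:
  assumes \<pi>: "\<pi> \<in> P" "\<not> p dvd n" "\<And>x. x \<in> P \<Longrightarrow> \<exists>y\<in>R. of_int n * x = \<pi> * y"
    and y: "y \<in> R" "y \<noteq> 0"
  shows "\<exists>k m z. \<not> p dvd m \<and> z \<in> R \<and> z \<notin> P \<and> of_int m * y = \<pi> ^ k * z"
proof -
  have *: "\<exists>k m z. \<not> p dvd m \<and> z \<in> R \<and> z \<notin> P \<and> of_int m * y = \<pi> ^ k * z"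
    if "y \<in> R" "y \<noteq> 0" "nm y = of_int c" "\<not> p ^ N dvd c" for y c N
    using that
  proof (induction N arbitrary: y c)
    case (Suc N)
    show ?case
    proof (cases "y \<in> P")
      case False
      then show ?thesis using Suc.prems(1) p
        by (intro exI[of _ 0] exI[of _ 1] exI[of _ y]) (auto simp: not_prime_unit)
    next
      case True
      then obtain y1 where y1: "y1 \<in> R" "of_int n * y = \<pi> * y1" using \<pi>(3) by blast
      have "n \<noteq> 0" using \<pi>(2) by auto
      then have "y1 \<noteq> 0" using y1(2) Suc.prems(2) by auto
      obtain c1 where c1: "nm y1 = of_int c1" using ex_nm_int[OF y1(1)] by blast
      obtain d where d: "nm \<pi> = of_int d" using ex_nm_int[OF P_R[OF \<pi>(1)]] by blast
      have "p dvd d" using \<pi>(1) nm_pR_iff[OF d] by (simp add: P_def)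
      have "nm (of_int n * y) = nm (\<pi> * y1)" using y1(2) by simp
      then have "of_int (n ^ l * c) = (of_int (d * c1) :: complex)"
        using Suc.prems y1(1) c1 d P_R[OF \<pi>(1)] by (simp add: nm_mult nm_of_int R_mem_K)
      then have eq: "n ^ l * c = d * c1" using of_int_eq_iff by blast
      have "\<not> p ^ N dvd c1"
      proof
        assume "p ^ N dvd c1"
        then have "p ^ Suc N dvd n ^ l * c" unfolding eq using \<open>p dvd d\<close> by (simp add: mult_dvd_mono)
        moreover have "coprime (p ^ Suc N) (n ^ l)"
          using prime_imp_coprime[OF p \<pi>(2)] by simp
        ultimately show False using Suc.prems(4) coprime_dvd_mult_right_iff by blast
      qed
      then obtain k m z where kmz: "\<not> p dvd m" "z \<in> R" "z \<notin> P" "of_int m * y1 = \<pi> ^ k * z"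
        using Suc.IH[OF y1(1) \<open>y1 \<noteq> 0\<close> c1] by blast
      have "of_int (m * n) * y = \<pi> * (of_int m * y1)" using y1(2) by (simp add: ac_simps)
      then have "of_int (m * n) * y = \<pi> ^ Suc k * z" unfolding kmz(4) by simp
      moreover have "\<not> p dvd m * n" using p kmz(1) \<pi>(2) by (simp add: prime_dvd_mult_iff)
      ultimately show ?thesis using kmz(2,3) by blast
    qed
  qed simp
  obtain c where c: "nm y = of_int c" using ex_nm_int[OF y(1)] by blast
  have "c \<noteq> 0" using c nm_eq_0_iff[OF R_mem_K[OF y(1)]] y(2) by auto
  have "\<not> p ^ Suc (multiplicity p c) dvd c"
    using \<open>c \<noteq> 0\<close> p not_prime_unit[of p] power_dvd_iff_le_multiplicity[of c p "Suc (multiplicity p c)"] by auto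
  then show ?thesis using *[OF y c] by blast
qed

text \<open>The wild case \<open>p = l\<close> costs at most one extra factor \<open>l\<close>: if \<open>y \<notin> p R\<close> then \<open>y R\<close> contains
  \<open>p M\<close> for some integer \<open>M\<close> prime to \<open>p\<close>, and this has trace \<open>l p M\<close>.\<close>

lemma trace_divisibility:
  assumes y: "y \<in> R" "y \<notin> pR p" "\<And>z. z \<in> R \<Longrightarrow> tr (y * z) \<in> pR (p ^ s)"
  shows "p ^ s dvd p * int l"
proof -
  obtain \<pi> n where \<pi>: "\<pi> \<in> P" "\<not> p dvd n" "\<And>x. x \<in> P \<Longrightarrow> \<exists>y\<in>R. of_int n * x = \<pi> * y"
    using ex_uniformizer by blast
  note \<pi>R = P_R[OF \<pi>(1)]
  have "y \<noteq> 0" using y(2) pR_0 by auto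
  then obtain k m z where y': "\<not> p dvd m" "z \<in> R" "z \<notin> P" "of_int m * y = \<pi> ^ k * z"
    using uniformizer_factorization[OF \<pi> y(1)] by blast
  have "of_int p \<noteq> (0 :: complex)" using p_nonzero by simp
  then obtain e m0 z0 where p': "\<not> p dvd m0" "z0 \<in> R" "z0 \<notin> P" "of_int m0 * of_int p = \<pi> ^ e * z0"
    using uniformizer_factorization[OF \<pi> R_of_int] by blast
  obtain c where c: "nm z = of_int c" using ex_nm_int[OF y'(2)] by blast
  have cp: "\<not> p dvd c" using y'(2,3) nm_pR_iff[OF c] by (simp add: P_def)
  obtain v where v: "v \<in> R" "nm z = z * v" using nm_cofactor[OF y'(2)] by blast
  obtain c0 where c0: "nm z0 = of_int c0" using ex_nm_int[OF p'(2)] by blast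
  have c0p: "\<not> p dvd c0" using p'(2,3) nm_pR_iff[OF c0] by (simp add: P_def)
  obtain v0 where v0: "v0 \<in> R" "nm z0 = z0 * v0" using nm_cofactor[OF p'(2)] by blast
  \<comment> \<open>Otherwise \<open>\<pi> ^ k\<close> would contain \<open>\<pi> ^ e\<close>, hence
    \<open>p\<close> up to factors prime to \<open>p\<close>, and \<open>y\<close> would be in
    \<open>pR p\<close>.\<close>
  have "k < e"
  proof (rule ccontr)
    assume "\<not> k < e"
    then have "\<pi> ^ k = \<pi> ^ (k - e) * \<pi> ^ e" by (simp flip: power_add)
    then have "of_int (m * c0) * y = \<pi> ^ (k - e) * z * v0 * (\<pi> ^ e * z0)"
      using y'(4) v0(2) c0 by (simp add: ac_simps)
    also have "\<dots> = of_int p * (\<pi> ^ (k - e) * z * v0 * of_int m0)"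
      unfolding p'(4)[symmetric] by (simp add: ac_simps)
    also have "\<dots> \<in> pR p"
      using \<pi>R y'(2) v0(1) by (intro pR_I[OF _ refl] R_mult R_power R_of_int)
    finally have mem: "of_int (m * c0) * y \<in> pR p" .
    have "\<not> p dvd m * c0" using p y'(1) c0p by (simp add: prime_dvd_mult_iff)
    then have "coprime p (m * c0)" by (rule prime_imp_coprime[OF p])
    then obtain a b where ab: "a * p + b * (m * c0) = 1"
      using bezout_int[of p "m * c0"] by (auto simp: coprime_iff_gcd_eq_1)
    have "of_int a * y * of_int p + of_int b * (of_int (m * c0) * y) \<in> pR p"
      using y(1) by (intro pR_add pR_mult[OF pR_self] pR_mult[OF mem] R_mult R_of_int)
    also have "of_int a * y * of_int p + of_int b * (of_int (m * c0) * y) = of_int (a * p + b * (m * c0)) * y"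
      by (simp add: algebra_simps)
    finally show False using y(2) unfolding ab by simp
  qed
  define M where "M = m0 * c"
  have Mp: "\<not> p dvd M" using p p'(1) cp by (simp add: M_def prime_dvd_mult_iff)
  \<comment> \<open>Chosen so that \<open>y * x = M * p\<close>: the power of \<open>\<pi>\<close>
    is raised from \<open>k\<close> to \<open>e\<close>, \<open>v\<close> turns \<open>z\<close>
    into its norm \<open>c\<close>, and \<open>z0\<close> completes \<open>\<pi> ^ e\<close> to
    \<open>m0 * p\<close>.\<close>
  define x where "x = of_int m * \<pi> ^ (e - k) * v * z0"
  have xR: "x \<in> R" unfolding x_def using \<pi>R v(1) p'(2) by (intro R_mult R_power R_of_int)
  have "y * x = (of_int m * y) * (\<pi> ^ (e - k) * v * z0)" by (simp add: x_def ac_simps)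
  also have "\<dots> = (\<pi> ^ k * \<pi> ^ (e - k) * z0) * (z * v)" unfolding y'(4) by (simp add: ac_simps)
  also have "\<pi> ^ k * \<pi> ^ (e - k) = \<pi> ^ e" using \<open>k < e\<close> by (simp flip: power_add)
  also have "\<pi> ^ e * z0 * (z * v) = of_int (M * p)"
    unfolding p'(4)[symmetric] v(2)[symmetric] c by (simp add: M_def)
  finally have "tr (y * x) = of_int (int l * M * p)" by (simp add: tr_of_Rats)
  then have "of_int (int l * M * p) \<in> pR (p ^ s)" using y(3)[OF xR] by simp
  then have "p ^ s dvd int l * M * p" using pR_of_int_iff[OF power_not_zero[OF p_nonzero]] by blast
  then have "p ^ s dvd M * (p * int l)" by (simp add: ac_simps)
  moreover have "coprime (p ^ s) M" using prime_imp_coprime[OF p Mp] by simp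
  ultimately show ?thesis using coprime_dvd_mult_right_iff by blast
qed

end

end

section \<open>Exceptional units\<close>

text \<open>Besides scaling the rows, this links the real determinant required by
  \<open>small_integer_vector\<close> to the complex one in \<open>D\<close>.\<close>

lemma det_scale_rows_of_real:
  fixes a :: "nat \<Rightarrow> real" and f :: "nat \<Rightarrow> nat \<Rightarrow> real"
  shows "complex_of_real (det (mat n n (\<lambda>(i,j). a i * f i j)))
    = of_real (\<Prod>i<n. a i) * det (mat n n (\<lambda>(i,j). complex_of_real (f i j)))"
proof -
  have eq: "of_real (signof p * (\<Prod>i = 0..<n. mat n n (\<lambda>(i,j). a i * f i j) $$ (i, p i)))
    = complex_of_real (\<Prod>i<n. a i) * (signof p * (\<Prod>i = 0..<n. mat n n (\<lambda>(i,j). complex_of_real (f i j)) $$ (i, p i)))"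
    if "p permutes {0..<n}" for p
  proof -
    have "p i < n" if "i < n" for i using permutes_in_image[OF \<open>p permutes {0..<n}\<close>, of i] that by simp
    then have "(\<Prod>i = 0..<n. mat n n (\<lambda>(i,j). a i * f i j) $$ (i, p i)) = (\<Prod>i<n. a i) * (\<Prod>i = 0..<n. f i (p i))"
      "(\<Prod>i = 0..<n. mat n n (\<lambda>(i,j). complex_of_real (f i j)) $$ (i, p i)) = of_real (\<Prod>i = 0..<n. f i (p i))"
      unfolding of_real_prod by (simp_all add: prod.distrib atLeast0LessThan)
    then show ?thesis by (simp add: sign_def)
  qed
  show ?thesis
    unfolding det_def'[OF mat_carrier] sum_distrib_left of_real_sum
    by (rule sum.cong[OF refl]) (simp only: mem_Collect_eq eq)
qed

lemma finite_int_polys_bounded: "finite {p :: int poly. degree p \<le> n \<and> (\<forall>k. \<bar>coeff p k\<bar> \<le> N)}"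
proof -
  let ?S = "{p :: int poly. degree p \<le> n \<and> (\<forall>k. \<bar>coeff p k\<bar> \<le> N)}"
  let ?h = "\<lambda>p :: int poly. \<lambda>k\<in>{..n}. coeff p k"
  have "inj_on ?h ?S"
  proof (rule inj_onI)
    fix p q assume pq: "p \<in> ?S" "q \<in> ?S" and eq: "?h p = ?h q"
    show "p = q"
    proof (rule poly_eqI)
      fix k
      show "coeff p k = coeff q k"
      proof (cases "k \<le> n")
        case True
        then show ?thesis using fun_cong[OF eq, of k] by simp
      next
        case False
        then show ?thesis using pq by (simp add: coeff_eq_0)
      qed
    qed
  qed
  moreover have "?h ` ?S \<subseteq> {..n} \<rightarrow>\<^sub>E {-N..N}"
    by (intro image_subsetI) (auto simp: restrict_PiE_iff abs_le_iff minus_le_iff)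
  then have "finite (?h ` ?S)" by (rule finite_subset) (intro finite_PiE, auto)
  ultimately show ?thesis by (rule finite_imageD[rotated])
qed

lemma finite_roots_bounded:
  "finite {y :: complex. \<exists>p :: int poly. p \<noteq> 0 \<and> degree p \<le> n \<and> (\<forall>k. \<bar>coeff p k\<bar> \<le> N) \<and> poly (of_int_poly p) y = 0}"
proof -
  let ?S = "{p :: int poly. degree p \<le> n \<and> (\<forall>k. \<bar>coeff p k\<bar> \<le> N)} - {0}"
  have "finite (\<Union>p\<in>?S. {y :: complex. poly (of_int_poly p) y = 0})"
    using finite_int_polys_bounded[of n N] by (intro finite_UN_I poly_roots_finite) auto
  then show ?thesis by (rule rev_finite_subset) auto
qed

text \<open>The rings of integers of the fields in question can only be ramified at primes dividing this
  integer.\<close>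

lemma ex_ramification_bound:
  fixes l :: nat
  assumes l: "prime l" "l \<noteq> 3"
  shows "\<exists>r::int. r > 0 \<and> (\<forall>e\<in>{1,-1}. \<forall>d\<in>{1,-1}. \<exists>A B :: int poly. \<forall>x :: complex. of_int r =
    poly (of_int_poly A) x * (x ^ l - of_int e) + poly (of_int_poly B) x * ((1 - x) ^ l - of_int d))"
proof -
  define good where "good r e d \<longleftrightarrow> (\<exists>A B :: int poly. \<forall>x :: complex. of_int r =
    poly (of_int_poly A) x * (x ^ l - of_int e) + poly (of_int_poly B) x * ((1 - x) ^ l - of_int d))" for r e d
  have l3: "\<not> 3 dvd l" "l > 0" using l primes_dvd_imp_eq[of 3 l] by (auto simp: prime_gt_0_nat)
  have ex: "\<exists>r. r \<noteq> 0 \<and> good r e d" if "e \<in> {1,-1}" "d \<in> {1,-1}" for e d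
    using unit_equation_resultant[OF l3 that] unfolding good_def .
  have good_mult: "good (c * r) e d" if r: "good r e d" for c r e d
  proof -
    obtain A B where AB: "\<And>x :: complex. of_int r =
      poly (of_int_poly A) x * (x ^ l - of_int e) + poly (of_int_poly B) x * ((1 - x) ^ l - of_int d)"
      using r unfolding good_def by blast
    have "of_int (c * r) = poly (of_int_poly ([:c:] * A)) x * (x ^ l - of_int e)
      + poly (of_int_poly ([:c:] * B)) x * ((1 - x) ^ l - of_int d)" for x :: complex
      unfolding of_int_mult AB[of x] by (simp add: of_int_hom.map_poly_hom_smult algebra_simps)
    then show ?thesis unfolding good_def by blast
  qed
  obtain r1 r2 r3 r4 where r: "r1 \<noteq> 0" "good r1 1 1" "r2 \<noteq> 0" "good r2 1 (-1)"
    "r3 \<noteq> 0" "good r3 (-1) 1" "r4 \<noteq> 0" "good r4 (-1) (-1)"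
    using ex[of 1 1] ex[of 1 "-1"] ex[of "-1" 1] ex[of "-1" "-1"] by blast
  \<comment> \<open>One integer has to serve all four choices of signs. As \<open>good\<close> is
    stable under multiples, the product does, and \<open>s\<close> makes it positive.\<close>
  define s where "s = sgn (r1 * r2 * r3 * r4)"
  define r' where "r' = s * (r1 * r2 * r3 * r4)"
  have "good r' 1 1" using good_mult[OF r(2), of "s * r2 * r3 * r4"] by (simp add: r'_def ac_simps)
  moreover have "good r' 1 (-1)" using good_mult[OF r(4), of "s * r1 * r3 * r4"] by (simp add: r'_def ac_simps)
  moreover have "good r' (-1) 1" using good_mult[OF r(6), of "s * r1 * r2 * r4"] by (simp add: r'_def ac_simps)
  moreover have "good r' (-1) (-1)" using good_mult[OF r(8), of "s * r1 * r2 * r3"] by (simp add: r'_def ac_simps)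
  moreover have "r' > 0" using r unfolding r'_def s_def by (simp add: sgn_mult_self_eq flip: abs_sgn mult.commute)
  ultimately have "r' > 0 \<and> (\<forall>e\<in>{1,-1}. \<forall>d\<in>{1,-1}. good r' e d)" by auto
  then show ?thesis unfolding good_def by blast
qed

context cyclic_ext
begin

lemma nm_unit: assumes "x \<in> unit_group K" shows "\<exists>e\<in>{1,-1}. nm x = of_int e"
proof -
  obtain y where y: "x \<in> R" "y \<in> R" "x * y = 1" using assms unfolding unit_group_def by auto
  obtain a where a: "nm x = of_int a" using nm_Ints[OF y(1)] by (auto elim: Ints_cases)
  obtain b where b: "nm y = of_int b" using nm_Ints[OF y(2)] by (auto elim: Ints_cases)
  have "nm x * nm y = 1" using y by (simp flip: nm_mult add: R_mem_K)
  then have "(of_int (a * b) :: complex) = of_int 1" using a b by simp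
  then have "a * b = 1" using of_int_eq_iff by blast
  then have "a = 1 \<or> a = -1" by (auto simp: zmult_eq_1_iff)
  then show ?thesis using a by auto
qed

lemma R_poly_int: "x \<in> R \<Longrightarrow> poly (of_int_poly A) x \<in> R"
  unfolding poly_altdef by (auto intro!: R_sum R_mult R_power simp: R_of_int)

lemma inertial_exceptional_unit:
  assumes p: "prime p" and J: "inertial p J" and u: "exceptional_unit K u"
    and r: "\<forall>e\<in>{1,-1}. \<forall>d\<in>{1,-1}. \<exists>A B :: int poly. \<forall>x :: complex. of_int r =
      poly (of_int_poly A) x * (x ^ l - of_int e) + poly (of_int_poly B) x * ((1 - x) ^ l - of_int d)"
  shows "p dvd r"
proof -
  have uR: "u \<in> R" "1 - u \<in> R" using u unfolding exceptional_unit_def unit_group_def by auto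
  obtain e where e: "e \<in> {1,-1}" "nm u = of_int e" using nm_unit u unfolding exceptional_unit_def by blast
  obtain d where d: "d \<in> {1,-1}" "nm (1 - u) = of_int d" using nm_unit u unfolding exceptional_unit_def by blast
  obtain A B where AB: "of_int r = poly (of_int_poly A) u * (u ^ l - of_int e)
      + poly (of_int_poly B) u * ((1 - u) ^ l - of_int d)"
    using r e(1) d(1) by blast
  have "- (nm u - u ^ l) \<in> J" "- (nm (1 - u) - (1 - u) ^ l) \<in> J"
    using J_minus[OF p J J_nm[OF p J]] uR by blast+
  then have "u ^ l - of_int e \<in> J" "(1 - u) ^ l - of_int d \<in> J" using e(2) d(2) by simp_all
  then have "of_int r \<in> J" unfolding AB using uR
    by (intro J_add[OF p J] J_mult[OF p J] R_poly_int)
  then show ?thesis by (rule J_of_int[OF p J])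
qed

text \<open>The least denominator \<open>g\<close> is compared with \<open>l * r\<close> one prime
  at a time: \<open>p ^ s dvd p * l\<close> from \<open>trace_divisibility\<close> and
  \<open>p dvd r\<close> from inertia give \<open>p ^ s dvd l * r\<close>.\<close>

lemma codifferent_bound:
  assumes r: "r > 0" "\<And>p J. prime p \<Longrightarrow> inertial p J \<Longrightarrow> p dvd r"
    and x: "x \<in> K" "\<And>z. z \<in> R \<Longrightarrow> tr (x * z) \<in> \<int>"
  shows "of_int (int l * r) * x \<in> R"
proof -
  define Q where "Q n \<longleftrightarrow> n > 0 \<and> of_nat n * x \<in> R" for n :: nat
  obtain d :: int where "d > 0" "of_int d * x \<in> R" using ex_integral_multiple[OF x(1)] by blast
  then have "Q (nat d)" by (simp add: Q_def)
  define g where "g = (LEAST n. Q n)"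
  have g: "Q g" unfolding g_def using \<open>Q (nat d)\<close> by (rule LeastI)
  have least: "\<not> Q n" if "n < g" for n using that not_less_Least unfolding g_def by blast
  have "int g dvd int l * r"
  proof (rule multiplicity_le_imp_dvd)
    show "int g \<noteq> 0" using g by (simp add: Q_def)
    fix p :: int assume p: "prime p"
    define s where "s = multiplicity p (int g)"
    have sg: "p ^ s dvd int g" unfolding s_def by (rule multiplicity_dvd)
    have C0: "int l * r \<noteq> 0" using l_pos r(1) by simp
    show "multiplicity p (int g) \<le> multiplicity p (int l * r)"
    proof (cases "s = 0")
      case True
      then show ?thesis by (simp add: s_def)
    next
      case False
      have "p > 0" using p by (simp add: prime_gt_0_int)
      have pg: "p dvd int g" using sg False dvd_trans[OF dvd_power] by blast
      define y where "y = of_nat g * x"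
      have yR: "y \<in> R" using g by (simp add: Q_def y_def)
      \<comment> \<open>Otherwise \<open>g\<close> divided by \<open>p\<close> would be a smaller
        denominator of \<open>x\<close>.\<close>
      have "y \<notin> pR p"
      proof
        assume "y \<in> pR p"
        then obtain y' where y': "y' \<in> R" "y = of_int p * y'" by (rule pR_E)
        obtain h where h: "int g = p * h" using pg by blast
        have "h > 0" using h g \<open>p > 0\<close> by (simp add: Q_def) (metis of_nat_0_less_iff zero_less_mult_pos)
        have "of_int p * (of_int h * x) = of_int p * y'"
          using y'(2) h unfolding y_def by (metis mult.assoc of_int_mult of_int_of_nat_eq)
        then have "of_int h * x = y'" using \<open>p > 0\<close> by simp
        then have "Q (nat h)" using y'(1) \<open>h > 0\<close> by (simp add: Q_def)
        moreover have "nat h < g"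
        proof -
          have "1 * h < p * h" using p \<open>h > 0\<close> by (intro mult_strict_right_mono) (simp_all add: prime_gt_1_int)
          then show ?thesis using h \<open>h > 0\<close> by linarith
        qed
        ultimately show False using least by blast
      qed
      have trs: "tr (y * z) \<in> pR (p ^ k)" if z: "z \<in> R" and k: "p ^ k dvd int g" for z k
      proof -
        have "tr (y * z) = of_nat g * tr (x * z)"
          using z x(1) by (simp add: y_def mult.assoc tr_Rats_mult R_mem_K mult_mem)
        moreover obtain t where "tr (x * z) = of_int t" using x(2)[OF z] by (auto elim: Ints_cases)
        ultimately have "tr (y * z) = of_int (int g * t)" by simp
        moreover have "of_int (int g * t) \<in> pR (p ^ k)"
          using pR_of_int_iff[of "p ^ k"] \<open>p > 0\<close> k by (metis dvd_mult2 less_irrefl power_not_zero)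
        ultimately show ?thesis by simp
      qed
      have "tr (y * z) \<in> pR p" if "z \<in> R" for z using trs[OF that, of 1] pg by simp
      then obtain J where J: "inertial p J" using ex_inertial[OF p yR \<open>y \<notin> pR p\<close>] by blast
      have "p ^ s dvd p * int l" by (rule trace_divisibility[OF p J yR \<open>y \<notin> pR p\<close> trs[OF _ sg]])
      also have "p * int l dvd int l * r" using r(2)[OF p J] by (simp add: mult.commute mult_dvd_mono)
      finally have "p ^ s dvd int l * r" .
      then show ?thesis unfolding s_def[symmetric]
        using C0 p not_prime_unit[of p] by (intro multiplicity_geI) auto
    qed
  qed
  then obtain t where "int l * r = int g * t" by blast
  then have "of_int (int l * r) * x = of_int t * (of_nat g * x)" by (metis mult.assoc mult.commute of_int_mult of_int_of_nat_eq)
  also have "\<dots> \<in> R" using g by (intro R_mult[OF R_of_int]) (simp add: Q_def)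
  finally show ?thesis .
qed

section \<open>Generators with bounded conjugates\<close>

lemma ex_power_expansion:
  assumes y: "y \<in> K" "y \<notin> \<rat>" and x: "x \<in> K"
  shows "\<exists>q. x = (\<Sum>j<l. of_rat (q j) * y ^ j)"
proof -
  obtain u where dp: "dual_pair (\<lambda>j. y ^ j) u"
    using ex_dual[of "\<lambda>j. y ^ j"] D_powers_nonzero[OF y] y by auto
  have "\<forall>j<l. \<exists>q. tr (x * u j) = of_rat q"
  proof (intro allI impI)
    fix j assume "j < l"
    then have "tr (x * u j) \<in> \<rat>" using dp x by (intro tr_Rats) (auto simp: dual_pair_def)
    then show "\<exists>q. tr (x * u j) = of_rat q" by (auto elim: Rats_cases)
  qed
  then obtain q where "\<And>j. j < l \<Longrightarrow> tr (x * u j) = of_rat (q j)" by metis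
  then have "x = (\<Sum>j<l. of_rat (q j) * y ^ j)" using dual_pair_expansion[OF dp x] by simp
  then show ?thesis by blast
qed

text \<open>In prime degree the powers of any nonrational element below the \<open>l\<close>-th form
  a basis. So \<open>y\<close> alone determines \<open>K\<close> as a set.\<close>

lemma generated_by_nonrational:
  assumes y: "y \<in> K" "y \<notin> \<rat>"
  shows "K = {\<Sum>j<l. of_rat (q j) * y ^ j | q. True}"
proof (intro subset_antisym subsetI)
  fix x assume "x \<in> K"
  then obtain q where "x = (\<Sum>j<l. of_rat (q j) * y ^ j)" using ex_power_expansion[OF y] by blast
  then show "x \<in> {\<Sum>j<l. of_rat (q j) * y ^ j | q. True}" by blast
next
  fix x assume "x \<in> {\<Sum>j<l. of_rat (q j) * y ^ j | q. True}"
  then obtain q where x: "x = (\<Sum>j<l. of_rat (q j) * y ^ j)" by blast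
  show "x \<in> K" unfolding x by (intro sum_mem mult_mem power_mem of_rat_mem y(1))
qed

text \<open>Complex conjugation permutes the conjugates of a generator, hence acts on
  \<open>K\<close> as some \<open>gal i\<close>. It is an involution, and a cyclic group of odd
  order has no element of order 2.\<close>

lemma totally_real:
  assumes odd: "odd l" and x: "x \<in> K"
  shows "cnj x = x"
proof -
  obtain y where y: "y \<in> K" "y \<notin> \<rat>" using ex_nonrational by blast
  have rat: "cnj (of_rat q) = of_rat q" for q by (simp flip: of_real_of_rat)
  have "poly (chi y) (cnj y) = cnj (poly (chi y) y)"
  proof -
    have "cnj (coeff (chi y) k) = coeff (chi y) k" for k
      using coeff_chi_Rats[OF y(1), of k] rat by (auto elim!: Rats_cases)
    then show ?thesis by (simp add: poly_altdef)
  qed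
  then have "poly (chi y) (cnj y) = 0" by (simp add: poly_chi_self)
  then obtain i where i: "i < l" "cnj y = gal i y"
    using poly_linear_factors_eq_0[of "{..<l}" "\<lambda>i. gal i y"] unfolding chi_def by auto
  have cnj: "cnj z = gal i z" if z: "z \<in> K" for z
  proof -
    obtain q where q: "z = (\<Sum>j<l. of_rat (q j) * y ^ j)" using ex_power_expansion[OF y z] by blast
    have "cnj z = (\<Sum>j<l. of_rat (q j) * cnj y ^ j)" unfolding q by (simp add: rat)
    also have "\<dots> = gal i z" unfolding q i(2) using y(1)
      by (subst gal_sum) (simp_all add: gal_mult gal_power mult_mem power_mem)
    finally show ?thesis .
  qed
  have "y = gal i (gal i y)" using cnj[of "gal i y"] i(2) y(1) by (metis complex_cnj_cnj gal_closed)
  then have fixed: "gal (2 * i) y = y" by (simp add: gal_gal mult_2)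
  have "i = 0"
  proof (rule ccontr)
    assume "i \<noteq> 0"
    show False
    proof (cases "2 * i < l")
      case True
      then show False using gal_nontrivial[OF y, of "2 * i"] fixed \<open>i \<noteq> 0\<close> by simp
    next
      case False
      have "2 * i \<noteq> l" using odd by auto
      then have k: "0 < 2 * i - l" "2 * i - l < l" using False i by auto
      have "gal (2 * i - l) y = y" using gal_add_l[OF y(1), of "2 * i - l"] fixed False by simp
      then show False using gal_nontrivial[OF y k] by simp
    qed
  qed
  then show ?thesis using cnj[OF x] by simp
qed

text \<open>Minkowski's theorem for the dual lattice of the ring of integers, whose covolume is at most
  one whatever the discriminant is. All conjugates but one are made so small that the element found
  cannot be rational.\<close>

lemma ex_small_dual_element:
  assumes odd: "odd l"
  shows "\<exists>x\<in>K. x \<notin> \<rat> \<and> (\<forall>z\<in>R. tr (x * z) \<in> \<int>) \<and>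
    (\<forall>i<l. norm (gal i x) \<le> real l * (2 * (2 * (real l)\<^sup>2) ^ (l - 1)))"
proof -
  obtain w u where dp: "dual_pair w u" and w: "\<And>j. j < l \<Longrightarrow> w j \<in> R"
    and int: "\<And>z j. z \<in> R \<Longrightarrow> j < l \<Longrightarrow> tr (z * u j) \<in> \<int>" using ex_integral_basis by blast
  have uK: "u j \<in> K" if "j < l" for j using dp that by (auto simp: dual_pair_def)
  have Du: "norm (D u) \<le> 1" "D u \<noteq> 0"
  proof -
    have one: "D u * D w = 1" by (rule dual_pair_D[OF dp])
    then show "D u \<noteq> 0" by auto
    obtain k where k: "D w * D w = of_int k" using D_sq_Ints[of w] w by (auto elim: Ints_cases)
    have "D w \<noteq> 0" using one by auto
    then have "k \<noteq> 0" using k by auto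
    then have "1 \<le> \<bar>k\<bar>" by simp
    then have "1 \<le> norm (D w * D w)" unfolding k by simp
    then have "1 \<le> norm (D w)" by (metis abs_norm_cancel abs_square_less_1 norm_mult not_le power2_eq_square)
    moreover have "norm (D u) * norm (D w) = 1" using one by (metis norm_mult norm_one)
    ultimately show "norm (D u) \<le> 1" by (metis mult_left_mono mult.right_neutral norm_ge_zero)
  qed
  \<comment> \<open>With this \<open>t\<close>, a rational \<open>x\<close> would satisfy
    \<open>l * norm x \<le> l * (t * l) = 1 / 2\<close>, although its trace \<open>l * x\<close> is
    an integer.\<close>
  define t where "t = 1 / (2 * (real l)\<^sup>2)"
  have t: "t > 0" using l_pos by (simp add: t_def)
  \<comment> \<open>Compensates the \<open>l - 1\<close> small weights: all weights together have
    product 2, so the scaled determinant is at most 1/2 and thus strictly below 1.\<close>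
  define S where "S = 2 * (2 * (real l)\<^sup>2) ^ (l - 1)"
  have St: "S * t ^ (l - 1) = 2" using l_pos by (simp add: S_def t_def power_one_over)
  have "1 \<le> (2 * (real l)\<^sup>2) ^ (l - 1)" using l_pos by (intro one_le_power) (simp add: power2_eq_square Suc_leI mult_ge1_I)
  then have S: "S \<ge> 1" by (simp add: S_def)
  define s where "s i = (if i = 0 then S else t)" for i :: nat
  have s: "s i > 0" for i using S t by (simp add: s_def)
  have sS: "s i \<le> S" for i
  proof -
    have "t \<le> 1" using l_pos unfolding t_def by (simp add: power2_eq_square Suc_leI mult_ge1_I)
    then show ?thesis using S by (simp add: s_def)
  qed
  have prod_s: "(\<Prod>i<l. s i) = 2"
  proof -
    have "(\<Prod>i<l. s i) = (\<Prod>i<Suc (l - 1). s i)" using l_pos by simp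
    also have "\<dots> = S * t ^ (l - 1)" unfolding prod.lessThan_Suc_shift by (simp add: s_def)
    finally show ?thesis using St by simp
  qed
  have real: "gal i (u j) = of_real (Re (gal i (u j)))" if "j < l" for i j
    using totally_real[OF odd gal_closed[OF uK[OF that], of i]] by (metis Reals_cnj_iff of_real_Re)
  define A where "A i j = 1 / s i * Re (gal i (u j))" for i j
  have "complex_of_real (det (mat l l (\<lambda>(i,j). A i j)))
    = of_real (\<Prod>i<l. 1 / s i) * det (mat l l (\<lambda>(i,j). complex_of_real (Re (gal i (u j)))))"
    unfolding A_def by (rule det_scale_rows_of_real)
  also have "mat l l (\<lambda>(i,j). complex_of_real (Re (gal i (u j)))) = gal_mat u"
    unfolding gal_mat_def by (rule eq_matI) (use real in auto)
  also have "(\<Prod>i<l. 1 / s i) = 1 / 2" using prod_s by (simp add: prod_dividef)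
  finally have detA: "complex_of_real (det (mat l l (\<lambda>(i,j). A i j))) = of_real (1 / 2) * D u"
    by (simp add: D_def)
  have nz: "det (mat l l (\<lambda>(i,j). A i j)) \<noteq> 0" using detA Du(2) by auto
  have "\<bar>det (mat l l (\<lambda>(i,j). A i j))\<bar> = norm (complex_of_real (det (mat l l (\<lambda>(i,j). A i j))))" by simp
  also have "\<dots> = 1 / 2 * norm (D u)" unfolding detA norm_mult by simp
  finally have lt: "\<bar>det (mat l l (\<lambda>(i,j). A i j))\<bar> < 1" using Du(1) by simp
  from small_integer_vector[OF nz lt] obtain z :: "nat \<Rightarrow> int" where z: "\<exists>j<l. z j \<noteq> 0"
    "\<And>i. i < l \<Longrightarrow> \<bar>\<Sum>j<l. A i j * z j\<bar> \<le> l" by blast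
  define x where "x = (\<Sum>j<l. of_int (z j) * u j)"
  have xK: "x \<in> K" unfolding x_def using uK by (intro sum_mem mult_mem) auto
  have bound: "norm (gal i x) \<le> s i * l" if i: "i < l" for i
  proof -
    have "gal i x = (\<Sum>j<l. of_int (z j) * gal i (u j))"
      unfolding x_def using uK by (subst gal_sum) (auto simp: gal_mult intro!: mult_mem)
    also have "\<dots> = (\<Sum>j<l. of_real (s i * (A i j * z j)))"
      using real s[of i] by (intro sum.cong) (auto simp: A_def)
    also have "\<dots> = of_real (s i * (\<Sum>j<l. A i j * z j))" by (simp add: sum_distrib_left)
    finally have "norm (gal i x) = s i * \<bar>\<Sum>j<l. A i j * z j\<bar>"
      using s[of i] by (simp only: norm_of_real abs_mult abs_of_pos)
    also have "\<dots> \<le> s i * l" using z(2)[OF i] s[of i] by (intro mult_left_mono) auto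
    finally show ?thesis .
  qed
  have tr_int: "tr (x * v) \<in> \<int>" if v: "v \<in> R" for v
  proof -
    have "tr (x * v) = tr (\<Sum>j<l. of_int (z j) * (v * u j))"
      unfolding x_def by (simp add: sum_distrib_left mult_ac)
    also have "\<dots> = (\<Sum>j<l. tr (of_int (z j) * (v * u j)))"
      using uK v by (intro tr_sum mult_mem) (auto intro: R_mem_K)
    also have "\<dots> = (\<Sum>j<l. of_int (z j) * tr (v * u j))"
      using uK v by (intro sum.cong tr_Rats_mult mult_mem) (auto intro: R_mem_K)
    also have "\<dots> \<in> \<int>" using int[OF v] by (intro Ints_sum Ints_mult) auto
    finally show ?thesis .
  qed
  have "x \<noteq> 0"
  proof
    assume x0: "x = 0"
    obtain j where j: "j < l" "z j \<noteq> 0" using z(1) by blast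
    have "tr (x * w j) = tr (\<Sum>k<l. of_int (z k) * (u k * w j))"
      unfolding x_def by (simp add: sum_distrib_right mult.assoc)
    also have "\<dots> = (\<Sum>k<l. tr (of_int (z k) * (u k * w j)))"
      using uK w j by (intro tr_sum mult_mem) (auto intro: R_mem_K)
    also have "\<dots> = (\<Sum>k<l. of_int (z k) * tr (u k * w j))"
      using uK w j by (intro sum.cong tr_Rats_mult mult_mem) (auto intro: R_mem_K)
    also have "\<dots> = (\<Sum>k<l. if k = j then of_int (z j) else 0)"
      using dp j by (intro sum.cong) (auto simp: dual_pair_def)
    also have "\<dots> = of_int (z j)" using j by simp
    finally show False using x0 j(2) by (simp add: tr_def)
  qed
  have "x \<notin> \<rat>"
  proof
    assume xr: "x \<in> \<rat>"
    \<comment> \<open>Index 1 belongs to a small conjugate, and it is available because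
      \<open>l > 1\<close>.\<close>
    have "norm x \<le> t * l" using bound[OF l_gt_1] gal_Rats[OF xr] by (simp add: s_def)
    then have "real l * norm x \<le> real l * (t * l)" by (intro mult_left_mono) auto
    also have "\<dots> = 1 / 2" using l_pos by (simp add: t_def power2_eq_square)
    finally have "norm (tr (x * 1)) \<le> 1 / 2" using tr_of_Rats[OF xr] by (simp add: norm_mult)
    moreover obtain k where k: "tr (x * 1) = of_int k" using tr_int[OF R_1] by (auto elim: Ints_cases)
    ultimately have "k = 0" by simp
    then have "of_nat l * x = 0" using k tr_of_Rats[OF xr] by simp
    then show False using \<open>x \<noteq> 0\<close> l_pos by simp
  qed
  moreover have "norm (gal i x) \<le> real l * S" if "i < l" for i
  proof -
    have "s i * l \<le> S * l" using sS by (intro mult_right_mono) auto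
    then show ?thesis using bound[OF that] by (simp add: mult.commute)
  qed
  ultimately show ?thesis using xK tr_int unfolding S_def by blast
qed

text \<open>Multiplying the small dual element by \<open>l * r\<close> makes it integral, so
  \<open>chi y\<close> has integer coefficients; the bound on its conjugates limits them by the left
  side of the hypothesis on \<open>N\<close>.\<close>

lemma ex_small_generator:
  assumes odd: "odd l" and r: "r > 0" "\<And>p J. prime p \<Longrightarrow> inertial p J \<Longrightarrow> p dvd r"
    and N: "(1 + real l * of_int r * (real l * (2 * (2 * (real l)\<^sup>2) ^ (l - 1)))) ^ l \<le> of_int N"
  shows "\<exists>y\<in>K. y \<notin> \<rat> \<and> (\<exists>p :: int poly. p \<noteq> 0 \<and> degree p \<le> l \<and> (\<forall>k. \<bar>coeff p k\<bar> \<le> N) \<and> poly (of_int_poly p) y = 0)"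
proof -
  define B where "B = real l * (2 * (2 * (real l)\<^sup>2) ^ (l - 1))"
  obtain x where x: "x \<in> K" "x \<notin> \<rat>" "\<And>z. z \<in> R \<Longrightarrow> tr (x * z) \<in> \<int>" "\<And>i. i < l \<Longrightarrow> norm (gal i x) \<le> B"
    using ex_small_dual_element[OF odd] unfolding B_def by blast
  define C where "C = int l * r"
  have C: "C > 0" using l_pos r(1) by (simp add: C_def)
  define y where "y = of_int C * x"
  have yR: "y \<in> R" unfolding y_def C_def by (rule codifferent_bound[OF r x(1,3)])
  have "y \<notin> \<rat>"
  proof
    assume "y \<in> \<rat>"
    then have "y / of_int C \<in> \<rat>" by (intro Rats_divide) auto
    then show False using x(2) C by (simp add: y_def)
  qed
  have yB: "norm (gal i y) \<le> of_int C * B" if "i < l" for i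
    using x(1) x(4)[OF that] C by (simp add: y_def gal_mult norm_mult mult_left_mono)
  have "B \<ge> 0" by (simp add: B_def)
  then have CB: "of_int C * B \<ge> 0" using C by simp
  have "\<forall>k. \<exists>n. coeff (chi y) k = of_int n" using coeff_chi_Ints[OF yR] by (auto elim: Ints_cases)
  then obtain f where f: "\<And>k. coeff (chi y) k = of_int (f k)" by metis
  define p where "p = (\<Sum>k\<le>l. monom (f k) k)"
  have f0: "f k = 0" if "k > l" for k using f[of k] that by (simp add: coeff_eq_0 degree_chi)
  have cp: "coeff p k = f k" for k
  proof -
    have "coeff p k = (if k \<le> l then f k else 0)"
      by (simp add: p_def coeff_sum if_distrib cong: if_cong)
    then show ?thesis using f0[of k] by simp
  qed
  have pchi: "of_int_poly p = chi y" by (rule poly_eqI) (simp add: cp f)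
  have "p \<noteq> 0"
  proof
    assume "p = 0"
    then have "chi y = 0" using pchi by simp
    then show False using coeff_chi_l[of y] by simp
  qed
  moreover have "degree p \<le> l" by (rule degree_le) (simp add: cp f0)
  moreover have "\<bar>coeff p k\<bar> \<le> N" for k
  proof -
    have "norm (coeff (chi y) k) \<le> (1 + of_int C * B) ^ card {..<l}"
      unfolding chi_def using yB CB by (intro norm_coeff_linear_factors_le) auto
    then have "real_of_int \<bar>f k\<bar> \<le> (1 + of_int C * B) ^ l" unfolding f by simp
    also have "\<dots> \<le> of_int N" using N by (simp add: C_def B_def)
    finally show ?thesis unfolding cp by simp
  qed
  moreover have "poly (of_int_poly p) y = 0" unfolding pchi by (rule poly_chi_self)
  ultimately show ?thesis using \<open>y \<notin> \<rat>\<close> R_mem_K[OF yR] by blast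
qed

text \<open>Quadratic fields may be imaginary, so the lattice argument is avoided. Expanding the
  norm of \<open>1 - u\<close> gives \<open>t = 1 + e - d\<close> for the trace \<open>t\<close>,
  whence the bound 3. A rational \<open>u\<close> would be 1 or -1, but then \<open>1 - u\<close> is
  0 or 2.\<close>

lemma quadratic_exceptional_unit:
  assumes l: "l = 2" and u: "exceptional_unit K u"
  shows "u \<in> K" "u \<notin> \<rat>"
    "\<exists>p :: int poly. p \<noteq> 0 \<and> degree p \<le> 2 \<and> (\<forall>k. \<bar>coeff p k\<bar> \<le> 3) \<and> poly (of_int_poly p) u = 0"
proof -
  have uR: "u \<in> R" "1 - u \<in> R" using u unfolding exceptional_unit_def unit_group_def by auto
  show uK: "u \<in> K" by (rule R_mem_K[OF uR(1)])
  obtain e where e: "e \<in> {1,-1}" "nm u = of_int e" using nm_unit u unfolding exceptional_unit_def by blast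
  obtain d where d: "d \<in> {1,-1}" "nm (1 - u) = of_int d" using nm_unit u unfolding exceptional_unit_def by blast
  have set: "{..<l} = {0, 1}" unfolding l by auto
  obtain t where t: "tr u = of_int t" using tr_Ints[OF uR(1)] by (auto elim: Ints_cases)
  have nm: "u * gal 1 u = of_int e" and tr: "u + gal 1 u = of_int t"
    using e(2) t unfolding nm_def tr_def set by simp_all
  have "(1 - u) * (1 - gal 1 u) = of_int d" using d(2) uK unfolding nm_def set by (simp add: gal_diff)
  then have "1 - (u + gal 1 u) + u * gal 1 u = of_int d" by (simp add: algebra_simps)
  then have "(of_int (1 - t + e) :: complex) = of_int d" unfolding nm tr by simp
  then have te: "1 - t + e = d" using of_int_eq_iff by blast
  then have t3: "\<bar>t\<bar> \<le> 3" using e(1) d(1) by auto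
  show "u \<notin> \<rat>"
  proof
    assume "u \<in> \<rat>"
    then obtain a where a: "u = of_int a" using R_Rats[OF uR(1)] by (auto elim: Ints_cases)
    have "(of_int (a * a) :: complex) = of_int e" "(of_int (a + a) :: complex) = of_int t"
      using nm tr unfolding a by simp_all
    then have "a * a = e" "a + a = t" using of_int_eq_iff by blast+
    then have "(1 - a) * (1 - a) = d" "a * a = e" using te by (simp_all add: algebra_simps)
    moreover have "a = 1 \<or> a = -1" using \<open>a * a = e\<close> e(1)
      by (metis abs_zmult_eq_1 abs_minus_cancel abs_one abs_eq_iff' insertE singletonD zero_le_one)
    ultimately show False using d(1) by auto
  qed
  define p where "p = [:e, - t, 1:]"
  have "poly (of_int_poly p) u = of_int e - of_int t * u + u * u" by (simp add: p_def algebra_simps)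
  also have "\<dots> = 0" unfolding nm[symmetric] tr[symmetric] by (simp add: algebra_simps)
  finally have "poly (of_int_poly p) u = 0" .
  moreover have "\<bar>coeff p k\<bar> \<le> 3" for k
    using e(1) t3 by (auto simp: p_def coeff_pCons split: nat.split)
  ultimately show "\<exists>p :: int poly. p \<noteq> 0 \<and> degree p \<le> 2 \<and> (\<forall>k. \<bar>coeff p k\<bar> \<le> 3) \<and> poly (of_int_poly p) u = 0"
    by (intro exI[of _ p]) (auto simp: p_def)
qed

end

theorem theorem1p1:
  fixes l :: nat
  assumes "prime l" and "l \<noteq> 3"
  shows "finite ({K. cyclic_number_field K \<and> degree_over_rat K = l \<and> exceptional K}
                  // number_field_iso_rel)"
proof -
  obtain r :: int where r: "r > 0" "\<forall>e\<in>{1,-1}. \<forall>d\<in>{1,-1}. \<exists>A B :: int poly. \<forall>x :: complex. of_int r =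
      poly (of_int_poly A) x * (x ^ l - of_int e) + poly (of_int_poly B) x * ((1 - x) ^ l - of_int d)"
    using ex_ramification_bound[OF assms] by blast
  \<comment> \<open>The value 3 covers the coefficients in the quadratic case.\<close>
  define N where "N = max 3 \<lceil>(1 + real l * of_int r * (real l * (2 * (2 * (real l)\<^sup>2) ^ (l - 1)))) ^ l\<rceil>"
  define Y where "Y = {y :: complex. \<exists>p :: int poly. p \<noteq> 0 \<and> degree p \<le> l \<and> (\<forall>k. \<bar>coeff p k\<bar> \<le> N) \<and> poly (of_int_poly p) y = 0}"
  define F where "F y = {\<Sum>j<l. of_rat (q j) * y ^ j | q. True}" for y :: complex
  let ?S = "{K. cyclic_number_field K \<and> degree_over_rat K = l \<and> exceptional K}"
  have "K \<in> F ` Y" if K: "K \<in> ?S" for K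
  proof -
    obtain \<sigma> where "cyclic_ext K \<sigma> l" using cyclic_ext_of_prime_degree K assms(1) by blast
    then interpret cyclic_ext K \<sigma> l .
    obtain u where u: "exceptional_unit K u" using K unfolding exceptional_def by blast
    have "\<exists>y\<in>K. y \<notin> \<rat> \<and> y \<in> Y"
    proof (cases "l = 2")
      case True
      obtain p :: "int poly" where p: "p \<noteq> 0" "degree p \<le> 2" "\<And>k. \<bar>coeff p k\<bar> \<le> 3" "poly (of_int_poly p) u = 0"
        using quadratic_exceptional_unit(3)[OF True u] by blast
      have "\<bar>coeff p k\<bar> \<le> N" for k using p(3)[of k] by (simp add: N_def)
      then have "u \<in> Y" unfolding Y_def using p True by blast
      then show ?thesis using quadratic_exceptional_unit(1,2)[OF True u] by blast
    next
      case False
      then have odd: "odd l" using assms(1) prime_odd_nat prime_ge_2_nat[of l] by force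
      have ram: "p dvd r" if "prime p" "inertial p J" for p J
        using inertial_exceptional_unit[OF that u r(2)] .
      have "(1 + real l * of_int r * (real l * (2 * (2 * (real l)\<^sup>2) ^ (l - 1)))) ^ l \<le> of_int N"
        unfolding N_def by linarith
      then have "\<exists>y\<in>K. y \<notin> \<rat> \<and> (\<exists>p :: int poly. p \<noteq> 0 \<and> degree p \<le> l \<and>
          (\<forall>k. \<bar>coeff p k\<bar> \<le> N) \<and> poly (of_int_poly p) y = 0)"
        by (rule ex_small_generator[OF odd r(1), rotated]) (rule ram)
      then show ?thesis unfolding Y_def by blast
    qed
    then obtain y where y: "y \<in> K" "y \<notin> \<rat>" "y \<in> Y" by blast
    have "K = F y" unfolding F_def by (rule generated_by_nonrational[OF y(1,2)])
    then show ?thesis using y(3) by blast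
  qed
  then have "?S \<subseteq> F ` Y" by blast
  moreover have "finite Y" unfolding Y_def by (rule finite_roots_bounded)
  \<comment> \<open>The fields themselves, as subsets of the complex numbers, are finite in number,
    and hence so are their isomorphism classes.\<close>
  ultimately have "finite ?S" using finite_subset by blast
  then show ?thesis unfolding quotient_def by simp
qed

end
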